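(* Let the observations be generated by model $m$ with parameter $\theta_m\in\Theta_m$. Assume: (a) each drift $B\in\{B_{1,m},B_{2,m},B_{3,m},B_{4,m}\}$ is globally Lipschitz and belongs to $C^4_{\uparrow}$, and each process $Y\in\{\xi_m,\delta_m,\varepsilon_m,\zeta_m\}$ satisfies $\sup_t \mathbb{E}[|Y_t|^{\ell}]<\infty$ for all $\ell\ge 0$; (b) each process $Y\in\{\xi_m,\delta_m,\varepsilon_m,\zeta_m\}$ is ergodic with an invariant measure $\pi_Y$: for every $\pi_Y$-integrable $g$, $\frac1T\int_0^T g(Y_t)\,dt\to\int g\,d\pi_Y$ in probability as $T\to\infty$; (c) $\Sigma_{\delta\delta,m}>0$ and $\Sigma_{\varepsilon\varepsilon,m}>0$; (d) $\Psi_m$ is non-singular; (e) $\operatorname{rank}\Lambda_{x_1,m}=k_{1,m}$. Then, as $n\to\infty$ with $h_n\to0$ and $nh_n\to\infty$, $$Q_{XX}\longrightarrow \Sigma_m(\theta_m)\quad\text{in } P_{\theta_m}\text{-probability}.$$ If in addition $nh_n^2\to0$, then $$\sqrt n\,\bigl(\operatorname{vech}Q_{XX}-\operatorname{vech}\Sigma_m(\theta_m)\bigr)\xrightarrow{d}N_{\bar p}\bigl(0,W_m(\theta_m)\bigr).$$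
   Context: Notation. $p=p_1+p_2$, $\bar p=p(p+1)/2$. $|\cdot|$ is the Euclidean norm; $A>0$ means positive definite. For symmetric $A\in\mathbb{R}^{p\times p}$, $\operatorname{vec}A$ and $\operatorname{vech}A$ are the vectorization and half-vectorization, $\mathbb{D}_p$ is the $p^2\times\bar p$ duplication matrix ($\operatorname{vec}A=\mathbb{D}_p\operatorname{vech}A$), and $A^+$ denotes the Moore-Penrose inverse. $C^4_{\uparrow}(\mathbb{R}^d)$ is the set of functions on $\mathbb{R}^d$ that are four times continuously differentiable and which, together with all these derivatives, are of polynomial growth. $N_r(\mu,\Sigma)$ is the $r$-dimensional normal law. Model ($m$ is a model number). $p_1,p_2\ge1$, $k_{1,m}\le p_1$, $k_{2,m}\le p_2$ are fixed integers independent of $n$. The observable process is $X_t=(X_{1,t}^\top,X_{2,t}^\top)^\top\in\mathbb{R}^{p_1+p_2}$ with $$X_{1,t}=\Lambda_{x_1,m}\xi_{m,t}+\delta_{m,t},\quad X_{2,t}=\Lambda_{x_2,m}\eta_{m,t}+\varepsilon_{m,t},\quad \eta_{m,t}=B_{0,m}\eta_{m,t}+\Gamma_m\xi_{m,t}+\zeta_{m,t},$$ where $\Lambda_{x_1,m}\in\mathbb{R}^{p_1\times k_{1,m}}$, $\Lambda_{x_2,m}\in\mathbb{R}^{p_2\times k_{2,m}}$, $\Gamma_m\in\mathbb{R}^{k_{2,m}\times k_{1,m}}$, $B_{0,m}\in\mathbb{R}^{k_{2,m}\times k_{2,m}}$ (zero diagonal) are constant, and $\Psi_m=\mathbb{I}_{k_{2,m}}-B_{0,m}$.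 The latent processes (dimensions $k_{1,m},p_1,p_2,k_{2,m}$) solve $$d\xi_{m,t}=B_{1,m}(\xi_{m,t})dt+S_{1,m}dW_{1,t},\quad d\delta_{m,t}=B_{2,m}(\delta_{m,t})dt+S_{2,m}dW_{2,t},$$ $$d\varepsilon_{m,t}=B_{3,m}(\varepsilon_{m,t})dt+S_{3,m}dW_{3,t},\quad d\zeta_{m,t}=B_{4,m}(\zeta_{m,t})dt+S_{4,m}dW_{4,t},$$ with deterministic initial values, constant matrices $S_{i,m}$, and independent standard Wiener processes $W_1,\dots,W_4$ of dimensions $r_1,\dots,r_4$. Put $\Sigma_{\xi\xi,m}=S_{1,m}S_{1,m}^\top$, $\Sigma_{\delta\delta,m}=S_{2,m}S_{2,m}^\top$, $\Sigma_{\varepsilon\varepsilon,m}=S_{3,m}S_{3,m}^\top$, $\Sigma_{\zeta\zeta,m}=S_{4,m}S_{4,m}^\top$. Parameter. $\theta_m\in\Theta_m$, with $\Theta_m\subset\mathbb{R}^{q_m}$ convex and compact, collects the unknown, non-duplicated entries of $\Lambda_{x_1,m},\Lambda_{x_2,m},\Gamma_m,\Psi_m,\Sigma_{\xi\xi,m},\Sigma_{\delta\delta,m},\Sigma_{\varepsilon\varepsilon,m},\Sigma_{\zeta\zeta,m}$ (all other entries are known constants or equal to other entries), so these matrices are functions of $\theta_m$. $P_{\theta_m}$ is the law under parameter $\theta_m$. The covariance structure is $$\Sigma_m(\theta_m)=\begin{pmatrix}\Sigma_{X_1X_1,m}&\Sigma_{X_1X_2,m}\\ \Sigma_{X_1X_2,m}^\top&\Sigma_{X_2X_2,m}\end{pmatrix},$$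 $\Sigma_{X_1X_1,m}=\Lambda_{x_1,m}\Sigma_{\xi\xi,m}\Lambda_{x_1,m}^\top+\Sigma_{\delta\delta,m}$, $\Sigma_{X_1X_2,m}=\Lambda_{x_1,m}\Sigma_{\xi\xi,m}\Gamma_m^\top\Psi_m^{-1\top}\Lambda_{x_2,m}^\top$, $\Sigma_{X_2X_2,m}=\Lambda_{x_2,m}\Psi_m^{-1}(\Gamma_m\Sigma_{\xi\xi,m}\Gamma_m^\top+\Sigma_{\zeta\zeta,m})\Psi_m^{-1\top}\Lambda_{x_2,m}^\top+\Sigma_{\varepsilon\varepsilon,m}$. Observations. $X_{t_i^n}$ with $t_i^n=ih_n$, $0\le i\le n$, $T=nh_n$, and $Q_{XX}=\frac1T\sum_{i=1}^n(X_{t_i^n}-X_{t_{i-1}^n})(X_{t_i^n}-X_{t_{i-1}^n})^\top$. $W_m(\theta_m)=2\,\mathbb{D}_p^{+}\bigl(\Sigma_m(\theta_m)\otimes\Sigma_m(\theta_m)\bigr)\mathbb{D}_p^{+\top}$. *)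

theory Defs
  imports "HOL-Probability.Probability"
begin

section \<open>Matrices\<close>

text \<open>A \<open>p \<times> q\<close> matrix is an element of \<^typ>\<open>real^'q^'p\<close>. Vectors and matrices of
  dimension \<open>p\<^sub>1 + p\<^sub>2\<close> are indexed by the sum type, the first block coming first.\<close>

instantiation sum :: (linorder, linorder) linorder
begin

fun less_eq_sum :: "'a + 'b \<Rightarrow> 'a + 'b \<Rightarrow> bool" where
  "less_eq_sum (Inl a) (Inl b) \<longleftrightarrow> a \<le> b"
| "less_eq_sum (Inl a) (Inr b) \<longleftrightarrow> True"
| "less_eq_sum (Inr a) (Inl b) \<longleftrightarrow> False"
| "less_eq_sum (Inr a) (Inr b) \<longleftrightarrow> a \<le> b"

definition less_sum :: "'a + 'b \<Rightarrow> 'a + 'b \<Rightarrow> bool" where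
  "less_sum x y \<longleftrightarrow> x \<le> y \<and> \<not> y \<le> x"

instance
proof
  fix x y z :: "'a + 'b"
  show "x < y \<longleftrightarrow> x \<le> y \<and> \<not> y \<le> x" by (rule less_sum_def)
  show "x \<le> x" by (cases x) auto
  show "x \<le> y \<Longrightarrow> y \<le> z \<Longrightarrow> x \<le> z" by (cases x; cases y; cases z) auto
  show "x \<le> y \<Longrightarrow> y \<le> x \<Longrightarrow> x = y" by (cases x; cases y) auto
  show "x \<le> y \<or> y \<le> x" by (cases x; cases y) auto
qed

end

definition stack :: "real^'a \<Rightarrow> real^'b \<Rightarrow> real^('a + 'b)" where
  "stack x y = (\<chi> i. case i of Inl a \<Rightarrow> x $ a | Inr b \<Rightarrow> y $ b)"

definition block_matrix ::
  "real^'c^'a \<Rightarrow> real^'d^'a \<Rightarrow> real^'c^'b \<Rightarrow> real^'d^'b \<Rightarrow> real^('c + 'd)^('a + 'b)" where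
  "block_matrix A B C D =
     (\<chi> i. case i of Inl a \<Rightarrow> stack (A $ a) (B $ a) | Inr b \<Rightarrow> stack (C $ b) (D $ b))"

definition pos_def :: "real^'n^'n \<Rightarrow> bool" where
  "pos_def A \<longleftrightarrow> transpose A = A \<and> (\<forall>x. x \<noteq> 0 \<longrightarrow> 0 < x \<bullet> (A *v x))"

definition outer :: "real^'n \<Rightarrow> real^'m \<Rightarrow> real^'m^'n" where
  "outer x y = (\<chi> i j. x $ i * y $ j)"

definition kronecker :: "real^'b^'a \<Rightarrow> real^'d^'c \<Rightarrow> real^('b \<times> 'd)^('a \<times> 'c)" where
  "kronecker A B = (\<chi> ik jl. A $ fst ik $ fst jl * B $ snd ik $ snd jl)"

definition moore_penrose :: "real^'n^'m \<Rightarrow> real^'m^'n" where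
  "moore_penrose A = (THE X. A ** X ** A = A \<and> X ** A ** X = X \<and>
     transpose (A ** X) = A ** X \<and> transpose (X ** A) = X ** A)"

text \<open>In the index pairs of \<open>vec\<close> and \<open>vech\<close> the column index comes first, so that the
  lexicographic order of the pairs is the order in which the columns are stacked.
  The pairs with column index at most row index are the positions of the lower triangle.\<close>

typedef (overloaded) ('n :: "{finite, linorder}") tri = "{(j :: 'n, i). j \<le> i}"
  by auto

instance tri :: ("{finite, linorder}") finite
proof
  have "UNIV = (Abs_tri :: 'a \<times> 'a \<Rightarrow> 'a tri) ` {(j, i). j \<le> i}"
    using type_definition.Abs_image[OF type_definition_tri] by metis
  then show "finite (UNIV :: 'a tri set)" by (metis finite finite_imageI)
qed

definition vec_mat :: "real^'n^'m \<Rightarrow> real^('n \<times> 'm)" where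
  "vec_mat A = (\<chi> ji. A $ snd ji $ fst ji)"

definition vech :: "real^('n :: {finite, linorder})^('n :: {finite, linorder}) \<Rightarrow> real^(('n :: {finite, linorder}) tri)" where
  "vech A = (\<chi> v. A $ snd (Rep_tri v) $ fst (Rep_tri v))"

definition duplication :: "real^(('n :: {finite, linorder}) tri)^(('n :: {finite, linorder}) \<times> ('n :: {finite, linorder}))" where
  "duplication = (\<chi> ji v. of_bool (Rep_tri v = (min (fst ji) (snd ji), max (fst ji) (snd ji))))"

lemma card_tri: "CARD('n :: {finite, linorder} tri) = CARD('n) * (CARD('n) + 1) div 2"
proof -
  let ?L = "{(j :: 'n, i). j \<le> i}" and ?U = "{(j :: 'n, i). i \<le> j}"
  have tri: "CARD('n tri) = card ?L"
    by (rule type_definition.card[OF type_definition_tri])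
  have "card ?U = card (prod.swap ` ?L)"
    by (rule arg_cong[where f = card]) force
  then have U: "card ?U = card ?L" by (simp add: card_image)
  have "?L \<union> ?U = UNIV" by auto
  then have un: "card (?L \<union> ?U) = CARD('n) * CARD('n)" by (simp add: card_prod)
  have "?L \<inter> ?U = (\<lambda>x. (x, x)) ` UNIV" by auto
  then have int: "card (?L \<inter> ?U) = CARD('n)" by (simp add: card_image inj_on_def)
  have "card ?L + card ?U = card (?L \<union> ?U) + card (?L \<inter> ?U)"
    by (rule card_Un_Int) auto
  then show ?thesis using tri U un int by simp
qed

lemma vec_mat_duplication:
  fixes A :: "real^('n :: {finite, linorder})^('n :: {finite, linorder})"
  assumes "transpose A = A"
  shows "vec_mat A = duplication *v vech A"
proof -
  have sym: "A $ i $ j = A $ j $ i" for i j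
    using assms by (metis transpose_def vec_lambda_beta)
  have "(duplication *v vech A) $ (j, i) = A $ i $ j" for i j
  proof -
    let ?v = "Abs_tri (min j i, max j i)"
    have rep: "Rep_tri ?v = (min j i, max j i)" by (rule Abs_tri_inverse) (auto simp: min_def max_def)
    have eq: "Rep_tri v = (min j i, max j i) \<longleftrightarrow> v = ?v" for v
      using rep by (metis Rep_tri_inverse)
    have "(duplication *v vech A) $ (j, i) = (\<Sum>v\<in>UNIV. of_bool (v = ?v) * vech A $ v)"
      by (simp add: matrix_vector_mult_def duplication_def eq)
    also have "\<dots> = vech A $ ?v" by (simp add: of_bool_def if_distrib[of "\<lambda>x. x * _"] cong: if_cong)
    also have "\<dots> = A $ i $ j" by (simp add: vech_def rep) (simp add: min_def max_def sym[of j i])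
    finally show ?thesis .
  qed
  then show ?thesis by (simp add: vec_mat_def vec_eq_iff)
qed


section \<open>Regularity of the drifts\<close>

definition poly_growth :: "('a :: real_normed_vector \<Rightarrow> 'b :: real_normed_vector) \<Rightarrow> bool" where
  "poly_growth f \<longleftrightarrow> (\<exists>C N. \<forall>x. norm (f x) \<le> C * (1 + norm x) ^ N)"

text \<open>\<open>C_poly k f\<close>: \<open>f\<close> is \<open>k\<close> times continuously differentiable, and \<open>f\<close> and its iterated
  partial derivatives of order at most \<open>k\<close> are of polynomial growth.\<close>

primrec C_poly :: "nat \<Rightarrow> ('a :: euclidean_space \<Rightarrow> 'b :: real_normed_vector) \<Rightarrow> bool" where
  "C_poly 0 f \<longleftrightarrow> continuous_on UNIV f \<and> poly_growth f"
| "C_poly (Suc k) f \<longleftrightarrow> poly_growth f \<and> (\<forall>x. f differentiable (at x)) \<and>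
     (\<forall>b\<in>Basis. C_poly k (\<lambda>x. frechet_derivative f (at x) b))"


section \<open>Probability\<close>

definition is_normal_law :: "real^'n \<Rightarrow> real^'n^'n \<Rightarrow> (real^'n) measure \<Rightarrow> bool" where
  "is_normal_law \<mu> V N \<longleftrightarrow> prob_space N \<and> sets N = sets borel \<and>
     (\<forall>u. (\<integral>x. iexp (u \<bullet> x) \<partial>N) =
        exp (\<i> * complex_of_real (u \<bullet> \<mu>) - complex_of_real (u \<bullet> (V *v u)) / 2))"

definition converges_in_distribution ::
  "'w measure \<Rightarrow> (nat \<Rightarrow> 'w \<Rightarrow> 'b) \<Rightarrow> ('b :: topological_space) measure \<Rightarrow> bool" where
  "converges_in_distribution P Z N \<longleftrightarrow>
     (\<forall>f :: 'b \<Rightarrow> real. continuous_on UNIV f \<and> bounded (range f) \<longrightarrow>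
        (\<lambda>n. \<integral>\<omega>. f (Z n \<omega>) \<partial>P) \<longlonglongrightarrow> (\<integral>x. f x \<partial>N))"

text \<open>The completion matters for time averages of processes whose paths are continuous only
  almost surely: these averages are measurable for the completion, but possibly not for \<open>P\<close>.\<close>

definition converges_in_prob ::
  "'w measure \<Rightarrow> 'i filter \<Rightarrow> ('i \<Rightarrow> 'w \<Rightarrow> 'b :: metric_space) \<Rightarrow> 'b \<Rightarrow> bool" where
  "converges_in_prob P F Z z \<longleftrightarrow>
     (\<forall>\<epsilon>>0. ((\<lambda>i. measure (completion P) {\<omega> \<in> space P. \<epsilon> < dist (Z i \<omega>) z}) \<longlongrightarrow> 0) F)"

text \<open>The events generated by a process over the time set \<open>I\<close>.\<close>

definition process_events ::
  "'w measure \<Rightarrow> real set \<Rightarrow> (real \<Rightarrow> 'w \<Rightarrow> 'b :: topological_space) \<Rightarrow> 'w set set" where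
  "process_events P I Y = sigma_sets (space P) {Y t -` A \<inter> space P | t A. t \<in> I \<and> A \<in> sets borel}"

definition wiener_process :: "'w measure \<Rightarrow> (real \<Rightarrow> 'w \<Rightarrow> real^'r) \<Rightarrow> bool" where
  "wiener_process P W \<longleftrightarrow>
     (\<forall>t\<ge>0. W t \<in> borel_measurable P) \<and>
     (AE \<omega> in P. W 0 \<omega> = 0 \<and> continuous_on {0..} (\<lambda>t. W t \<omega>)) \<and>
     (\<forall>s t. 0 \<le> s \<and> s < t \<longrightarrow>
        is_normal_law 0 (mat (t - s)) (distr P borel (\<lambda>\<omega>. W t \<omega> - W s \<omega>)) \<and>
        prob_space.indep_set P (process_events P {0..s} W)
          {(\<lambda>\<omega>. W t \<omega> - W s \<omega>) -` A \<inter> space P | A. A \<in> sets borel})"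

text \<open>\<open>Y\<close> solves \<open>dY\<^sub>t = B(Y\<^sub>t) dt + S dW\<^sub>t\<close>, \<open>Y\<^sub>0 = y\<^sub>0\<close>. The diffusion coefficient \<open>S\<close> is a
  constant matrix, so the stochastic integral of \<open>S\<close> over \<open>[0, t]\<close> is \<open>S W\<^sub>t\<close>.\<close>

definition solves_sde :: "'w measure \<Rightarrow> (real^'k \<Rightarrow> real^'k) \<Rightarrow> real^'r^'k \<Rightarrow> real^'k \<Rightarrow>
    (real \<Rightarrow> 'w \<Rightarrow> real^'r) \<Rightarrow> (real \<Rightarrow> 'w \<Rightarrow> real^'k) \<Rightarrow> bool" where
  "solves_sde P B S y0 W Y \<longleftrightarrow>
     (\<forall>t\<ge>0. Y t \<in> borel_measurable P) \<and>
     (AE \<omega> in P. continuous_on {0..} (\<lambda>t. Y t \<omega>) \<and>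
        (\<forall>t\<ge>0. Y t \<omega> = y0 + integral {0..t} (\<lambda>s. B (Y s \<omega>)) + S *v W t \<omega>))"

definition bounded_moments ::
  "'w measure \<Rightarrow> (real \<Rightarrow> 'w \<Rightarrow> 'b :: real_normed_vector) \<Rightarrow> bool" where
  "bounded_moments P Y \<longleftrightarrow> (\<forall>l :: real. 0 \<le> l \<longrightarrow>
     (SUP t\<in>{0..}. \<integral>\<^sup>+\<omega>. ennreal (norm (Y t \<omega>) powr l) \<partial>P) < \<infinity>)"

definition ergodic_with ::
  "'w measure \<Rightarrow> (real \<Rightarrow> 'w \<Rightarrow> 'b :: topological_space) \<Rightarrow> 'b measure \<Rightarrow> bool" where
  "ergodic_with P Y \<pi> \<longleftrightarrow> prob_space \<pi> \<and> sets \<pi> = sets borel \<and>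
     (\<forall>g :: 'b \<Rightarrow> real. integrable \<pi> g \<longrightarrow>
        converges_in_prob P at_top (\<lambda>T \<omega>. (1 / T) * (LINT t:{0..T}|lborel. g (Y t \<omega>)))
          (\<integral>y. g y \<partial>\<pi>))"


section \<open>The model\<close>

definition entries :: "(real^'q \<Rightarrow> real^'b^'a) \<Rightarrow> (real^'q \<Rightarrow> real) set" where
  "entries M = {\<lambda>\<theta>. M \<theta> $ i $ j | i j. True}"

text \<open>The parameter collects the unknown, non-duplicated entries among \<open>E\<close>: every entry is
  either constant or a coordinate of the parameter, and every coordinate is an entry.\<close>

definition collects_entries :: "(real^'q) set \<Rightarrow> (real^'q \<Rightarrow> real) set \<Rightarrow> bool" where
  "collects_entries \<Theta> E \<longleftrightarrow>
     (\<forall>f\<in>E. (\<exists>c. \<forall>\<theta>\<in>\<Theta>. f \<theta> = c) \<or> (\<exists>j. \<forall>\<theta>\<in>\<Theta>. f \<theta> = \<theta> $ j)) \<and>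
     (\<forall>j. \<exists>f\<in>E. \<forall>\<theta>\<in>\<Theta>. f \<theta> = \<theta> $ j)"

definition cov_structure :: "real^'k1^'p1 \<Rightarrow> real^'k2^'p2 \<Rightarrow> real^'k1^'k2 \<Rightarrow> real^'k2^'k2 \<Rightarrow>
    real^'k1^'k1 \<Rightarrow> real^'p1^'p1 \<Rightarrow> real^'p2^'p2 \<Rightarrow> real^'k2^'k2 \<Rightarrow> real^('p1 + 'p2)^('p1 + 'p2)" where
  "cov_structure Lx1 Lx2 \<Gamma> \<Psi> \<Sigma>\<xi> \<Sigma>\<delta> \<Sigma>\<epsilon> \<Sigma>\<zeta> =
     (let \<Psi>i = matrix_inv \<Psi>;
          \<Sigma>11 = Lx1 ** \<Sigma>\<xi> ** transpose Lx1 + \<Sigma>\<delta>;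
          \<Sigma>12 = Lx1 ** \<Sigma>\<xi> ** transpose \<Gamma> ** transpose \<Psi>i ** transpose Lx2;
          \<Sigma>22 = Lx2 ** \<Psi>i ** (\<Gamma> ** \<Sigma>\<xi> ** transpose \<Gamma> + \<Sigma>\<zeta>) ** transpose \<Psi>i ** transpose Lx2 + \<Sigma>\<epsilon>
      in block_matrix \<Sigma>11 \<Sigma>12 (transpose \<Sigma>12) \<Sigma>22)"

definition realized_cov :: "(real \<Rightarrow> 'w \<Rightarrow> real^'p) \<Rightarrow> real \<Rightarrow> nat \<Rightarrow> 'w \<Rightarrow> real^'p^'p" where
  "realized_cov X h n \<omega> = (1 / (real n * h)) *\<^sub>R
     (\<Sum>i=1..n. outer (X (real i * h) \<omega> - X (real (i - 1) * h) \<omega>)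
                      (X (real i * h) \<omega> - X (real (i - 1) * h) \<omega>))"

definition asym_cov ::
  "real^('p :: {finite, linorder})^('p :: {finite, linorder})
     \<Rightarrow> real^(('p :: {finite, linorder}) tri)^(('p :: {finite, linorder}) tri)" where
  "asym_cov \<Sigma> =
     2 *\<^sub>R (moore_penrose duplication ** kronecker \<Sigma> \<Sigma> ** transpose (moore_penrose duplication))"

end

theory Submission
  imports Defs
begin

text \<open>The four latent processes, stacked into one vector \<open>Y\<close>, solve a single equation
\<open>dY = B(Y) dt + S dW\<close> with a Lipschitz drift and a Wiener process \<open>W\<close>, because independent Wiener
processes stack to a Wiener process (\<open>wiener_process_stack\<close>, \<open>solves_sde_stack\<close>). Solving the
structural equation for \<open>\<eta>\<close> makes the observation a linear image \<open>X = A Y\<close>, and the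
covariance structure is \<open>G G\<^sup>T\<close> with \<open>G = A S\<close> (\<open>cov_structure_factorization\<close>). The theorem is thus a
statement about the realized covariance of a linear image of one diffusion.

Over a step of length \<open>h\<close> the increment of \<open>X\<close> is \<open>\<surd>h Z\<^sub>k + D\<^sub>k\<close>, where \<open>Z\<^sub>k = G g\<^sub>k\<close> with
independent standard Gaussian vectors \<open>g\<^sub>k\<close>, and \<open>D\<^sub>k\<close> comes from the integral of the drift. Expanding the
outer products, the realized covariance minus \<open>G G\<^sup>T\<close> is the average of the centred
\<open>Z\<^sub>k Z\<^sub>k\<^sup>T\<close> plus a remainder, whose mean absolute value is at most a constant times
\<open>h + \<surd>(h/n)\<close> (\<open>remainder_bound\<close>). The products \<open>D\<^sub>k D\<^sub>k\<^sup>T\<close> contribute \<open>h\<close>. The cross products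
\<open>D\<^sub>k Z\<^sub>k\<^sup>T\<close> need care: the crude bound \<open>\<surd>h\<close> does not survive multiplication by \<open>\<surd>n\<close>.
Replacing the drift by its value at the beginning of the step costs only \<open>h\<close>, since the Lipschitz
drift moves by the order of \<open>\<surd>h\<close> in root mean square during a step; and the frozen drift is a function of the past,
hence independent of \<open>g\<^sub>k\<close>, so that the remaining products are orthogonal and their average is of order
\<open>\<surd>(h/n)\<close> (\<open>innovation_cross_sum_bound\<close>). That \<open>Y\<close> is a function of the past of \<open>W\<close> is a consequence
of the equation: for a Lipschitz drift the Euler scheme converges along every path
(\<open>sde_solution_adapted\<close>).

The average of the centred products has variance of order \<open>1/n\<close>, so all errors vanish when
\<open>n \<rightarrow> \<infinity>\<close> and \<open>h \<rightarrow> 0\<close>, which is the consistency. After multiplication by \<open>\<surd>n\<close> the remainder is of order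
\<open>\<surd>(n h\<^sup>2) + \<surd>h\<close> and vanishes when \<open>n h\<^sup>2 \<rightarrow> 0\<close>, and the main term is a normalized sum of
independent variables, whose characteristic function is controlled by a third order expansion
(\<open>innovation_clt\<close>). Its variance comes from the fourth moments of Gaussian vectors, and it agrees with the
quadratic form of \<open>2 D\<^sup>+ (\<Sigma> \<otimes> \<Sigma>) D\<^sup>+\<^sup>T\<close> because \<open>D\<^sup>+\<close>, for the duplication
matrix \<open>D\<close>, averages the two entries at mirrored positions (\<open>moore_penrose_duplication\<close>,
\<open>asym_cov_entry\<close>). Given bounded first moments, convergence of characteristic functions implies convergence in
distribution, since test functions can be approximated by trigonometric polynomials (\<open>levy_continuity_euclidean\<close>).\<close>

section \<open>Convergence in distribution from characteristic functions\<close>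

text \<open>Trigonometric polynomials with arbitrary real frequencies. The phase \<open>b\<close> makes sines available, and
writing every function as a sum of waves turns a statement about characteristic functions into one
about the whole class; products stay in the class since a product of two cosines is a sum of two.\<close>

inductive trig_poly :: "('a::real_inner \<Rightarrow> real) \<Rightarrow> bool" where
  wave: "trig_poly (\<lambda>x. a * cos (u \<bullet> x + b))"
| add: "trig_poly f \<Longrightarrow> trig_poly g \<Longrightarrow> trig_poly (\<lambda>x. f x + g x)"

lemma trig_poly_const: "trig_poly (\<lambda>x. c)"
  using wave[of c 0 0] by simp

lemma trig_poly_mult_wave:
  "trig_poly g \<Longrightarrow> trig_poly (\<lambda>x. a * cos (u \<bullet> x + b) * g x)"
proof (induction rule: trig_poly.induct)
  case (wave a' u' b')
  have "a * cos (u \<bullet> x + b) * (a' * cos (u' \<bullet> x + b')) =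
      (a * a' / 2) * cos ((u - u') \<bullet> x + (b - b')) + (a * a' / 2) * cos ((u + u') \<bullet> x + (b + b'))" for x
    using cos_times_cos[of "u \<bullet> x + b" "u' \<bullet> x + b'"]
    by (simp add: inner_diff_left inner_add_left algebra_simps add_divide_distrib)
  then have "(\<lambda>x. a * cos (u \<bullet> x + b) * (a' * cos (u' \<bullet> x + b'))) =
      (\<lambda>x. (a * a' / 2) * cos ((u - u') \<bullet> x + (b - b')) + (a * a' / 2) * cos ((u + u') \<bullet> x + (b + b')))"
    by (rule ext)
  then show ?case by (simp only: trig_poly.add[OF trig_poly.wave trig_poly.wave])
next
  case (add f g)
  then show ?case using trig_poly.add by (fastforce simp: distrib_left)
qed

lemma trig_poly_mult:
  "trig_poly f \<Longrightarrow> trig_poly g \<Longrightarrow> trig_poly (\<lambda>x. f x * g x)"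
proof (induction rule: trig_poly.induct)
  case (wave a u b)
  then show ?case by (rule trig_poly_mult_wave)
next
  case (add f g')
  then show ?case using trig_poly.add by (fastforce simp: distrib_right)
qed

lemma trig_poly_compose_polynomial:
  assumes "real_polynomial_function \<phi>" "trig_poly p"
  shows "trig_poly (\<lambda>x. \<phi> (p x))"
  using assms(1)
proof (induction rule: real_polynomial_function.induct)
  case (linear l)
  then have "l y = l 1 * y" for y
    using linear_cmul[OF bounded_linear.linear[OF linear], of y 1] by simp
  then have "(\<lambda>x. l (p x)) = (\<lambda>x. l 1 * p x)" by (intro ext)
  then show ?case by (simp only: trig_poly_mult[OF trig_poly_const assms(2)])
qed (auto intro: trig_poly_const trig_poly.add trig_poly_mult)

lemma trig_poly_continuous: "trig_poly f \<Longrightarrow> continuous_on S f"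
  by (induction rule: trig_poly.induct) (auto intro!: continuous_intros)

lemma trig_poly_separates:
  fixes x y :: "'a::real_inner"
  assumes "x \<noteq> y"
  shows "\<exists>f. trig_poly f \<and> f x \<noteq> f y"
proof -
  \<comment> \<open>The frequency is normalized so that the phases at \<open>x\<close> and \<open>y\<close> differ by one.\<close>
  define u where "u = (1 / ((x - y) \<bullet> (x - y))) *\<^sub>R (x - y)"
  have "u \<bullet> (x - y) = 1" using assms by (simp add: u_def)
  then have x: "u \<bullet> x + - (u \<bullet> y) = 1" by (simp add: inner_diff_right)
  have "cos (1::real) < cos 0"
    by (rule cos_monotone_0_pi) (use pi_gt3 in auto)
  then have "1 * cos (u \<bullet> x + - (u \<bullet> y)) \<noteq> 1 * cos (u \<bullet> y + - (u \<bullet> y))"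
    unfolding x by simp
  then show ?thesis using wave[of 1 u "- (u \<bullet> y)"] by blast
qed

text \<open>By Stone--Weierstrass a trigonometric polynomial \<open>p\<close> approximates \<open>f\<close> on \<open>K\<close>, but away from \<open>K\<close> it
may be much larger than \<open>B\<close>. Its range is bounded, and on that range a polynomial \<open>\<phi>\<close> is close to
the truncation at \<open>\<plusminus>B\<close>. Then \<open>\<phi> \<circ> p\<close> is again a trigonometric polynomial, it is still close to \<open>f\<close>
on \<open>K\<close>, and it obeys the bound everywhere.\<close>

lemma trig_poly_approx:
  fixes f :: "'a::euclidean_space \<Rightarrow> real"
  assumes K: "compact K" and f: "continuous_on K f" and B: "\<And>x. x \<in> K \<Longrightarrow> \<bar>f x\<bar> \<le> B"
    and B0: "0 \<le> B" and e: "0 < e"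
  obtains q where "trig_poly q" "\<And>x. \<bar>q x\<bar> \<le> B + e" "\<And>x. x \<in> K \<Longrightarrow> \<bar>f x - q x\<bar> \<le> e"
proof -
  interpret function_ring_on "Collect trig_poly" K
    using K by unfold_locales
      (auto intro: trig_poly_continuous trig_poly.add trig_poly_mult trig_poly_const
        dest: trig_poly_separates)
  obtain p where p: "trig_poly p" "\<And>x. x \<in> K \<Longrightarrow> \<bar>f x - p x\<bar> < e / 2"
    using Stone_Weierstrass_basic[OF f, of "e / 2"] e by auto
  have bdd: "\<exists>M. \<forall>x. \<bar>p x\<bar> \<le> M"
    using p(1)
  proof (induction rule: trig_poly.induct)
    case (wave a u b)
    have "\<bar>a * cos (u \<bullet> x + b)\<bar> \<le> \<bar>a\<bar>" for x
      by (simp add: abs_mult mult_left_le)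
    then show ?case by blast
  next
    case (add f g)
    then obtain M N where "\<And>x. \<bar>f x\<bar> \<le> M" "\<And>x. \<bar>g x\<bar> \<le> N" by blast
    then have "\<bar>f x + g x\<bar> \<le> M + N" for x
      using abs_triangle_ineq[of "f x" "g x"] add_mono[of "\<bar>f x\<bar>" M "\<bar>g x\<bar>" N] by (meson order_trans)
    then show ?case by blast
  qed
  then obtain M where M: "\<And>x. \<bar>p x\<bar> \<le> M" by blast
  \<comment> \<open>The truncation fixes the values of \<open>f\<close>, so truncating \<open>p\<close> does not increase its distance to \<open>f\<close>.\<close>
  define c where "c y = max (- B) (min B y)" for y :: real
  have "continuous_on {-M..M} c" unfolding c_def by (intro continuous_intros)
  then obtain \<phi> where \<phi>: "real_polynomial_function \<phi>"
      "\<And>y. y \<in> {-M..M} \<Longrightarrow> \<bar>c y - \<phi> y\<bar> < e / 2"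
    using Stone_Weierstrass_real_polynomial_function[of "{-M..M}" c "e / 2"] e by auto
  have \<phi>p: "\<bar>c (p x) - \<phi> (p x)\<bar> < e / 2" for x
    using \<phi>(2)[of "p x"] M[of x] by (simp add: abs_le_iff minus_le_iff)
  show ?thesis
  proof
    show "trig_poly (\<lambda>x. \<phi> (p x))" by (rule trig_poly_compose_polynomial[OF \<phi>(1) p(1)])
    have "\<bar>c (p x)\<bar> \<le> B" for x using B0 by (auto simp: c_def)
    note cB = this
    show "\<bar>\<phi> (p x)\<bar> \<le> B + e" for x
      using \<phi>p[of x] cB[of x] e by linarith
    show "\<bar>f x - \<phi> (p x)\<bar> \<le> e" if "x \<in> K" for x
    proof -
      have "\<bar>c (p x) - f x\<bar> \<le> \<bar>p x - f x\<bar>" using B[OF that] by (auto simp: c_def)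
      then show ?thesis using \<phi>p[of x] p(2)[OF that] by linarith
    qed
  qed
qed

lemma (in prob_space) trig_poly_integrable:
  fixes Z :: "'a \<Rightarrow> 'b::euclidean_space"
  assumes [measurable]: "Z \<in> borel_measurable M" and q: "trig_poly q"
  shows "integrable M (\<lambda>\<omega>. q (Z \<omega>))"
  using q
proof (induction rule: trig_poly.induct)
  case (wave a u b)
  show ?case by (rule integrable_const_bound[where B="\<bar>a\<bar>"]) (auto simp: abs_mult mult_left_le)
qed auto

lemma (in prob_space) wave_expectation:
  fixes Z :: "'a \<Rightarrow> 'b::euclidean_space"
  assumes [measurable]: "Z \<in> borel_measurable M"
  shows "(\<integral>\<omega>. cos (u \<bullet> Z \<omega> + b) \<partial>M) = Re (iexp b * (\<integral>\<omega>. iexp (u \<bullet> Z \<omega>) \<partial>M))"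
proof -
  have int: "integrable M (\<lambda>\<omega>. iexp (u \<bullet> Z \<omega>))"
    by (rule integrable_const_bound[where B=1]) auto
  have "Re (iexp b * (\<integral>\<omega>. iexp (u \<bullet> Z \<omega>) \<partial>M)) = Re (\<integral>\<omega>. iexp b * iexp (u \<bullet> Z \<omega>) \<partial>M)"
    by (simp add: int)
  also have "\<dots> = (\<integral>\<omega>. Re (iexp b * iexp (u \<bullet> Z \<omega>)) \<partial>M)"
    by (rule integral_Re[symmetric]) (intro integrable_mult_right int)
  also have "\<dots> = (\<integral>\<omega>. cos (u \<bullet> Z \<omega> + b) \<partial>M)"
    by (simp add: Re_exp cos_add exp_eq_polar cis.code mult.commute)
  finally show ?thesis by simp
qed

lemma trig_poly_expectation_converges:
  fixes Z :: "nat \<Rightarrow> 'w \<Rightarrow> 'b::euclidean_space"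
  assumes P: "prob_space P" and Z: "\<And>n. Z n \<in> borel_measurable P"
    and N: "prob_space N" "sets N = sets borel"
    and char: "\<And>u. (\<lambda>n. \<integral>\<omega>. iexp (u \<bullet> Z n \<omega>) \<partial>P) \<longlonglongrightarrow> (\<integral>x. iexp (u \<bullet> x) \<partial>N)"
    and q: "trig_poly q"
  shows "(\<lambda>n. \<integral>\<omega>. q (Z n \<omega>) \<partial>P) \<longlonglongrightarrow> (\<integral>x. q x \<partial>N)"
  using q
proof (induction rule: trig_poly.induct)
  case (wave a u b)
  have id: "(\<lambda>x. x) \<in> borel_measurable N" by (simp add: measurable_def space_borel N(2) sets_eq_imp_space_eq[OF N(2)])
  show ?case
    by (simp add: prob_space.wave_expectation[OF P Z] prob_space.wave_expectation[OF N(1) id])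
      (intro tendsto_intros char)
next
  case (add f g)
  have id: "(\<lambda>x. x) \<in> borel_measurable N" by (simp add: measurable_def space_borel N(2) sets_eq_imp_space_eq[OF N(2)])
  note i = prob_space.trig_poly_integrable[OF P Z] prob_space.trig_poly_integrable[OF N(1) id]
  show ?case using add by (simp add: i tendsto_add)
qed

lemma (in prob_space) expectation_diff_le_off_compact:
  fixes Z :: "'a \<Rightarrow> 'b::euclidean_space" and f q :: "'b \<Rightarrow> real"
  assumes Z[measurable]: "Z \<in> borel_measurable M" and [measurable]: "f \<in> borel_measurable borel" "q \<in> borel_measurable borel"
    and f: "\<And>x. \<bar>f x\<bar> \<le> B" and q: "\<And>x. \<bar>q x\<bar> \<le> B + e" and e: "0 < e" "0 \<le> B"
    and fq: "\<And>x. norm x \<le> R \<Longrightarrow> \<bar>f x - q x\<bar> \<le> e"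
  shows "\<bar>(\<integral>\<omega>. f (Z \<omega>) \<partial>M) - (\<integral>\<omega>. q (Z \<omega>) \<partial>M)\<bar> \<le> e + (2 * B + e) * prob {\<omega>\<in>space M. R < norm (Z \<omega>)}"
proof -
  let ?A = "{\<omega>\<in>space M. R < norm (Z \<omega>)}"
  have A: "?A \<in> sets M" by measurable
  have i1: "integrable M (\<lambda>\<omega>. f (Z \<omega>))" by (rule integrable_const_bound[where B=B]) (auto simp: f)
  have i2: "integrable M (\<lambda>\<omega>. q (Z \<omega>))" by (rule integrable_const_bound[where B="B+e"]) (auto simp: q)
  have "\<bar>(\<integral>\<omega>. f (Z \<omega>) \<partial>M) - (\<integral>\<omega>. q (Z \<omega>) \<partial>M)\<bar> = \<bar>\<integral>\<omega>. f (Z \<omega>) - q (Z \<omega>) \<partial>M\<bar>"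
    by (simp add: i1 i2)
  also have "\<dots> \<le> (\<integral>\<omega>. \<bar>f (Z \<omega>) - q (Z \<omega>)\<bar> \<partial>M)" by (rule integral_abs_bound)
  also have "\<dots> \<le> (\<integral>\<omega>. e + (2 * B + e) * indicator ?A \<omega> \<partial>M)"
  proof (rule integral_mono)
    show "integrable M (\<lambda>\<omega>. \<bar>f (Z \<omega>) - q (Z \<omega>)\<bar>)" using i1 i2 by simp
    show "integrable M (\<lambda>\<omega>. e + (2 * B + e) * indicator ?A \<omega>)" using A
      by (intro Bochner_Integration.integrable_add integrable_mult_right)
        (auto intro!: integrable_real_indicator simp: emeasure_eq_measure)
    fix \<omega> assume \<omega>: "\<omega> \<in> space M"
    show "\<bar>f (Z \<omega>) - q (Z \<omega>)\<bar> \<le> e + (2 * B + e) * indicator ?A \<omega>"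
    proof (cases "R < norm (Z \<omega>)")
      case True
      have "\<bar>f (Z \<omega>) - q (Z \<omega>)\<bar> \<le> B + (B + e)" using f[of "Z \<omega>"] q[of "Z \<omega>"] by linarith
      then show ?thesis using True \<omega> e by simp
    next
      case False
      then show ?thesis using fq[of "Z \<omega>"] by simp
    qed
  qed
  also have "\<dots> = e + (2 * B + e) * prob ?A"
    using A by (subst Bochner_Integration.integral_add)
       (auto intro!: integrable_mult_right integrable_real_indicator simp: emeasure_eq_measure prob_space)
  finally show ?thesis .
qed

text \<open>Bounded first moments make the laws tight by Markov's inequality. Outside a large ball the test
function and its trigonometric approximation are bounded, so that little mass there matters little;
inside the ball they are close; and expectations of trigonometric polynomials converge with the
characteristic functions.\<close>

theorem levy_continuity_euclidean:
  fixes Z :: "nat \<Rightarrow> 'w \<Rightarrow> 'b::euclidean_space"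
  assumes P: "prob_space P" and Z[measurable]: "\<And>n. Z n \<in> borel_measurable P"
    and N: "prob_space N" "sets N = sets borel"
    and char: "\<And>u. (\<lambda>n. \<integral>\<omega>. iexp (u \<bullet> Z n \<omega>) \<partial>P) \<longlonglongrightarrow> (\<integral>x. iexp (u \<bullet> x) \<partial>N)"
    and mom: "\<And>n. integrable P (\<lambda>\<omega>. norm (Z n \<omega>))" "\<And>n. (\<integral>\<omega>. norm (Z n \<omega>) \<partial>P) \<le> C"
  shows "converges_in_distribution P Z N"
  unfolding converges_in_distribution_def
proof (intro allI impI)
  fix f :: "'b \<Rightarrow> real"
  assume f: "continuous_on UNIV f \<and> bounded (range f)"
  then have [measurable]: "f \<in> borel_measurable borel" by (simp add: borel_measurable_continuous_onI)
  obtain B where B: "\<And>x. \<bar>f x\<bar> \<le> B" using f by (auto simp: bounded_iff)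
  then have B0: "0 \<le> B" using abs_ge_zero order_trans by blast
  interpret P: prob_space P by (rule P)
  interpret N: prob_space N by (rule N(1))
  have idN[measurable]: "(\<lambda>x. x) \<in> borel_measurable N"
    by (simp add: measurable_def space_borel N(2) sets_eq_imp_space_eq[OF N(2)])
  have C0: "0 \<le> C" 
    using mom(2)[of 0] by (rule order_trans[rotated]) simp
  show "(\<lambda>n. \<integral>\<omega>. f (Z n \<omega>) \<partial>P) \<longlonglongrightarrow> (\<integral>x. f x \<partial>N)"
  proof (rule LIMSEQ_I)
    fix r :: real assume r: "0 < r"
    \<comment> \<open>The two errors that \<open>expectation_diff_le_off_compact\<close> adds up are each made at most \<open>r / 8\<close>, under either law.\<close>
    define e where "e = min 1 (r / 8)"
    define d where "d = r / (8 * (2 * B + 1))"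
    have e: "0 < e" "e \<le> 1" "e \<le> r / 8" using r by (auto simp: e_def)
    have d: "0 < d" using r B0 by (auto simp: d_def intro!: divide_pos_pos)
    have de: "(2 * B + e) * p \<le> r / 8" if "p \<le> d" "0 \<le> p" for p
    proof -
      have "(2 * B + e) * p \<le> (2 * B + 1) * d" using that e B0 by (intro mult_mono) auto
      moreover have "(2 * B + 1) * d = r / 8" using B0 by (simp add: d_def field_simps add_nonneg_eq_0_iff)
      ultimately show ?thesis by simp
    qed
    have "(\<lambda>k. N.prob {x\<in>space N. real k < norm x}) \<longlonglongrightarrow> N.prob (\<Inter>k. {x\<in>space N. real k < norm x})"
    proof (rule N.finite_Lim_measure_decseq)
      show "range (\<lambda>k. {x\<in>space N. real k < norm x}) \<subseteq> N.events" by auto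
      show "decseq (\<lambda>k. {x\<in>space N. real k < norm x})"
        by (auto simp: decseq_def intro: order.strict_trans1[OF of_nat_mono])
    qed
    moreover have "(\<Inter>k. {x\<in>space N. real k < norm x}) = {}"
      by (auto dest: spec) (metis order_less_asym reals_Archimedean2)
    ultimately have "eventually (\<lambda>k. N.prob {x\<in>space N. real k < norm x} < d) sequentially"
      using d by (auto dest!: order_tendstoD(2)[where a=d])
    moreover have "eventually (\<lambda>k. C / d < real k) sequentially"
      using filterlim_real_sequentially by (simp add: filterlim_at_top_dense)
    ultimately have "eventually (\<lambda>k. N.prob {x\<in>space N. real k < norm x} < d \<and> C / d < real k) sequentially"
      by (rule eventually_conj)
    then obtain k where k: "N.prob {x\<in>space N. real k < norm x} < d" "C / d < real k"
      by (auto simp: eventually_sequentially)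
    have kpos: "0 < real k" 
      using k(2) C0 d by (meson divide_nonneg_pos le_less_trans)
    have tight: "P.prob {\<omega>\<in>space P. real k < norm (Z n \<omega>)} \<le> d" for n
    proof -
      have "P.prob {\<omega>\<in>space P. real k < norm (Z n \<omega>)} \<le> P.prob {\<omega>\<in>space P. real k \<le> norm (Z n \<omega>)}"
        by (rule P.finite_measure_mono) auto
      also have "\<dots> \<le> (\<integral>\<omega>. norm (Z n \<omega>) \<partial>P) / real k"
        by (rule integral_Markov_inequality_measure[OF mom(1), where A="{}"]) (use kpos in auto)
      also have "\<dots> \<le> C / real k" using mom(2) kpos by (simp add: divide_right_mono)
      also have "\<dots> \<le> d" using k(2) d kpos by (simp add: field_simps)
      finally show ?thesis .
    qed
    obtain q where q: "trig_poly q" "\<And>x. \<bar>q x\<bar> \<le> B + e" "\<And>x. x \<in> cball 0 (real k) \<Longrightarrow> \<bar>f x - q x\<bar> \<le> e"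
      using trig_poly_approx[of "cball 0 (real k)" f B e] B B0 e f
      by (metis compact_cball continuous_on_subset top_greatest)
    have [measurable]: "q \<in> borel_measurable borel"
      using trig_poly_continuous[OF q(1)] by (simp add: borel_measurable_continuous_onI)
    have fq: "norm x \<le> real k \<Longrightarrow> \<bar>f x - q x\<bar> \<le> e" for x using q(3)[of x] by simp
    have 1: "\<bar>(\<integral>\<omega>. f (Z n \<omega>) \<partial>P) - (\<integral>\<omega>. q (Z n \<omega>) \<partial>P)\<bar> \<le> r / 4" for n
      using P.expectation_diff_le_off_compact[of "Z n" f q B e "real k"] B q(2) e B0 fq de[OF tight[of n]] by simp
    have 2: "\<bar>(\<integral>x. f x \<partial>N) - (\<integral>x. q x \<partial>N)\<bar> \<le> r / 4"
      using N.expectation_diff_le_off_compact[of "\<lambda>x. x" f q B e "real k"] B q(2) e B0 fq de[of "N.prob {x\<in>space N. real k < norm x}"] k(1) by auto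
    obtain n0 where n0: "\<And>n. n \<ge> n0 \<Longrightarrow> norm ((\<integral>\<omega>. q (Z n \<omega>) \<partial>P) - (\<integral>x. q x \<partial>N)) < r / 4"
      using LIMSEQ_D[OF trig_poly_expectation_converges[OF P Z N char q(1)], of "r / 4"] r by auto
    show "\<exists>n0. \<forall>n\<ge>n0. norm ((\<integral>\<omega>. f (Z n \<omega>) \<partial>P) - (\<integral>x. f x \<partial>N)) < r"
    proof (intro exI allI impI)
      fix n assume "n \<ge> n0"
      from n0[OF this] 1[of n] 2 r show "norm ((\<integral>\<omega>. f (Z n \<omega>) \<partial>P) - (\<integral>x. f x \<partial>N)) < r"
        unfolding real_norm_def by linarith
    qed
  qed
qed

section \<open>Bounds on mean absolute values\<close>

text \<open>Bounds of this form are closed under sums and multiples, so the error of the realized covariance can be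
estimated term by term.\<close>

definition (in prob_space) mean_abs_le :: "('a \<Rightarrow> real) \<Rightarrow> real \<Rightarrow> bool" where
  "mean_abs_le f c \<longleftrightarrow> integrable M f \<and> expectation (\<lambda>\<omega>. \<bar>f \<omega>\<bar>) \<le> c"

lemma (in prob_space) mean_abs_le_integrable: "mean_abs_le f c \<Longrightarrow> integrable M f"
  by (simp add: mean_abs_le_def)

lemma (in prob_space) mean_abs_leI:
  assumes [measurable]: "f \<in> borel_measurable M" and g: "integrable M g" "\<And>\<omega>. \<bar>f \<omega>\<bar> \<le> g \<omega>" "expectation g \<le> c"
  shows "mean_abs_le f c"
proof -
  have i: "integrable M f"
    by (rule Bochner_Integration.integrable_bound[OF g(1)])
      (measurable, intro AE_I2, unfold real_norm_def, rule order_trans[OF g(2) abs_ge_self])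
  have "expectation (\<lambda>\<omega>. \<bar>f \<omega>\<bar>) \<le> expectation g"
    using i by (intro integral_mono g(1,2)) simp
  then show ?thesis using i g(3) by (simp add: mean_abs_le_def)
qed

lemma (in prob_space) mean_abs_le_mono: "mean_abs_le f a \<Longrightarrow> a \<le> b \<Longrightarrow> mean_abs_le f b"
  by (simp add: mean_abs_le_def)

lemma (in prob_space) mean_abs_le_abs: "mean_abs_le f a \<Longrightarrow> mean_abs_le (\<lambda>\<omega>. \<bar>f \<omega>\<bar>) a"
  by (simp add: mean_abs_le_def)

lemma (in prob_space) mean_abs_le_add:
  assumes "mean_abs_le f a" "mean_abs_le g b"
  shows "mean_abs_le (\<lambda>\<omega>. f \<omega> + g \<omega>) (a + b)"
proof (rule mean_abs_leI[where g="\<lambda>\<omega>. \<bar>f \<omega>\<bar> + \<bar>g \<omega>\<bar>"])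
  have [measurable]: "f \<in> borel_measurable M" "g \<in> borel_measurable M"
    using assms by (auto simp: mean_abs_le_def)
  show "(\<lambda>\<omega>. f \<omega> + g \<omega>) \<in> borel_measurable M" by measurable
qed (use assms in \<open>auto simp: mean_abs_le_def\<close>)

lemma (in prob_space) mean_abs_le_cmult: "mean_abs_le f a \<Longrightarrow> mean_abs_le (\<lambda>\<omega>. c * f \<omega>) (\<bar>c\<bar> * a)"
  by (simp add: mean_abs_le_def abs_mult mult_left_mono)

lemma (in prob_space) mean_abs_le_sum:
  assumes "\<And>i. i \<in> I \<Longrightarrow> mean_abs_le (f i) (a i)"
  shows "mean_abs_le (\<lambda>\<omega>. \<Sum>i\<in>I. f i \<omega>) (\<Sum>i\<in>I. a i)"
  using assms
proof (induction I rule: infinite_finite_induct)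
  case (insert i I)
  then show ?case using mean_abs_le_add[of "f i" "a i" "\<lambda>\<omega>. \<Sum>i\<in>I. f i \<omega>" "\<Sum>i\<in>I. a i"] by simp
qed (simp_all add: mean_abs_le_def)

text \<open>The weight \<open>c\<close> replaces the Cauchy--Schwarz inequality for expectations: choosing it as the ratio of
the sizes of the two factors gives the same order of magnitude.\<close>

lemma abs_mult_le_weighted: "0 < (c::real) \<Longrightarrow> \<bar>x * y\<bar> \<le> (x\<^sup>2 / c + c * y\<^sup>2) / 2"
proof -
  assume c: "0 < c"
  have "0 \<le> (\<bar>x\<bar> - c * \<bar>y\<bar>)\<^sup>2 / c" using c by simp
  also have "(\<bar>x\<bar> - c * \<bar>y\<bar>)\<^sup>2 = x\<^sup>2 + c * (c * y\<^sup>2) - c * (2 * \<bar>x * y\<bar>)"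
    by (simp add: power2_diff power_mult_distrib abs_mult power2_eq_square[of c] ac_simps)
  also have "\<dots> / c = x\<^sup>2 / c + c * y\<^sup>2 - 2 * \<bar>x * y\<bar>"
    using c by (simp add: add_divide_distrib diff_divide_distrib)
  finally show ?thesis by simp
qed

lemma (in prob_space) mean_abs_le_mult:
  assumes [measurable]: "f \<in> borel_measurable M" "g \<in> borel_measurable M"
    and f: "integrable M (\<lambda>\<omega>. (f \<omega>)\<^sup>2)" "expectation (\<lambda>\<omega>. (f \<omega>)\<^sup>2) \<le> a"
    and g: "integrable M (\<lambda>\<omega>. (g \<omega>)\<^sup>2)" "expectation (\<lambda>\<omega>. (g \<omega>)\<^sup>2) \<le> b" and c: "0 < c"
  shows "mean_abs_le (\<lambda>\<omega>. f \<omega> * g \<omega>) ((a / c + c * b) / 2)"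
proof (rule mean_abs_leI)
  show "integrable M (\<lambda>\<omega>. ((f \<omega>)\<^sup>2 / c + c * (g \<omega>)\<^sup>2) / 2)" using f g by auto
  have "expectation (\<lambda>\<omega>. ((f \<omega>)\<^sup>2 / c + c * (g \<omega>)\<^sup>2) / 2) =
      (expectation (\<lambda>\<omega>. (f \<omega>)\<^sup>2) / c + c * expectation (\<lambda>\<omega>. (g \<omega>)\<^sup>2)) / 2"
    using f g by simp
  also have "\<dots> \<le> (a / c + c * b) / 2"
    using f g c by (intro divide_right_mono add_mono mult_left_mono) auto
  finally show "expectation (\<lambda>\<omega>. ((f \<omega>)\<^sup>2 / c + c * (g \<omega>)\<^sup>2) / 2) \<le> (a / c + c * b) / 2" .
qed (use abs_mult_le_weighted[OF c] in auto)

text \<open>Sums of \<open>n\<close> orthogonal terms have second moments of order \<open>n\<close>.\<close>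

lemma (in prob_space) mean_abs_le_second_moment:
  assumes "f \<in> borel_measurable M" "integrable M (\<lambda>\<omega>. (f \<omega>)\<^sup>2)" "expectation (\<lambda>\<omega>. (f \<omega>)\<^sup>2) \<le> real n * s" "0 < n"
  shows "mean_abs_le f (sqrt (real n) * ((s + 1) / 2))"
proof -
  have "mean_abs_le (\<lambda>\<omega>. f \<omega> * 1) ((real n * s / sqrt (real n) + sqrt (real n) * 1) / 2)"
    by (rule mean_abs_le_mult) (use assms in \<open>auto simp: prob_space\<close>)
  moreover have "(real n * s / sqrt (real n) + sqrt (real n) * 1) / 2 = sqrt (real n) * ((s + 1) / 2)"
  proof -
    have "real n * s / sqrt (real n) = real n / sqrt (real n) * s" by simp
    then show ?thesis by (simp only: real_div_sqrt of_nat_0_le_iff) (simp add: algebra_simps add_divide_distrib)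
  qed
  ultimately show ?thesis by (simp only: mult_1_right)
qed

lemma cmod_iexp_diff_le: "cmod (iexp a - iexp b) \<le> \<bar>a - b\<bar>"
proof -
  have "iexp a - iexp b = iexp b * (iexp (a - b) - 1)"
    by (simp add: right_diff_distrib exp_add[symmetric])
  then have "cmod (iexp a - iexp b) = cmod (iexp (a - b) - 1)" by (simp add: norm_mult)
  also have "\<dots> \<le> \<bar>a - b\<bar>" using iexp_approx1[of "a - b" 0] by simp
  finally show ?thesis .
qed

lemma (in prob_space) char_diff_le:
  assumes [measurable]: "f \<in> borel_measurable M" "g \<in> borel_measurable M" and d: "mean_abs_le (\<lambda>\<omega>. f \<omega> - g \<omega>) c"
  shows "cmod (expectation (\<lambda>\<omega>. iexp (f \<omega>)) - expectation (\<lambda>\<omega>. iexp (g \<omega>))) \<le> c"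
proof -
  have fi: "integrable M (\<lambda>\<omega>. iexp (f \<omega>))" and gi: "integrable M (\<lambda>\<omega>. iexp (g \<omega>))"
    by (auto intro!: integrable_const_bound[where B=1])
  have "expectation (\<lambda>\<omega>. iexp (f \<omega>)) - expectation (\<lambda>\<omega>. iexp (g \<omega>)) = expectation (\<lambda>\<omega>. iexp (f \<omega>) - iexp (g \<omega>))"
    by (rule Bochner_Integration.integral_diff[OF fi gi, symmetric])
  also have "cmod \<dots> \<le> expectation (\<lambda>\<omega>. cmod (iexp (f \<omega>) - iexp (g \<omega>)))" by (rule integral_norm_bound)
  also have "\<dots> \<le> expectation (\<lambda>\<omega>. \<bar>f \<omega> - g \<omega>\<bar>)"
    by (rule integral_mono)
      (use fi gi mean_abs_le_integrable[OF d] in \<open>auto intro!: cmod_iexp_diff_le integrable_norm\<close>)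
  finally show ?thesis using d by (simp add: mean_abs_le_def)
qed

section \<open>Moments of Gaussian vectors\<close>

lemma mat_vec: "(mat h :: real^'i^'i) *v v = h *\<^sub>R v"
  by (simp add: vec_eq_iff matrix_vector_mult_def mat_def if_distrib[of "\<lambda>x. x * _"] cong: if_cong)

text \<open>The image under \<open>A\<close> of a product of standard normal distributions.\<close>

lemma normal_law_exists:
  fixes A :: "real^'n^'m"
  shows "\<exists>N. is_normal_law 0 (A ** transpose A) N"
proof -
  interpret G: prob_space std_normal_distribution by (rule prob_space_normal_density) simp
  interpret product_sigma_finite "\<lambda>_::'n. std_normal_distribution" ..
  interpret product_prob_space "\<lambda>_::'n. std_normal_distribution" UNIV ..
  define Q where "Q = Pi\<^sub>M (UNIV::'n set) (\<lambda>_. std_normal_distribution)"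
  define T where "T \<omega> = A *v (\<chi> i. \<omega> i)" for \<omega> :: "'n \<Rightarrow> real"
  have coord: "(\<lambda>\<omega>. \<omega> i) \<in> borel_measurable Q" for i
    unfolding Q_def using measurable_component_singleton[of i UNIV "\<lambda>_. std_normal_distribution"] by simp
  have vec: "(\<lambda>\<omega>. \<chi> i. \<omega> i) \<in> borel_measurable Q"
    using coord by (subst borel_measurable_euclidean_space) (auto simp: Basis_vec_def inner_axis)
  have [measurable]: "T \<in> borel_measurable Q"
    unfolding T_def by (rule borel_measurable_continuous_on[OF _ vec]) (intro continuous_intros)
  have prob: "prob_space Q" unfolding Q_def by (rule P.prob_space_axioms)
  have char: "(\<integral>\<omega>. iexp (u \<bullet> T \<omega>) \<partial>Q) = exp (- complex_of_real (u \<bullet> ((A ** transpose A) *v u)) / 2)" for u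
  proof -
    \<comment> \<open>The exponent becomes a sum over the coordinates, so the integral over the product splits.\<close>
    define w where "w = transpose A *v u"
    have uT: "u \<bullet> T \<omega> = (\<Sum>i\<in>UNIV. w $ i * \<omega> i)" for \<omega>
      unfolding T_def w_def by (simp add: dot_lmul_matrix[symmetric] inner_vec_def[of "u v* A"])
    have "(\<integral>\<omega>. iexp (u \<bullet> T \<omega>) \<partial>Q) = (\<integral>\<omega>. (\<Prod>i\<in>UNIV. iexp (w $ i * \<omega> i)) \<partial>Q)"
      by (simp add: uT exp_sum sum_distrib_left)
    also have "\<dots> = (\<Prod>i\<in>UNIV. \<integral>x. iexp (w $ i * x) \<partial>std_normal_distribution)"
      unfolding Q_def by (rule product_integral_prod) (auto intro!: G.integrable_iexp)
    also have "\<dots> = (\<Prod>i\<in>UNIV. exp (complex_of_real (- ((w $ i)\<^sup>2) / 2)))"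
      using char_std_normal_distribution unfolding char_def by (simp add: fun_eq_iff flip: exp_of_real)
    also have "\<dots> = exp (- complex_of_real (w \<bullet> w) / 2)"
      by (simp add: exp_sum[symmetric] inner_vec_def sum_divide_distrib sum_negf power2_eq_square)
    also have "w \<bullet> w = u \<bullet> ((A ** transpose A) *v u)"
      by (simp add: w_def matrix_vector_mul_assoc[symmetric] dot_lmul_matrix[symmetric])
    finally show ?thesis .
  qed
  have "is_normal_law 0 (A ** transpose A) (distr Q borel T)"
    unfolding is_normal_law_def
    by (auto intro: prob_space.prob_space_distr[OF prob] simp: integral_distr char)
  then show ?thesis by blast
qed

definition (in prob_space) standard_gaussian :: "('a \<Rightarrow> 'b::euclidean_space) \<Rightarrow> bool" where
  "standard_gaussian g \<longleftrightarrow> g \<in> borel_measurable M \<and>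
     (\<forall>u. (\<integral>\<omega>. iexp (u \<bullet> g \<omega>) \<partial>M) = exp (- complex_of_real (u \<bullet> u) / 2))"

lemma normal_law_standardize:
  fixes D :: "'w \<Rightarrow> real^'r"
  assumes P: "prob_space P" and D[measurable]: "D \<in> borel_measurable P" and h: "0 < h"
    and law: "is_normal_law 0 (mat h) (distr P borel D)"
  shows "prob_space.standard_gaussian P (\<lambda>\<omega>. (1 / sqrt h) *\<^sub>R D \<omega>)"
  unfolding prob_space.standard_gaussian_def[OF P]
proof (intro conjI allI)
  show "(\<lambda>\<omega>. (1 / sqrt h) *\<^sub>R D \<omega>) \<in> borel_measurable P" by measurable
  fix u :: "real^'r"
  define v where "v = (1 / sqrt h) *\<^sub>R u"
  have "(\<integral>\<omega>. iexp (u \<bullet> ((1 / sqrt h) *\<^sub>R D \<omega>)) \<partial>P) = (\<integral>x. iexp (v \<bullet> x) \<partial>distr P borel D)"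
    by (simp add: integral_distr v_def)
  also have "\<dots> = exp (\<i> * complex_of_real (v \<bullet> 0) - complex_of_real (v \<bullet> (mat h *v v)) / 2)"
    using law unfolding is_normal_law_def by blast
  also have "v \<bullet> (mat h *v v) = u \<bullet> u" using h by (simp add: mat_vec v_def field_simps)
  finally show "(\<integral>\<omega>. iexp (u \<bullet> ((1 / sqrt h) *\<^sub>R D \<omega>)) \<partial>P) = exp (- complex_of_real (u \<bullet> u) / 2)"
    by simp
qed

context prob_space begin

lemma standard_gaussian_measurable [measurable_dest]: "standard_gaussian g \<Longrightarrow> g \<in> borel_measurable M"
  by (simp add: standard_gaussian_def)

text \<open>Normality is given through the characteristic function. Uniqueness in dimension one identifies the law
of each linear form, and with it all moments of linear forms.\<close>

lemma standard_gaussian_linear_form: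
  fixes g :: "'a \<Rightarrow> 'b::euclidean_space"
  assumes g: "standard_gaussian g" and v: "v \<bullet> v = 1"
  shows "distr M borel (\<lambda>\<omega>. v \<bullet> g \<omega>) = std_normal_distribution"
proof (rule Levy_uniqueness)
  note [measurable] = standard_gaussian_measurable[OF g]
  show "real_distribution (distr M borel (\<lambda>\<omega>. v \<bullet> g \<omega>))" by (rule real_distribution_distr) simp
  show "real_distribution std_normal_distribution" by (rule real_dist_normal_dist)
  show "char (distr M borel (\<lambda>\<omega>. v \<bullet> g \<omega>)) = char std_normal_distribution"
  proof
    fix t
    have "char (distr M borel (\<lambda>\<omega>. v \<bullet> g \<omega>)) t = (\<integral>\<omega>. iexp ((t *\<^sub>R v) \<bullet> g \<omega>) \<partial>M)"
      by (simp add: char_def integral_distr)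
    also have "\<dots> = exp (- complex_of_real ((t *\<^sub>R v) \<bullet> (t *\<^sub>R v)) / 2)"
      using g unfolding standard_gaussian_def by blast
    also have "\<dots> = char std_normal_distribution t"
      by (simp add: char_std_normal_distribution v power2_eq_square flip: exp_of_real)
    finally show "char (distr M borel (\<lambda>\<omega>. v \<bullet> g \<omega>)) t = char std_normal_distribution t" .
  qed
qed

lemma standard_gaussian_moments:
  fixes g :: "'a \<Rightarrow> 'b::euclidean_space"
  assumes g: "standard_gaussian g"
  shows "integrable M (\<lambda>\<omega>. (v \<bullet> g \<omega>) ^ k)"
    and "expectation (\<lambda>\<omega>. (v \<bullet> g \<omega>) ^ k) = norm v ^ k * (\<integral>x. x ^ k \<partial>std_normal_distribution)"
proof -
  note [measurable] = standard_gaussian_measurable[OF g]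
  \<comment> \<open>For \<open>v = 0\<close> any unit vector will do.\<close>
  define w where "w = (if v = 0 then SOME b. b \<in> Basis else v /\<^sub>R norm v)"
  have "(SOME b::'b. b \<in> Basis) \<in> Basis" using nonempty_Basis by (metis some_in_eq)
  then have w: "w \<bullet> w = 1" by (auto simp: w_def dot_square_norm power2_eq_square field_simps)
  have v: "v = norm v *\<^sub>R w" by (simp add: w_def)
  have vg: "(v \<bullet> g \<omega>) ^ k = norm v ^ k * (w \<bullet> g \<omega>) ^ k" for \<omega>
    by (subst v) (simp add: power_mult_distrib)
  have "integrable (distr M borel (\<lambda>\<omega>. w \<bullet> g \<omega>)) (\<lambda>x. x ^ k)"
    unfolding standard_gaussian_linear_form[OF g w] by (rule integrable_std_normal_distribution_moment)
  then have i: "integrable M (\<lambda>\<omega>. (w \<bullet> g \<omega>) ^ k)"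
    by (simp add: integrable_distr_eq)
  then show "integrable M (\<lambda>\<omega>. (v \<bullet> g \<omega>) ^ k)" unfolding vg by simp
  have "expectation (\<lambda>\<omega>. (w \<bullet> g \<omega>) ^ k) = (\<integral>x. x ^ k \<partial>distr M borel (\<lambda>\<omega>. w \<bullet> g \<omega>))"
    by (simp add: integral_distr)
  then show "expectation (\<lambda>\<omega>. (v \<bullet> g \<omega>) ^ k) = norm v ^ k * (\<integral>x. x ^ k \<partial>std_normal_distribution)"
    unfolding vg standard_gaussian_linear_form[OF g w] by simp
qed

lemma standard_gaussian_first_moment:
  fixes g :: "'a \<Rightarrow> 'b::euclidean_space"
  assumes g: "standard_gaussian g"
  shows "integrable M (\<lambda>\<omega>. v \<bullet> g \<omega>)" "expectation (\<lambda>\<omega>. v \<bullet> g \<omega>) = 0"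
  using standard_gaussian_moments[OF g, of v 1] integral_std_normal_distribution_moment_odd[of 1] by auto

lemma standard_gaussian_even_moment:
  fixes g :: "'a \<Rightarrow> 'b::euclidean_space"
  assumes g: "standard_gaussian g"
  shows "expectation (\<lambda>\<omega>. (v \<bullet> g \<omega>) ^ (2 * k)) = (v \<bullet> v) ^ k * (fact (2 * k) / (2 ^ k * fact k))"
  unfolding standard_gaussian_moments(2)[OF g] std_normal_distribution_even_moments
  using std_normal_distribution_even_moments
  by (simp add: power_mult dot_square_norm has_bochner_integral_iff)

lemma standard_gaussian_second_moment:
  fixes g :: "'a \<Rightarrow> 'b::euclidean_space"
  assumes g: "standard_gaussian g"
  shows "integrable M (\<lambda>\<omega>. (a \<bullet> g \<omega>) * (b \<bullet> g \<omega>))"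
    and "expectation (\<lambda>\<omega>. (a \<bullet> g \<omega>) * (b \<bullet> g \<omega>)) = a \<bullet> b"
proof -
  have eq: "(a \<bullet> g \<omega>) * (b \<bullet> g \<omega>) = (((a + b) \<bullet> g \<omega>) ^ 2 - ((a - b) \<bullet> g \<omega>) ^ 2) / 4" for \<omega>
    by (simp add: inner_add_left inner_diff_left power2_eq_square field_simps)
  note i = standard_gaussian_moments(1)[OF g, where k=2]
  show "integrable M (\<lambda>\<omega>. (a \<bullet> g \<omega>) * (b \<bullet> g \<omega>))" unfolding eq using i by simp
  have "expectation (\<lambda>\<omega>. (v \<bullet> g \<omega>)\<^sup>2) = v \<bullet> v" for v
    using standard_gaussian_even_moment[OF g, of v 1] by simp
  then show "expectation (\<lambda>\<omega>. (a \<bullet> g \<omega>) * (b \<bullet> g \<omega>)) = a \<bullet> b"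
    unfolding eq using i
    by (simp del: inner_add_left inner_diff_left) (simp add: inner_add_left inner_diff_left inner_add_right inner_diff_right inner_commute)
qed

text \<open>Mixed fourth moments follow from those of single linear forms: the signed sum of the fourth powers
cancels every monomial except \<open>a b c d\<close>, which occurs with multiplicity \<open>8 \<cdot> 24 = 192\<close>.\<close>

lemma polarization4:
  fixes a b c d :: real
  shows "a * b * c * d = (1 / 192) *
    ((a + b + c + d) ^ 4 - (a + b + c - d) ^ 4 - (a + b - c + d) ^ 4 + (a + b - c - d) ^ 4
     - (a - b + c + d) ^ 4 + (a - b + c - d) ^ 4 + (a - b - c + d) ^ 4 - (a - b - c - d) ^ 4)"
  by algebra

text \<open>The same signed sum with each fourth power \<open>(v \<bullet> g)\<^sup>4\<close> replaced by its expectation \<open>3 (v \<bullet> v)\<^sup>2\<close>; the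
letters stand for the inner products of the four vectors and \<open>s\<close> for the sum of their squared norms.\<close>

lemma polarization4_quadratic_form:
  fixes s ab ac ad bc bd cd :: real
  shows "(1 / 192) *
    (3 * (s + 2 * (ab + ac + ad + bc + bd + cd))\<^sup>2 - 3 * (s + 2 * (ab + ac - ad + bc - bd - cd))\<^sup>2
     - 3 * (s + 2 * (ab - ac + ad - bc + bd - cd))\<^sup>2 + 3 * (s + 2 * (ab - ac - ad - bc - bd + cd))\<^sup>2
     - 3 * (s + 2 * (- ab + ac + ad - bc - bd + cd))\<^sup>2 + 3 * (s + 2 * (- ab + ac - ad - bc + bd - cd))\<^sup>2
     + 3 * (s + 2 * (- ab - ac + ad + bc - bd - cd))\<^sup>2 - 3 * (s + 2 * (- ab - ac - ad + bc + bd + cd))\<^sup>2)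
     = ab * cd + ac * bd + ad * bc"
  by algebra

text \<open>Isserlis' formula, obtained by polarizing the one-dimensional fourth moment.\<close>

lemma standard_gaussian_fourth_moment:
  fixes g :: "'a \<Rightarrow> 'b::euclidean_space"
  assumes g: "standard_gaussian g"
  shows "integrable M (\<lambda>\<omega>. (a \<bullet> g \<omega>) * (b \<bullet> g \<omega>) * (c \<bullet> g \<omega>) * (d \<bullet> g \<omega>))"
    and "expectation (\<lambda>\<omega>. (a \<bullet> g \<omega>) * (b \<bullet> g \<omega>) * (c \<bullet> g \<omega>) * (d \<bullet> g \<omega>)) =
      (a \<bullet> b) * (c \<bullet> d) + (a \<bullet> c) * (b \<bullet> d) + (a \<bullet> d) * (b \<bullet> c)"
proof -
  note eq = polarization4[of "a \<bullet> g \<omega>" "b \<bullet> g \<omega>" "c \<bullet> g \<omega>" "d \<bullet> g \<omega>" for \<omega>,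
      folded inner_add_left inner_diff_left]
  note i = standard_gaussian_moments(1)[OF g, where k=4]
  show "integrable M (\<lambda>\<omega>. (a \<bullet> g \<omega>) * (b \<bullet> g \<omega>) * (c \<bullet> g \<omega>) * (d \<bullet> g \<omega>))"
    unfolding eq by (intro integrable_mult_right Bochner_Integration.integrable_add Bochner_Integration.integrable_diff i)
  have m: "expectation (\<lambda>\<omega>. (v \<bullet> g \<omega>) ^ 4) = 3 * (v \<bullet> v)\<^sup>2" for v
    using standard_gaussian_even_moment[OF g, of v 2] by (simp add: fact_numeral)
  have "expectation (\<lambda>\<omega>. (a \<bullet> g \<omega>) * (b \<bullet> g \<omega>) * (c \<bullet> g \<omega>) * (d \<bullet> g \<omega>)) =
      (1 / 192) * (3 * ((a + b + c + d) \<bullet> (a + b + c + d))\<^sup>2 - 3 * ((a + b + c - d) \<bullet> (a + b + c - d))\<^sup>2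
       - 3 * ((a + b - c + d) \<bullet> (a + b - c + d))\<^sup>2 + 3 * ((a + b - c - d) \<bullet> (a + b - c - d))\<^sup>2
       - 3 * ((a - b + c + d) \<bullet> (a - b + c + d))\<^sup>2 + 3 * ((a - b + c - d) \<bullet> (a - b + c - d))\<^sup>2
       + 3 * ((a - b - c + d) \<bullet> (a - b - c + d))\<^sup>2 - 3 * ((a - b - c - d) \<bullet> (a - b - c - d))\<^sup>2)"
    unfolding eq by (simp only: integral_mult_right_zero Bochner_Integration.integral_add Bochner_Integration.integral_diff i m
      Bochner_Integration.integrable_add Bochner_Integration.integrable_diff)
  also have "\<dots> = (a \<bullet> b) * (c \<bullet> d) + (a \<bullet> c) * (b \<bullet> d) + (a \<bullet> d) * (b \<bullet> c)"
  proof -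
    let ?s = "a \<bullet> a + b \<bullet> b + c \<bullet> c + d \<bullet> d"
    have
      "(a + b + c + d) \<bullet> (a + b + c + d) = ?s + 2 * (a \<bullet> b + a \<bullet> c + a \<bullet> d + b \<bullet> c + b \<bullet> d + c \<bullet> d)"
      "(a + b + c - d) \<bullet> (a + b + c - d) = ?s + 2 * (a \<bullet> b + a \<bullet> c - a \<bullet> d + b \<bullet> c - b \<bullet> d - c \<bullet> d)"
      "(a + b - c + d) \<bullet> (a + b - c + d) = ?s + 2 * (a \<bullet> b - a \<bullet> c + a \<bullet> d - b \<bullet> c + b \<bullet> d - c \<bullet> d)"
      "(a + b - c - d) \<bullet> (a + b - c - d) = ?s + 2 * (a \<bullet> b - a \<bullet> c - a \<bullet> d - b \<bullet> c - b \<bullet> d + c \<bullet> d)"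
      "(a - b + c + d) \<bullet> (a - b + c + d) = ?s + 2 * (- (a \<bullet> b) + a \<bullet> c + a \<bullet> d - b \<bullet> c - b \<bullet> d + c \<bullet> d)"
      "(a - b + c - d) \<bullet> (a - b + c - d) = ?s + 2 * (- (a \<bullet> b) + a \<bullet> c - a \<bullet> d - b \<bullet> c + b \<bullet> d - c \<bullet> d)"
      "(a - b - c + d) \<bullet> (a - b - c + d) = ?s + 2 * (- (a \<bullet> b) - a \<bullet> c + a \<bullet> d + b \<bullet> c - b \<bullet> d - c \<bullet> d)"
      "(a - b - c - d) \<bullet> (a - b - c - d) = ?s + 2 * (- (a \<bullet> b) - a \<bullet> c - a \<bullet> d + b \<bullet> c + b \<bullet> d + c \<bullet> d)"
      by (simp_all add: inner_add_left inner_diff_left inner_add_right inner_diff_right inner_commute)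
    then show ?thesis
      using polarization4_quadratic_form[of ?s "a \<bullet> b" "a \<bullet> c" "a \<bullet> d" "b \<bullet> c" "b \<bullet> d" "c \<bullet> d"]
      by (simp only:)
  qed
  finally show "expectation (\<lambda>\<omega>. (a \<bullet> g \<omega>) * (b \<bullet> g \<omega>) * (c \<bullet> g \<omega>) * (d \<bullet> g \<omega>)) =
      (a \<bullet> b) * (c \<bullet> d) + (a \<bullet> c) * (b \<bullet> d) + (a \<bullet> d) * (b \<bullet> c)" .
qed

end

text \<open>The bound is the same for all standard Gaussian vectors on the space, as is required for
estimates that are uniform over an array.\<close>

lemma (in prob_space) standard_gaussian_norm_moment:
  "\<exists>C. \<forall>g :: 'a \<Rightarrow> 'b::euclidean_space. standard_gaussian g \<longrightarrow>
     integrable M (\<lambda>\<omega>. norm (g \<omega>) ^ (2 * m)) \<and> expectation (\<lambda>\<omega>. norm (g \<omega>) ^ (2 * m)) \<le> C"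
proof (intro exI allI impI)
  fix g :: "'a \<Rightarrow> 'b" assume g: "standard_gaussian g"
  note [measurable] = standard_gaussian_measurable[OF g]
  have pw: "norm x ^ (2 * m) \<le> real DIM('b) ^ (2 * m) * (\<Sum>b\<in>Basis. (b \<bullet> x) ^ (2 * m))" for x :: 'b
  proof -
    obtain b where b: "b \<in> Basis" "\<And>c. c \<in> Basis \<Longrightarrow> \<bar>c \<bullet> x\<bar> \<le> \<bar>b \<bullet> x\<bar>"
      using Max_in[of "(\<lambda>b. \<bar>b \<bullet> x\<bar>) ` Basis"] Max_ge[of "(\<lambda>b. \<bar>b \<bullet> x\<bar>) ` Basis"] nonempty_Basis by fastforce
    have "norm x \<le> (\<Sum>b\<in>Basis. \<bar>b \<bullet> x\<bar>)" using norm_le_l1[of x] by (simp add: inner_commute)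
    also have "\<dots> \<le> real DIM('b) * \<bar>b \<bullet> x\<bar>" 
      using sum_bounded_above[of Basis "\<lambda>c. \<bar>c \<bullet> x\<bar>" "\<bar>b \<bullet> x\<bar>"] b(2) by simp
    finally have "norm x ^ (2 * m) \<le> (real DIM('b) * \<bar>b \<bullet> x\<bar>) ^ (2 * m)" by (rule power_mono) simp
    also have "\<dots> = real DIM('b) ^ (2 * m) * (b \<bullet> x) ^ (2 * m)"
      by (simp add: power_mult_distrib power_even_abs)
    also have "(b \<bullet> x) ^ (2 * m) \<le> (\<Sum>b\<in>Basis. (b \<bullet> x) ^ (2 * m))"
      by (rule member_le_sum[OF b(1)]) (auto simp: power_mult)
    finally show ?thesis by (simp add: mult_left_mono)
  qed
  have i: "integrable M (\<lambda>\<omega>. real DIM('b) ^ (2 * m) * (\<Sum>b\<in>Basis. (b \<bullet> g \<omega>) ^ (2 * m)))"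
    by (intro integrable_mult_right Bochner_Integration.integrable_sum standard_gaussian_moments[OF g])
  show int: "integrable M (\<lambda>\<omega>. norm (g \<omega>) ^ (2 * m)) \<and> expectation (\<lambda>\<omega>. norm (g \<omega>) ^ (2 * m)) \<le>
    real DIM('b) ^ (2 * m) * (\<Sum>b\<in>(Basis::'b set). (b \<bullet> b) ^ m * (fact (2 * m) / (2 ^ m * fact m)))"
  proof
    show j: "integrable M (\<lambda>\<omega>. norm (g \<omega>) ^ (2 * m))"
      by (rule Bochner_Integration.integrable_bound[OF i]) (auto intro!: AE_I2 order_trans[OF pw])
    have "expectation (\<lambda>\<omega>. norm (g \<omega>) ^ (2 * m)) \<le>
      expectation (\<lambda>\<omega>. real DIM('b) ^ (2 * m) * (\<Sum>b\<in>Basis. (b \<bullet> g \<omega>) ^ (2 * m)))"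
      by (rule integral_mono[OF j i pw])
    also have "\<dots> = real DIM('b) ^ (2 * m) * (\<Sum>b\<in>(Basis::'b set). (b \<bullet> b) ^ m * (fact (2 * m) / (2 ^ m * fact m)))"
      by (simp add: standard_gaussian_moments(1)[OF g] standard_gaussian_even_moment[OF g])
    finally show "expectation (\<lambda>\<omega>. norm (g \<omega>) ^ (2 * m)) \<le> \<dots>" .
  qed
qed

definition centered_product :: "'b::real_inner \<Rightarrow> 'b \<Rightarrow> 'b \<Rightarrow> real" where
  "centered_product p q x = (p \<bullet> x) * (q \<bullet> x) - p \<bullet> q"

lemma centered_product_measurable [measurable]:
  "centered_product p q \<in> borel_measurable (borel :: 'b::euclidean_space measure)"
  unfolding centered_product_def by measurable

context prob_space begin

lemma centered_product_expectation:
  fixes g :: "'a \<Rightarrow> 'b::euclidean_space"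
  assumes g: "standard_gaussian g"
  shows "integrable M (\<lambda>\<omega>. centered_product p q (g \<omega>))"
    and "expectation (\<lambda>\<omega>. centered_product p q (g \<omega>)) = 0"
  using standard_gaussian_second_moment[OF g, of p q] unfolding centered_product_def
  by (auto simp: prob_space)

lemma centered_product_covariance:
  fixes g :: "'a \<Rightarrow> 'b::euclidean_space"
  assumes g: "standard_gaussian g"
  shows "integrable M (\<lambda>\<omega>. centered_product p q (g \<omega>) * centered_product p' q' (g \<omega>))"
    and "expectation (\<lambda>\<omega>. centered_product p q (g \<omega>) * centered_product p' q' (g \<omega>)) =
      (p \<bullet> p') * (q \<bullet> q') + (p \<bullet> q') * (q \<bullet> p')"
proof -
  have eq: "centered_product p q x * centered_product p' q' x =
      (p \<bullet> x) * (q \<bullet> x) * (p' \<bullet> x) * (q' \<bullet> x) - (p' \<bullet> q') * ((p \<bullet> x) * (q \<bullet> x))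
      - (p \<bullet> q) * ((p' \<bullet> x) * (q' \<bullet> x)) + (p \<bullet> q) * (p' \<bullet> q')" for x
    by (simp add: centered_product_def algebra_simps)
  note m = standard_gaussian_fourth_moment[OF g, of p q p' q'] standard_gaussian_second_moment[OF g, of p q]
    standard_gaussian_second_moment[OF g, of p' q']
  show "integrable M (\<lambda>\<omega>. centered_product p q (g \<omega>) * centered_product p' q' (g \<omega>))"
    unfolding eq using m by (intro Bochner_Integration.integrable_add Bochner_Integration.integrable_diff integrable_mult_right) auto
  have "expectation (\<lambda>\<omega>. centered_product p q (g \<omega>) * centered_product p' q' (g \<omega>)) =
     ((p \<bullet> q) * (p' \<bullet> q') + (p \<bullet> p') * (q \<bullet> q') + (p \<bullet> q') * (q \<bullet> p')) - (p' \<bullet> q') * (p \<bullet> q)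
      - (p \<bullet> q) * (p' \<bullet> q') + (p \<bullet> q) * (p' \<bullet> q')"
    unfolding eq using m by (simp add: prob_space)
  then show "expectation (\<lambda>\<omega>. centered_product p q (g \<omega>) * centered_product p' q' (g \<omega>)) =
      (p \<bullet> p') * (q \<bullet> q') + (p \<bullet> q') * (q \<bullet> p')" by simp
qed

lemma centered_quadratic_moments:
  fixes g :: "'a \<Rightarrow> 'b::euclidean_space" and u :: "'v::finite \<Rightarrow> real" and p q :: "'v \<Rightarrow> 'b"
  assumes g: "standard_gaussian g"
  defines "\<phi> \<equiv> \<lambda>x. \<Sum>v\<in>UNIV. u v * centered_product (p v) (q v) x"
  shows "integrable M (\<lambda>\<omega>. (\<phi> (g \<omega>))\<^sup>2)" "expectation (\<lambda>\<omega>. \<phi> (g \<omega>)) = 0"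
    "expectation (\<lambda>\<omega>. (\<phi> (g \<omega>))\<^sup>2) = (\<Sum>v\<in>UNIV. \<Sum>w\<in>UNIV. u v * u w *
        ((p v \<bullet> p w) * (q v \<bullet> q w) + (p v \<bullet> q w) * (q v \<bullet> p w)))"
proof -
  have sq: "(\<phi> x)\<^sup>2 = (\<Sum>v\<in>UNIV. \<Sum>w\<in>UNIV. u v * u w * (centered_product (p v) (q v) x * centered_product (p w) (q w) x))" for x
    by (simp add: \<phi>_def power2_eq_square sum_product mult_ac)
  show "integrable M (\<lambda>\<omega>. (\<phi> (g \<omega>))\<^sup>2)" unfolding sq
    by (intro Bochner_Integration.integrable_sum integrable_mult_right centered_product_covariance[OF g])
  show "expectation (\<lambda>\<omega>. \<phi> (g \<omega>)) = 0" unfolding \<phi>_def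
    by (simp add: centered_product_expectation[OF g])
  show "expectation (\<lambda>\<omega>. (\<phi> (g \<omega>))\<^sup>2) = (\<Sum>v\<in>UNIV. \<Sum>w\<in>UNIV. u v * u w *
        ((p v \<bullet> p w) * (q v \<bullet> q w) + (p v \<bullet> q w) * (q v \<bullet> p w)))"
    unfolding sq by (simp add: centered_product_covariance[OF g])
qed

text \<open>The quadratic form grows at most like \<open>1 + |x|\<^sup>2\<close>, so its third absolute moment is controlled by the
sixth moment of the norm.\<close>

lemma centered_quadratic_third_moment:
  fixes u :: "'v::finite \<Rightarrow> real" and p q :: "'v \<Rightarrow> 'b::euclidean_space"
  defines "\<phi> \<equiv> \<lambda>x. \<Sum>v\<in>UNIV. u v * centered_product (p v) (q v) x"
  shows "\<exists>C. \<forall>g. standard_gaussian g \<longrightarrow>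
    integrable M (\<lambda>\<omega>. \<bar>\<phi> (g \<omega>)\<bar> ^ 3) \<and> expectation (\<lambda>\<omega>. \<bar>\<phi> (g \<omega>)\<bar> ^ 3) \<le> C"
proof -
  obtain c where c: "\<And>g :: 'a \<Rightarrow> 'b. standard_gaussian g \<Longrightarrow>
     integrable M (\<lambda>\<omega>. norm (g \<omega>) ^ (2 * 3)) \<and> expectation (\<lambda>\<omega>. norm (g \<omega>) ^ (2 * 3)) \<le> c"
    using standard_gaussian_norm_moment[of 3, where 'b='b] by blast
  define \<kappa> where "\<kappa> = (\<Sum>v\<in>UNIV. \<bar>u v\<bar> * (norm (p v) * norm (q v)))"
  have \<kappa>: "0 \<le> \<kappa>" by (simp add: \<kappa>_def sum_nonneg)
  have cp: "\<bar>centered_product a b x\<bar> \<le> norm a * norm b * (1 + (norm x)\<^sup>2)" for a b x :: 'b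
  proof -
    have "\<bar>(a \<bullet> x) * (b \<bullet> x)\<bar> \<le> (norm a * norm x) * (norm b * norm x)"
      unfolding abs_mult by (intro mult_mono Cauchy_Schwarz_ineq2) auto
    then show ?thesis using Cauchy_Schwarz_ineq2[of a b] abs_triangle_ineq4[of "(a \<bullet> x) * (b \<bullet> x)" "a \<bullet> b"]
      unfolding centered_product_def by (simp add: algebra_simps power2_eq_square)
  qed
  have \<phi>: "\<bar>\<phi> x\<bar> \<le> \<kappa> * (1 + (norm x)\<^sup>2)" for x
  proof -
    have "\<bar>\<phi> x\<bar> \<le> (\<Sum>v\<in>UNIV. \<bar>u v * centered_product (p v) (q v) x\<bar>)" unfolding \<phi>_def by (rule sum_abs)
    also have "\<dots> \<le> (\<Sum>v\<in>UNIV. \<bar>u v\<bar> * (norm (p v) * norm (q v) * (1 + (norm x)\<^sup>2)))"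
      unfolding abs_mult by (intro sum_mono mult_left_mono cp) simp
    also have "\<dots> = \<kappa> * (1 + (norm x)\<^sup>2)" by (simp add: \<kappa>_def sum_distrib_right mult.assoc)
    finally show ?thesis .
  qed
  \<comment> \<open>Convexity of the cube.\<close>
  have cube: "(1 + y) ^ 3 \<le> 4 * (1 + y ^ 3)" if "0 \<le> y" for y :: real
  proof -
    have "0 \<le> 3 * ((1 - y)\<^sup>2 * (1 + y))" using that by simp
    also have "\<dots> = 4 * (1 + y ^ 3) - (1 + y) ^ 3" by (simp add: power2_eq_square power3_eq_cube algebra_simps)
    finally show ?thesis by simp
  qed
  have pw: "\<bar>\<phi> x\<bar> ^ 3 \<le> \<kappa> ^ 3 * 4 * (1 + norm x ^ (2 * 3))" for x
  proof -
    have "\<bar>\<phi> x\<bar> ^ 3 \<le> (\<kappa> * (1 + (norm x)\<^sup>2)) ^ 3" by (rule power_mono[OF \<phi>]) simp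
    also have "\<dots> \<le> \<kappa> ^ 3 * (4 * (1 + ((norm x)\<^sup>2) ^ 3))"
      using \<kappa> cube[of "(norm x)\<^sup>2"] by (simp add: power_mult_distrib mult_left_mono)
    finally show ?thesis by (simp only: power_mult mult.assoc)
  qed
  have m\<phi>[measurable]: "\<phi> \<in> borel_measurable borel" unfolding \<phi>_def by measurable
  show ?thesis
  proof (intro exI allI impI conjI)
    fix g :: "'a \<Rightarrow> 'b" assume g: "standard_gaussian g"
    note [measurable] = standard_gaussian_measurable[OF g]
    have i: "integrable M (\<lambda>\<omega>. \<kappa> ^ 3 * 4 * (1 + norm (g \<omega>) ^ (2 * 3)))" using c[OF g] by simp
    show j: "integrable M (\<lambda>\<omega>. \<bar>\<phi> (g \<omega>)\<bar> ^ 3)"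
      by (rule Bochner_Integration.integrable_bound[OF i])
        (measurable, intro AE_I2, unfold real_norm_def, rule order_trans[OF _ abs_ge_self], use pw in simp)
    have "expectation (\<lambda>\<omega>. \<bar>\<phi> (g \<omega>)\<bar> ^ 3) \<le> expectation (\<lambda>\<omega>. \<kappa> ^ 3 * 4 * (1 + norm (g \<omega>) ^ (2 * 3)))"
      by (rule integral_mono[OF j i pw])
    also have "\<dots> = \<kappa> ^ 3 * 4 * (1 + expectation (\<lambda>\<omega>. norm (g \<omega>) ^ (2 * 3)))"
      using c[OF g] by (simp add: prob_space)
    also have "\<dots> \<le> \<kappa> ^ 3 * 4 * (1 + c)" using c[OF g] \<kappa> by (intro mult_left_mono) auto
    finally show "expectation (\<lambda>\<omega>. \<bar>\<phi> (g \<omega>)\<bar> ^ 3) \<le> \<kappa> ^ 3 * 4 * (1 + c)" .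
  qed
qed

end

section \<open>Arrays of Gaussian innovations\<close>

lemma (in prob_space) indep_set_mono:
  assumes "indep_set A B" "A' \<subseteq> A" "B' \<subseteq> B"
  shows "indep_set A' B'"
  using assms unfolding indep_set_def
  by (elim indep_sets_mono_sets) (auto split: bool.split)

lemma preimages_Int_stable: "Int_stable {f -` A \<inter> space P | A. A \<in> sets borel}"
proof (rule Int_stableI)
  fix a b assume "a \<in> {f -` A \<inter> space P | A. A \<in> sets borel}" "b \<in> {f -` A \<inter> space P | A. A \<in> sets borel}"
  then obtain A B where "A \<in> sets borel" "B \<in> sets borel" "a = f -` A \<inter> space P" "b = f -` B \<inter> space P" by blast
  then have "a \<inter> b = f -` (A \<inter> B) \<inter> space P" "A \<inter> B \<in> sets borel" by auto
  then show "a \<inter> b \<in> {f -` A \<inter> space P | A. A \<in> sets borel}" by blast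
qed

lemma (in prob_space) indep_var_compose_preimages:
  fixes F :: "'b::topological_space \<Rightarrow> 'd::topological_space" and G :: "'c::topological_space \<Rightarrow> 'd"
  assumes [measurable]: "f \<in> borel_measurable M" "g \<in> borel_measurable M"
    and F[measurable]: "F \<in> borel_measurable borel" and G[measurable]: "G \<in> borel_measurable borel"
    and ind: "indep_set (sigma_sets (space M) {f -` A \<inter> space M | A. A \<in> sets borel})
        (sigma_sets (space M) {g -` A \<inter> space M | A. A \<in> sets borel})"
  shows "indep_var borel (\<lambda>\<omega>. F (f \<omega>)) borel (\<lambda>\<omega>. G (g \<omega>))"
proof -
  have sub: "sigma_sets (space M) {(\<lambda>\<omega>. H (k \<omega>)) -` A \<inter> space M |A. A \<in> sets borel}
      \<subseteq> sigma_sets (space M) {k -` A \<inter> space M | A. A \<in> sets borel}"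
    if H: "H \<in> borel_measurable borel" for H :: "'e::topological_space \<Rightarrow> 'd" and k :: "'a \<Rightarrow> 'e"
  proof (rule sigma_sets_subseteq, rule subsetI)
    fix T assume "T \<in> {(\<lambda>\<omega>. H (k \<omega>)) -` A \<inter> space M |A. A \<in> sets borel}"
    then obtain A where A: "A \<in> sets borel" "T = (\<lambda>\<omega>. H (k \<omega>)) -` A \<inter> space M" by blast
    then have "T = k -` (H -` A) \<inter> space M" "H -` A \<in> sets borel"
      using measurable_sets[OF H A(1)] by auto
    then show "T \<in> {k -` A \<inter> space M | A. A \<in> sets borel}" by blast
  qed
  show ?thesis unfolding indep_var_eq
    by (intro conjI indep_set_mono[OF ind]) (use sub[OF F] sub[OF G] in \<open>measurable\<close>)
qed

text \<open>\<open>F k\<close> is the information available at the beginning of step \<open>k\<close>, and \<open>g k\<close> is the normalized noise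
of that step: known at its end and independent of everything known at its beginning.\<close>

locale gaussian_innovations = prob_space M for M :: "'a measure" +
  fixes F :: "nat \<Rightarrow> 'a measure" and g :: "nat \<Rightarrow> 'a \<Rightarrow> 'b::euclidean_space"
  assumes space_F: "\<And>k. space (F k) = space M"
    and F_subset: "\<And>k. sets (F k) \<subseteq> sets M"
    and F_mono: "\<And>j k. j \<le> k \<Longrightarrow> sets (F j) \<subseteq> sets (F k)"
    and g_adapted: "\<And>k. g k \<in> borel_measurable (F (Suc k))"
    and g_gaussian: "\<And>k. standard_gaussian (g k)"
    and g_indep: "\<And>k. indep_set (sets (F k)) {g k -` A \<inter> space M | A. A \<in> sets borel}"
begin

lemma measurable_F: "f \<in> borel_measurable (F k) \<Longrightarrow> f \<in> borel_measurable M"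
  using F_subset[of k] space_F[of k] by (auto simp: measurable_def)

lemma measurable_F_mono: "f \<in> borel_measurable (F j) \<Longrightarrow> j \<le> k \<Longrightarrow> f \<in> borel_measurable (F k)"
  using F_mono[of j k] space_F by (auto simp: measurable_def)

lemma g_measurable[measurable]: "g k \<in> borel_measurable M"
  by (rule measurable_F[OF g_adapted])

lemma innovation_indep_var:
  fixes f :: "'a \<Rightarrow> 'c::{real_normed_field, banach, second_countable_topology}"
  assumes f: "f \<in> borel_measurable (F k)" and \<phi>[measurable]: "\<phi> \<in> borel_measurable borel"
  shows "indep_var borel f borel (\<lambda>\<omega>. \<phi> (g k \<omega>) :: 'c)"
proof -
  let ?G = "{g k -` A \<inter> space M | A. A \<in> sets borel}"
  have "indep_set (sigma_sets (space M) (sets (F k))) (sigma_sets (space M) ?G)"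
    by (rule indep_set_sigma_sets[OF g_indep sets.Int_stable preimages_Int_stable])
  then have ind: "indep_set (sigma_sets (space M) {f -` A \<inter> space M | A. A \<in> sets borel}) (sigma_sets (space M) ?G)"
    by (rule indep_set_mono[OF _ sigma_sets_subseteq order_refl])
      (use f space_F[of k] in \<open>auto simp: measurable_def\<close>)
  show ?thesis
    by (rule indep_var_compose_preimages[where F="\<lambda>x. x", OF measurable_F[OF f] g_measurable _ \<phi> ind]) simp
qed

lemma expectation_innovation:
  fixes f :: "'a \<Rightarrow> 'c::{real_normed_field, banach, second_countable_topology}"
  assumes "f \<in> borel_measurable (F k)" "\<phi> \<in> borel_measurable borel"
    and "integrable M f" "integrable M (\<lambda>\<omega>. \<phi> (g k \<omega>))"
  shows "integrable M (\<lambda>\<omega>. f \<omega> * \<phi> (g k \<omega>))"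
    and "expectation (\<lambda>\<omega>. f \<omega> * \<phi> (g k \<omega>)) = expectation f * expectation (\<lambda>\<omega>. \<phi> (g k \<omega>))"
  using indep_var_integrable[OF innovation_indep_var[OF assms(1,2)] assms(3,4)]
    indep_var_lebesgue_integral[OF innovation_indep_var[OF assms(1,2)] assms(3,4)] by auto

lemma innovation_sum_adapted:
  fixes \<phi> :: "'b \<Rightarrow> real"
  assumes "\<And>k. b k \<in> borel_measurable (F k)" and [measurable]: "\<phi> \<in> borel_measurable borel"
  shows "(\<lambda>\<omega>. \<Sum>k<n. b k \<omega> * \<phi> (g k \<omega>)) \<in> borel_measurable (F n)"
proof (rule borel_measurable_sum)
  fix k assume k: "k \<in> {..<n}"
  have [measurable]: "b k \<in> borel_measurable (F n)" "g k \<in> borel_measurable (F n)"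
    using k by (auto intro: measurable_F_mono[OF assms(1)] measurable_F_mono[OF g_adapted])
  show "(\<lambda>\<omega>. b k \<omega> * \<phi> (g k \<omega>)) \<in> borel_measurable (F n)" by measurable
qed

text \<open>The summands are orthogonal: the partial sum and the next coefficient are known before the
centred factor \<open>\<phi> (g n)\<close>, which is independent of them.\<close>

lemma innovation_sum_second_moment:
  fixes \<phi> :: "'b \<Rightarrow> real"
  assumes b: "\<And>k. b k \<in> borel_measurable (F k)" "\<And>k. integrable M (\<lambda>\<omega>. (b k \<omega>)\<^sup>2)"
      "\<And>k. expectation (\<lambda>\<omega>. (b k \<omega>)\<^sup>2) \<le> C"
    and \<phi>[measurable]: "\<phi> \<in> borel_measurable borel" and \<phi>2: "\<And>k. integrable M (\<lambda>\<omega>. (\<phi> (g k \<omega>))\<^sup>2)"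
    and mean: "\<And>k. expectation (\<lambda>\<omega>. \<phi> (g k \<omega>)) = 0" and var: "\<And>k. expectation (\<lambda>\<omega>. (\<phi> (g k \<omega>))\<^sup>2) = s"
  shows "integrable M (\<lambda>\<omega>. (\<Sum>k<n. b k \<omega> * \<phi> (g k \<omega>))\<^sup>2) \<and>
    expectation (\<lambda>\<omega>. (\<Sum>k<n. b k \<omega> * \<phi> (g k \<omega>))\<^sup>2) \<le> real n * (C * s)"
proof (induction n)
  case (Suc n)
  let ?S = "\<lambda>\<omega>. \<Sum>k<n. b k \<omega> * \<phi> (g k \<omega>)"
  have S: "?S \<in> borel_measurable (F n)" by (rule innovation_sum_adapted[OF b(1) \<phi>])
  have [measurable]: "?S \<in> borel_measurable M" "b n \<in> borel_measurable M"
    using measurable_F[OF S] measurable_F[OF b(1)] by auto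
  have \<phi>1: "integrable M (\<lambda>\<omega>. \<phi> (g n \<omega>))"
    by (rule square_integrable_imp_integrable[OF _ \<phi>2]) measurable
  have "integrable M (\<lambda>\<omega>. ?S \<omega> * b n \<omega>)"
  proof (rule Bochner_Integration.integrable_bound)
    show "integrable M (\<lambda>\<omega>. (?S \<omega>)\<^sup>2 + (b n \<omega>)\<^sup>2)" using Suc.IH b(2) by simp
    have "\<bar>x * y\<bar> \<le> x\<^sup>2 + y\<^sup>2" for x y :: real
    proof -
      have "2 * (\<bar>x\<bar> * \<bar>y\<bar>) \<le> x\<^sup>2 + y\<^sup>2" "0 \<le> \<bar>x\<bar> * \<bar>y\<bar>"
        using sum_squares_bound[of "\<bar>x\<bar>" "\<bar>y\<bar>"] by auto
      then show ?thesis unfolding abs_mult by linarith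
    qed
    then show "AE \<omega> in M. norm (?S \<omega> * b n \<omega>) \<le> norm ((?S \<omega>)\<^sup>2 + (b n \<omega>)\<^sup>2)" by simp
  qed measurable
  moreover have "(\<lambda>\<omega>. ?S \<omega> * b n \<omega>) \<in> borel_measurable (F n)" using S b(1) by measurable
  ultimately have cross: "integrable M (\<lambda>\<omega>. (?S \<omega> * b n \<omega>) * \<phi> (g n \<omega>))"
      "expectation (\<lambda>\<omega>. (?S \<omega> * b n \<omega>) * \<phi> (g n \<omega>)) = 0"
    using expectation_innovation[OF _ \<phi> _ \<phi>1, of "\<lambda>\<omega>. ?S \<omega> * b n \<omega>"] mean by auto
  have [measurable]: "(\<lambda>x. (\<phi> x)\<^sup>2) \<in> borel_measurable borel" by measurable
  have bF: "(\<lambda>\<omega>. (b n \<omega>)\<^sup>2) \<in> borel_measurable (F n)" using b(1) by measurable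
  note sq = expectation_innovation[where \<phi>="\<lambda>x. (\<phi> x)\<^sup>2", OF bF _ b(2) \<phi>2, simplified]
  have s0: "0 \<le> s" using var[of 0] by (metis Bochner_Integration.integral_nonneg zero_le_power2)
  have eq: "(\<Sum>k<Suc n. b k \<omega> * \<phi> (g k \<omega>))\<^sup>2 =
      (?S \<omega>)\<^sup>2 + 2 * ((?S \<omega> * b n \<omega>) * \<phi> (g n \<omega>)) + (b n \<omega>)\<^sup>2 * (\<phi> (g n \<omega>))\<^sup>2" for \<omega>
    by (simp add: power2_eq_square algebra_simps)
  have int: "integrable M (\<lambda>\<omega>. (\<Sum>k<Suc n. b k \<omega> * \<phi> (g k \<omega>))\<^sup>2)"
    unfolding eq using Suc.IH cross(1) sq(1)
    by (intro Bochner_Integration.integrable_add integrable_mult_right) auto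
  have "expectation (\<lambda>\<omega>. (\<Sum>k<Suc n. b k \<omega> * \<phi> (g k \<omega>))\<^sup>2) =
      expectation (\<lambda>\<omega>. (?S \<omega>)\<^sup>2) + 2 * 0 + expectation (\<lambda>\<omega>. (b n \<omega>)\<^sup>2) * s"
    unfolding eq using Suc.IH cross sq var[of n]
    by (subst Bochner_Integration.integral_add, simp, simp)+ (simp add: mult.assoc)
  also have "\<dots> \<le> real n * (C * s) + C * s"
    using Suc.IH mult_right_mono[OF b(3)[of n] s0] by simp
  finally show ?case using int by (simp add: distrib_right)
qed simp

lemma innovation_sum_char:
  fixes \<phi> :: "'b \<Rightarrow> real"
  assumes \<phi>[measurable]: "\<phi> \<in> borel_measurable borel"
  shows "expectation (\<lambda>\<omega>. iexp (t * (\<Sum>k<n. \<phi> (g k \<omega>)))) = (\<Prod>k<n. expectation (\<lambda>\<omega>. iexp (t * \<phi> (g k \<omega>))))"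
proof (induction n)
  case (Suc n)
  have S: "(\<lambda>\<omega>. \<Sum>k<n. \<phi> (g k \<omega>)) \<in> borel_measurable (F n)"
    using innovation_sum_adapted[of "\<lambda>_ _. 1" \<phi> n] by simp
  note [measurable] = S measurable_F[OF S]
  have F: "(\<lambda>\<omega>. iexp (t * (\<Sum>k<n. \<phi> (g k \<omega>)))) \<in> borel_measurable (F n)" by measurable
  have "expectation (\<lambda>\<omega>. iexp (t * (\<Sum>k<Suc n. \<phi> (g k \<omega>)))) =
      expectation (\<lambda>\<omega>. iexp (t * (\<Sum>k<n. \<phi> (g k \<omega>))) * iexp (t * \<phi> (g n \<omega>)))"
    by (simp add: exp_add[symmetric] algebra_simps)
  also have "\<dots> = expectation (\<lambda>\<omega>. iexp (t * (\<Sum>k<n. \<phi> (g k \<omega>)))) * expectation (\<lambda>\<omega>. iexp (t * \<phi> (g n \<omega>)))"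
    by (rule expectation_innovation(2)[OF F, where \<phi>="\<lambda>x. iexp (t * \<phi> x)"])
      (auto intro!: integrable_const_bound[where B=1])
  finally show ?case by (simp only: Suc.IH prod.lessThan_Suc)
qed (simp add: prob_space)

text \<open>The characteristic function of the sum is a product, and each factor differs from \<open>1 - s/(2n)\<close> by a
third order term, which is uniformly of order \<open>n\<close> to the power \<open>-3/2\<close>. Products of numbers of modulus at most
one differ at most by the sum of the differences of their factors; the bound on \<open>s\<close> puts
\<open>1 - s/(2n)\<close> into the unit disc.\<close>

lemma innovation_clt_bound:
  fixes \<phi> :: "'b \<Rightarrow> real"
  assumes \<phi>[measurable]: "\<phi> \<in> borel_measurable borel"
    and \<phi>2: "\<And>k. integrable M (\<lambda>\<omega>. (\<phi> (g k \<omega>))\<^sup>2)"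
    and mean: "\<And>k. expectation (\<lambda>\<omega>. \<phi> (g k \<omega>)) = 0" and var: "\<And>k. expectation (\<lambda>\<omega>. (\<phi> (g k \<omega>))\<^sup>2) = s"
    and \<phi>3: "\<And>k. integrable M (\<lambda>\<omega>. \<bar>\<phi> (g k \<omega>)\<bar> ^ 3)" "\<And>k. expectation (\<lambda>\<omega>. \<bar>\<phi> (g k \<omega>)\<bar> ^ 3) \<le> c"
    and n: "0 < n" "s \<le> 4 * real n"
  shows "cmod (expectation (\<lambda>\<omega>. iexp ((\<Sum>k<n. \<phi> (g k \<omega>)) / sqrt (real n))) -
      complex_of_real ((1 + (- s / 2) / real n) ^ n)) \<le> c / (6 * sqrt (real n))"
proof -
  define t where "t = 1 / sqrt (real n)"
  have t2: "t\<^sup>2 = 1 / real n" and t0: "0 < t" using n by (auto simp: t_def power_divide)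
  have s0: "0 \<le> s" using var[of 0] by (metis Bochner_Integration.integral_nonneg zero_le_power2)
  have w: "cmod (complex_of_real (1 - t\<^sup>2 * s / 2)) \<le> 1"
    using n s0 unfolding t2 norm_of_real by (auto simp: abs_le_iff field_simps)
  have one: "cmod (expectation (\<lambda>\<omega>. iexp (t * \<phi> (g k \<omega>))) - complex_of_real (1 - t\<^sup>2 * s / 2)) \<le> t^3 * c / 6" for k
  proof -
    have \<phi>1: "integrable M (\<lambda>\<omega>. \<phi> (g k \<omega>))"
      by (rule square_integrable_imp_integrable[OF _ \<phi>2]) measurable
    have "cmod (char (distr M borel (\<lambda>\<omega>. \<phi> (g k \<omega>))) t - (1 - t^2 * s / 2)) \<le>
      (t^2 / 6) * expectation (\<lambda>\<omega>. min (6 * (\<phi> (g k \<omega>))^2) (\<bar>t\<bar> * \<bar>\<phi> (g k \<omega>)\<bar>^3))"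
      by (rule char_approx3'[OF _ \<phi>1 \<phi>2 mean _ refl]) (auto simp: mean var)
    also have "\<dots> \<le> (t^2 / 6) * (t * c)"
    proof (rule mult_left_mono)
      have "expectation (\<lambda>\<omega>. min (6 * (\<phi> (g k \<omega>))^2) (\<bar>t\<bar> * \<bar>\<phi> (g k \<omega>)\<bar>^3)) \<le>
          expectation (\<lambda>\<omega>. t * \<bar>\<phi> (g k \<omega>)\<bar>^3)"
      proof (rule integral_mono)
        show "integrable M (\<lambda>\<omega>. min (6 * (\<phi> (g k \<omega>))^2) (\<bar>t\<bar> * \<bar>\<phi> (g k \<omega>)\<bar>^3))"
          using \<phi>2 \<phi>3(1) by (intro integrable_min integrable_mult_right)
      qed (use \<phi>3(1) t0 in \<open>auto\<close>)
      also have "\<dots> \<le> t * c" using \<phi>3(2)[of k] t0 by simp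
      finally show "expectation (\<lambda>\<omega>. min (6 * (\<phi> (g k \<omega>))^2) (\<bar>t\<bar> * \<bar>\<phi> (g k \<omega>)\<bar>^3)) \<le> t * c" .
    qed simp
    finally show ?thesis
      by (simp add: char_def integral_distr power2_eq_square power3_eq_cube mult_ac)
  qed
  have "cmod ((\<Prod>k<n. expectation (\<lambda>\<omega>. iexp (t * \<phi> (g k \<omega>)))) - (\<Prod>k<n. complex_of_real (1 - t\<^sup>2 * s / 2)))
      \<le> (\<Sum>k<n. cmod (expectation (\<lambda>\<omega>. iexp (t * \<phi> (g k \<omega>))) - complex_of_real (1 - t\<^sup>2 * s / 2)))"
  proof (rule norm_prod_diff)
    show "cmod (expectation (\<lambda>\<omega>. iexp (t * \<phi> (g k \<omega>)))) \<le> 1" for k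
      by (rule order_trans[OF integral_norm_bound]) (simp add: prob_space)
  qed (rule w)
  also have "\<dots> \<le> (\<Sum>k<n. t^3 * c / 6)" by (rule sum_mono) (rule one)
  also have "\<dots> = c / (6 * sqrt (real n))"
    using n by (simp add: t_def power3_eq_cube field_simps)
  finally have "cmod ((\<Prod>k<n. expectation (\<lambda>\<omega>. iexp (t * \<phi> (g k \<omega>)))) -
      complex_of_real ((1 - t\<^sup>2 * s / 2) ^ n)) \<le> c / (6 * sqrt (real n))"
    by simp
  moreover have "1 - t\<^sup>2 * s / 2 = 1 + (- s / 2) / real n" by (simp add: t2)
  moreover have "(\<Prod>k<n. expectation (\<lambda>\<omega>. iexp (t * \<phi> (g k \<omega>)))) =
      expectation (\<lambda>\<omega>. iexp ((\<Sum>k<n. \<phi> (g k \<omega>)) / sqrt (real n)))"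
    unfolding innovation_sum_char[OF \<phi>, symmetric] by (simp add: t_def)
  ultimately show ?thesis by simp
qed

end

lemma innovation_clt:
  fixes \<phi> :: "'b::euclidean_space \<Rightarrow> real"
  assumes inn: "\<And>n. 0 < n \<Longrightarrow> gaussian_innovations M (F n) (g n)"
    and \<phi>[measurable]: "\<phi> \<in> borel_measurable borel"
    and \<phi>2: "\<And>n k. 0 < n \<Longrightarrow> integrable M (\<lambda>\<omega>. (\<phi> (g n k \<omega>))\<^sup>2)"
    and mean: "\<And>n k. 0 < n \<Longrightarrow> (\<integral>\<omega>. \<phi> (g n k \<omega>) \<partial>M) = 0"
    and var: "\<And>n k. 0 < n \<Longrightarrow> (\<integral>\<omega>. (\<phi> (g n k \<omega>))\<^sup>2 \<partial>M) = s"
    and \<phi>3: "\<And>n k. 0 < n \<Longrightarrow> integrable M (\<lambda>\<omega>. \<bar>\<phi> (g n k \<omega>)\<bar> ^ 3)"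
        "\<And>n k. 0 < n \<Longrightarrow> (\<integral>\<omega>. \<bar>\<phi> (g n k \<omega>)\<bar> ^ 3 \<partial>M) \<le> c"
  shows "(\<lambda>n. \<integral>\<omega>. iexp ((\<Sum>k<n. \<phi> (g n k \<omega>)) / sqrt (real n)) \<partial>M) \<longlonglongrightarrow> exp (- complex_of_real s / 2)"
proof -
  have "eventually (\<lambda>n. s / 4 \<le> real n) sequentially"
    using filterlim_real_sequentially unfolding filterlim_at_top by blast
  then have "eventually (\<lambda>n. cmod ((\<integral>\<omega>. iexp ((\<Sum>k<n. \<phi> (g n k \<omega>)) / sqrt (real n)) \<partial>M) -
      complex_of_real ((1 + (- s / 2) / real n) ^ n)) \<le> c / 6 * inverse (sqrt (real n))) sequentially"
    using eventually_gt_at_top[of 0]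
  proof eventually_elim
    case (elim n)
    then show ?case
      using gaussian_innovations.innovation_clt_bound[OF inn \<phi> \<phi>2 mean var \<phi>3, of n n]
      by (simp add: field_simps)
  qed
  moreover have "(\<lambda>n. c / 6 * inverse (sqrt (real n))) \<longlonglongrightarrow> 0"
    by (intro tendsto_mult_right_zero tendsto_inverse_0_at_top filterlim_compose[OF sqrt_at_top] filterlim_real_sequentially)
  ultimately have "(\<lambda>n. (\<integral>\<omega>. iexp ((\<Sum>k<n. \<phi> (g n k \<omega>)) / sqrt (real n)) \<partial>M) -
      complex_of_real ((1 + (- s / 2) / real n) ^ n)) \<longlonglongrightarrow> 0"
    by (rule Lim_null_comparison)
  moreover have "(\<lambda>n. complex_of_real ((1 + (- s / 2) / real n) ^ n)) \<longlonglongrightarrow> complex_of_real (exp (- s / 2))"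
    by (intro tendsto_of_real tendsto_exp_limit_sequentially)
  ultimately show ?thesis
    using Lim_transform by (fastforce simp flip: exp_of_real)
qed

text \<open>The bound for the cross products of drift and noise. Write \<open>d k = r k + h \<beta> k\<close> with the frozen drift
\<open>\<beta> k\<close>. The error \<open>r k\<close> is so small, of size \<open>h\<close> to the power \<open>3/2\<close>, that its products may be
estimated one by one. The products with \<open>\<beta> k\<close> are orthogonal, so their sum is only of order \<open>\<surd>n\<close>.\<close>

lemma (in gaussian_innovations) innovation_cross_sum_bound:
  fixes d \<beta> :: "nat \<Rightarrow> 'a \<Rightarrow> real"
  assumes d[measurable]: "\<And>k. d k \<in> borel_measurable M" and \<beta>: "\<And>k. \<beta> k \<in> borel_measurable (F k)"
    and \<beta>2: "\<And>k. integrable M (\<lambda>\<omega>. (\<beta> k \<omega>)\<^sup>2)" "\<And>k. expectation (\<lambda>\<omega>. (\<beta> k \<omega>)\<^sup>2) \<le> C"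
    and r2: "\<And>k. integrable M (\<lambda>\<omega>. (d k \<omega> - h * \<beta> k \<omega>)\<^sup>2)" "\<And>k. expectation (\<lambda>\<omega>. (d k \<omega> - h * \<beta> k \<omega>)\<^sup>2) \<le> C * h ^ 3"
    and h: "0 < h" and n: "0 < n"
  shows "mean_abs_le (\<lambda>\<omega>. \<Sum>k<n. d k \<omega> * (v \<bullet> g k \<omega>))
      (real n * sqrt h * ((C + v \<bullet> v) / 2 * h + (C * (v \<bullet> v) + 1) / 2 * sqrt (h / real n)))"
proof -
  have [measurable]: "\<beta> k \<in> borel_measurable M" for k by (rule measurable_F[OF \<beta>])
  define r where "r k \<omega> = d k \<omega> - h * \<beta> k \<omega>" for k \<omega>
  have rm[measurable]: "r k \<in> borel_measurable M" for k unfolding r_def by measurable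
  \<comment> \<open>\<open>c\<close> is \<open>h\<close> to the power \<open>3/2\<close>, the size of \<open>r k\<close> relative to the noise.\<close>
  define c where "c = h * sqrt h"
  have c: "0 < c" "h ^ 3 = c * c" using h by (auto simp: c_def power3_eq_cube)
  define m where "m \<omega> = (\<Sum>k<n. \<beta> k \<omega> * (v \<bullet> g k \<omega>))" for \<omega>
  have g2: "integrable M (\<lambda>\<omega>. (v \<bullet> g k \<omega>)\<^sup>2)" "expectation (\<lambda>\<omega>. (v \<bullet> g k \<omega>)\<^sup>2) = v \<bullet> v" for k
    using standard_gaussian_second_moment[OF g_gaussian, where a=v and b=v] by (auto simp: power2_eq_square)
  have "mean_abs_le (\<lambda>\<omega>. r k \<omega> * (v \<bullet> g k \<omega>)) ((C * h ^ 3 / c + c * (v \<bullet> v)) / 2)" for k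
    by (rule mean_abs_le_mult) (use r2 g2 c in \<open>auto simp: r_def\<close>)
  then have "mean_abs_le (\<lambda>\<omega>. \<Sum>k<n. r k \<omega> * (v \<bullet> g k \<omega>)) (\<Sum>k<n. (C * h ^ 3 / c + c * (v \<bullet> v)) / 2)"
    by (rule mean_abs_le_sum)
  moreover have "(\<Sum>k<n. (C * h ^ 3 / c + c * (v \<bullet> v)) / 2) = real n * ((C + v \<bullet> v) / 2 * c)"
    using c by (simp add: field_simps)
  ultimately have r: "mean_abs_le (\<lambda>\<omega>. \<Sum>k<n. r k \<omega> * (v \<bullet> g k \<omega>)) (real n * ((C + v \<bullet> v) / 2 * c))" by (simp only:)
  have [measurable]: "m \<in> borel_measurable M" unfolding m_def by measurable
  have "mean_abs_le m (sqrt (real n) * ((C * (v \<bullet> v) + 1) / 2))"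
    by (rule mean_abs_le_second_moment)
      (use innovation_sum_second_moment[OF \<beta> \<beta>2, where \<phi>="\<lambda>x. v \<bullet> x" and s="v \<bullet> v", of n] g2 n
        standard_gaussian_first_moment(2)[OF g_gaussian, where v=v] in \<open>auto simp: m_def\<close>)
  then have m: "mean_abs_le (\<lambda>\<omega>. h * m \<omega>) (\<bar>h\<bar> * (sqrt (real n) * ((C * (v \<bullet> v) + 1) / 2)))"
    by (rule mean_abs_le_cmult)
  have eq: "(\<Sum>k<n. d k \<omega> * (v \<bullet> g k \<omega>)) = (\<Sum>k<n. r k \<omega> * (v \<bullet> g k \<omega>)) + h * m \<omega>" for \<omega>
    by (simp add: r_def m_def sum_distrib_left sum.distrib[symmetric] algebra_simps)
  have "real n * sqrt h * (sqrt h / sqrt (real n)) = (real n / sqrt (real n)) * (sqrt h * sqrt h)"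
    by simp
  also have "\<dots> = sqrt (real n) * h" using h by (simp only: real_div_sqrt of_nat_0_le_iff) simp
  finally have hn: "h * sqrt (real n) = real n * sqrt h * sqrt (h / real n)"
    by (simp add: real_sqrt_divide)
  have "real n * ((C + v \<bullet> v) / 2 * c) + \<bar>h\<bar> * (sqrt (real n) * ((C * (v \<bullet> v) + 1) / 2)) =
      real n * ((C + v \<bullet> v) / 2 * (h * sqrt h)) + h * sqrt (real n) * ((C * (v \<bullet> v) + 1) / 2)"
    using h by (simp add: c_def)
  also have "\<dots> = real n * sqrt h * ((C + v \<bullet> v) / 2 * h + (C * (v \<bullet> v) + 1) / 2 * sqrt (h / real n))"
    unfolding hn by (simp add: algebra_simps)
  finally show ?thesis using mean_abs_le_add[OF r m] unfolding eq by simp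
qed

section \<open>Integrals along continuous paths and the Euler scheme\<close>

lemma norm_integral_minus_const_le:
  fixes f :: "real \<Rightarrow> 'b::euclidean_space"
  assumes "a \<le> b" "continuous_on {a..b} f" "\<And>x. x \<in> {a..b} \<Longrightarrow> norm (f x - v) \<le> e"
  shows "norm (integral {a..b} f - (b - a) *\<^sub>R v) \<le> e * (b - a)"
proof -
  have f: "f integrable_on {a..b}" by (rule integrable_continuous_real[OF assms(2)])
  have "integral {a..b} f - (b - a) *\<^sub>R v = integral {a..b} (\<lambda>x. f x - v)"
    using assms(1) f by (subst Henstock_Kurzweil_Integration.integral_diff) auto
  also have "norm \<dots> \<le> e * (b - a)"
    by (rule integral_bound) (use assms in \<open>auto intro!: continuous_intros\<close>)
  finally show ?thesis .
qed

lemma integral_eq_sum_subintervals: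
  fixes f :: "real \<Rightarrow> 'b::euclidean_space"
  assumes "0 \<le> d" "continuous_on {a..a + real n * d} f"
  shows "integral {a..a + real n * d} f = (\<Sum>k<n. integral {a + real k * d..a + real (Suc k) * d} f)"
  using assms(2)
proof (induction n)
  case (Suc n)
  have c: "continuous_on {a..a + real n * d} f"
    by (rule continuous_on_subset[OF Suc.prems]) (use assms(1) in \<open>auto simp: algebra_simps\<close>)
  have "integral {a..a + real (Suc n) * d} f =
      integral {a..a + real n * d} f + integral {a + real n * d..a + real (Suc n) * d} f"
    by (rule Henstock_Kurzweil_Integration.integral_combine[symmetric])
      (use assms(1) Suc.prems in \<open>auto intro!: integrable_continuous_real simp: distrib_right\<close>)
  then show ?case using Suc.IH[OF c] by simp
qed simp

lemma riemann_sum_tendsto_integral: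
  fixes f :: "real \<Rightarrow> 'b::euclidean_space"
  assumes ab: "a \<le> b" and f: "continuous_on {a..b} f"
  shows "(\<lambda>n. \<Sum>k<n. ((b - a) / real n) *\<^sub>R f (a + real k * ((b - a) / real n))) \<longlonglongrightarrow> integral {a..b} f"
proof (rule LIMSEQ_I)
  fix r :: real assume r: "0 < r"
  define e where "e = r / (2 * (b - a + 1))"
  have e: "0 < e" using r ab by (simp add: e_def)
  have "uniformly_continuous_on {a..b} f" by (rule compact_uniformly_continuous[OF f]) simp
  then obtain d where d: "0 < d" "\<And>x y. x \<in> {a..b} \<Longrightarrow> y \<in> {a..b} \<Longrightarrow> dist y x < d \<Longrightarrow> dist (f y) (f x) < e"
    using e unfolding uniformly_continuous_on_def by metis
  obtain m :: nat where m: "(b - a) / d < real m" using reals_Archimedean2 by blast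
  show "\<exists>no. \<forall>n\<ge>no. norm ((\<Sum>k<n. ((b - a) / real n) *\<^sub>R f (a + real k * ((b - a) / real n))) - integral {a..b} f) < r"
  proof (intro exI[of _ "Suc m"] allI impI)
    fix n assume n: "Suc m \<le> n"
    define h where "h = (b - a) / real n"
    have n0: "0 < real n" and h0: "0 \<le> h" and nh: "real n * h = b - a" using n ab by (auto simp: h_def)
    have "(b - a) / d < real n" using m n by linarith
    then have hd: "h < d" using d(1) n0 by (simp add: h_def field_simps)
    have one: "norm (integral {a + real k * h..a + real (Suc k) * h} f - h *\<^sub>R f (a + real k * h)) \<le> e * h" if "k < n" for k
    proof -
      have le: "a + real k * h \<le> a + real (Suc k) * h" using h0 by (simp add: distrib_right)
      have "real (Suc k) * h \<le> real n * h" using that h0 by (intro mult_right_mono) auto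
      then have sub: "{a + real k * h..a + real (Suc k) * h} \<subseteq> {a..b}"
        using nh h0 by (auto intro: order_trans[of a "a + real k * h"])
      have "norm (f x - f (a + real k * h)) \<le> e" if x: "x \<in> {a + real k * h..a + real (Suc k) * h}" for x
      proof -
        have "dist x (a + real k * h) < d" using x hd by (auto simp: dist_real_def distrib_right)
        then show ?thesis using d(2)[of "a + real k * h" x] x sub le by (force simp: dist_norm)
      qed
      from norm_integral_minus_const_le[OF le continuous_on_subset[OF f sub] this]
      show ?thesis by (simp add: distrib_right)
    qed
    have "integral {a..b} f = (\<Sum>k<n. integral {a + real k * h..a + real (Suc k) * h} f)"
      using integral_eq_sum_subintervals[OF h0, of a n f] f by (simp add: nh)
    then have "norm ((\<Sum>k<n. h *\<^sub>R f (a + real k * h)) - integral {a..b} f) =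
        norm (\<Sum>k<n. integral {a + real k * h..a + real (Suc k) * h} f - h *\<^sub>R f (a + real k * h))"
      by (simp add: sum_subtractf norm_minus_commute)
    also have "\<dots> \<le> (\<Sum>k<n. e * h)" by (rule sum_norm_le) (use one in auto)
    also have "\<dots> = e * (b - a)" using nh by simp
    also have "\<dots> < r"
    proof -
      have "e * (b - a) \<le> e * (b - a + 1)" using e by simp
      also have "\<dots> = r / 2"
      proof -
        have *: "r / (2 * z) * z = r / 2" if "0 < z" for z :: real using that by simp
        show ?thesis unfolding e_def by (rule *) (use ab in simp)
      qed
      finally show ?thesis using r by simp
    qed
    finally show "norm ((\<Sum>k<n. ((b - a) / real n) *\<^sub>R f (a + real k * ((b - a) / real n))) - integral {a..b} f) < r"
      unfolding h_def .
  qed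
qed

text \<open>Valued in the extended nonnegative numbers, so that it can be bounded before integrability is known.\<close>

abbreviation mean_square :: "'w measure \<Rightarrow> ('w \<Rightarrow> 'b::real_normed_vector) \<Rightarrow> ennreal" where
  "mean_square P f \<equiv> (\<integral>\<^sup>+\<omega>. ennreal ((norm (f \<omega>))\<^sup>2) \<partial>P)"

text \<open>The Cauchy--Schwarz inequality for the integral over time, proved for Riemann sums and carried to the
limit by Fatou's lemma. Riemann sums involve the process at single times only, where its
measurability is given.\<close>

lemma nn_integral_norm_integral_sq_le:
  fixes F :: "real \<Rightarrow> 'w \<Rightarrow> 'b::euclidean_space"
  assumes ab: "a \<le> b" and F[measurable]: "\<And>v. v \<in> {a..b} \<Longrightarrow> F v \<in> borel_measurable M"
    and K: "\<And>v. v \<in> {a..b} \<Longrightarrow> mean_square M (F v) \<le> ennreal K" and K0: "0 \<le> K"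
    and cont: "AE \<omega> in M. continuous_on {a..b} (\<lambda>v. F v \<omega>)"
  shows "mean_square M (\<lambda>\<omega>. integral {a..b} (\<lambda>v. F v \<omega>)) \<le> ennreal (K * (b - a)\<^sup>2)"
proof -
  \<comment> \<open>The left endpoints of the subintervals; for \<open>n = 0\<close> the Riemann sum is empty.\<close>
  define p where "p n k = a + real k * ((b - a) / real n)" for n k :: nat
  define R where "R n \<omega> = (\<Sum>k<n. ((b - a) / real n) *\<^sub>R F (p n k) \<omega>)" for n \<omega>
  have p: "p n k \<in> {a..b}" if "k < n" for n k
  proof -
    have "real k * ((b - a) / real n) \<le> real n * ((b - a) / real n)" using that ab by (intro mult_right_mono) auto
    then show ?thesis using that ab by (auto simp: p_def)
  qed
  have [measurable]: "R n \<in> borel_measurable M" for n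
    unfolding R_def by (intro borel_measurable_sum borel_measurable_scaleR borel_measurable_const F p) simp
  have "mean_square M (\<lambda>\<omega>. integral {a..b} (\<lambda>v. F v \<omega>)) \<le>
      (\<integral>\<^sup>+\<omega>. liminf (\<lambda>n. ennreal ((norm (R n \<omega>))\<^sup>2)) \<partial>M)"
  proof (rule nn_integral_mono_AE)
    from cont show "AE \<omega> in M. ennreal ((norm (integral {a..b} (\<lambda>v. F v \<omega>)))\<^sup>2) \<le> liminf (\<lambda>n. ennreal ((norm (R n \<omega>))\<^sup>2))"
    proof eventually_elim
      case (elim \<omega>)
      have "(\<lambda>n. ennreal ((norm (R n \<omega>))\<^sup>2)) \<longlonglongrightarrow> ennreal ((norm (integral {a..b} (\<lambda>v. F v \<omega>)))\<^sup>2)"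
        unfolding R_def p_def
        by (intro tendsto_ennrealI tendsto_power tendsto_norm riemann_sum_tendsto_integral ab elim)
      from lim_imp_Liminf[OF _ this] show ?case by simp
    qed
  qed
  also have "\<dots> \<le> liminf (\<lambda>n. \<integral>\<^sup>+\<omega>. ennreal ((norm (R n \<omega>))\<^sup>2) \<partial>M)"
    by (rule nn_integral_liminf) measurable
  also have "\<dots> \<le> liminf (\<lambda>n. ennreal (K * (b - a)\<^sup>2))"
  proof (rule Liminf_mono, rule always_eventually, rule allI)
    fix n :: nat
    show "mean_square M (R n) \<le> ennreal (K * (b - a)\<^sup>2)"
    proof (cases "n = 0")
      case False
      define c where "c = (b - a)\<^sup>2 / real n"
      have c: "0 \<le> c" by (simp add: c_def)
      have "(norm (R n \<omega>))\<^sup>2 \<le> c * (\<Sum>k<n. (norm (F (p n k) \<omega>))\<^sup>2)" for \<omega>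
      proof -
        have "norm (R n \<omega>) \<le> (\<Sum>k<n. ((b - a) / real n) * norm (F (p n k) \<omega>))"
          unfolding R_def using ab by (intro order_trans[OF norm_sum]) (simp add: abs_mult)
        then have "(norm (R n \<omega>))\<^sup>2 \<le> (\<Sum>k<n. ((b - a) / real n) * norm (F (p n k) \<omega>))\<^sup>2"
          by (rule power_mono) simp
        also have "\<dots> \<le> (\<Sum>k<n. (((b - a) / real n) * norm (F (p n k) \<omega>))\<^sup>2) * real (card {..<n})"
          by (rule sum_squared_le_sum_of_squares)
        also have "\<dots> = c * (\<Sum>k<n. (norm (F (p n k) \<omega>))\<^sup>2)"
        proof -
          have "(\<Sum>k<n. (((b - a) / real n) * norm (F (p n k) \<omega>))\<^sup>2) =
              ((b - a) / real n)\<^sup>2 * (\<Sum>k<n. (norm (F (p n k) \<omega>))\<^sup>2)"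
            by (simp only: power_mult_distrib sum_distrib_left)
          then show ?thesis using False by (simp add: c_def power_divide power2_eq_square)
        qed
        finally show ?thesis .
      qed
      then have "mean_square M (R n) \<le>
          (\<integral>\<^sup>+\<omega>. ennreal c * (\<Sum>k<n. ennreal ((norm (F (p n k) \<omega>))\<^sup>2)) \<partial>M)"
        using c by (intro nn_integral_mono) (simp add: ennreal_mult[symmetric] sum_nonneg sum_ennreal)
      also have "\<dots> = ennreal c * (\<Sum>k<n. \<integral>\<^sup>+\<omega>. ennreal ((norm (F (p n k) \<omega>))\<^sup>2) \<partial>M)"
      proof -
        have [measurable]: "F (p n k) \<in> borel_measurable M" if "k \<in> {..<n}" for k using F p that by auto
        show ?thesis
          by (subst nn_integral_cmult, measurable, subst nn_integral_sum) auto
      qed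
      also have "\<dots> \<le> ennreal c * (\<Sum>k<n. ennreal K)"
        by (intro mult_left_mono sum_mono K p) auto
      also have "\<dots> = ennreal (K * (b - a)\<^sup>2)"
        using False c K0 by (simp add: sum_ennreal ennreal_mult[symmetric] c_def ennreal_of_nat_eq_real_of_nat mult.commute)
      finally show ?thesis .
    qed (simp add: R_def)
  qed
  also have "\<dots> = ennreal (K * (b - a)\<^sup>2)" by (simp add: Liminf_const)
  finally show ?thesis .
qed

text \<open>The Euler scheme with step \<open>h\<close> for the equation \<open>y t = y0 + \<integral>\<^sub>0\<^sup>t B (y s) ds + w t\<close>. The driving path enters
only through its values at the grid points.\<close>

primrec euler :: "('b::real_vector \<Rightarrow> 'b) \<Rightarrow> 'b \<Rightarrow> (real \<Rightarrow> 'b) \<Rightarrow> real \<Rightarrow> nat \<Rightarrow> 'b" where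
  "euler B y0 w h 0 = y0 + w 0"
| "euler B y0 w h (Suc k) = euler B y0 w h k + h *\<^sub>R B (euler B y0 w h k) + (w (real (Suc k) * h) - w (real k * h))"

lemma integral_equation_increment:
  fixes f y w :: "real \<Rightarrow> 'b::euclidean_space"
  assumes eq: "\<And>s. 0 \<le> s \<Longrightarrow> y s = y0 + integral {0..s} f + w s"
    and f: "continuous_on {0..} f" and ab: "0 \<le> a" "a \<le> b"
  shows "y b - y a = integral {a..b} f + (w b - w a)"
proof -
  have "integral {0..a} f + integral {a..b} f = integral {0..b} f"
    by (rule Henstock_Kurzweil_Integration.integral_combine)
      (use ab f in \<open>auto intro!: integrable_continuous_real elim: continuous_on_subset\<close>)
  then show ?thesis using eq[of a] eq[of b] ab by (simp add: algebra_simps)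
qed

text \<open>By uniform continuity of the path the local error of a step is at most \<open>h L e\<close>; the discrete
Gronwall inequality sums these errors to at most \<open>e (exp (L t) - 1)\<close>.\<close>

lemma euler_converges:
  fixes y w :: "real \<Rightarrow> 'b::euclidean_space"
  assumes eq: "\<And>s. 0 \<le> s \<Longrightarrow> y s = y0 + integral {0..s} (\<lambda>u. B (y u)) + w s"
    and L: "L-lipschitz_on UNIV B" and y: "continuous_on {0..} y" and t: "0 \<le> t"
  shows "(\<lambda>n. euler B y0 w (t / real n) n) \<longlonglongrightarrow> y t"
proof (rule LIMSEQ_I)
  fix r :: real assume r: "0 < r"
  define e where "e = r / (2 * exp (L * t))"
  have e: "0 < e" using r by (simp add: e_def)
  have L0: "0 \<le> L" using lipschitz_on_nonneg[OF L] .
  have Lip: "norm (B x - B z) \<le> L * norm (x - z)" for x z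
    using lipschitz_onD[OF L, of x z] by (simp add: dist_norm)
  have contB: "continuous_on {0..} (\<lambda>u. B (y u))"
    using continuous_on_compose2[OF lipschitz_on_continuous_on[OF L] y] by simp
  have "uniformly_continuous_on {0..t} y"
    by (rule compact_uniformly_continuous[OF continuous_on_subset[OF y]]) auto
  then obtain d where d: "0 < d" "\<And>x x'. x \<in> {0..t} \<Longrightarrow> x' \<in> {0..t} \<Longrightarrow> dist x' x < d \<Longrightarrow> dist (y x') (y x) < e"
    using e unfolding uniformly_continuous_on_def by metis
  obtain m :: nat where m: "t / d < real m" using reals_Archimedean2 by blast
  show "\<exists>no. \<forall>n\<ge>no. norm (euler B y0 w (t / real n) n - y t) < r"
  proof (intro exI[of _ "Suc m"] allI impI)
    fix n assume n: "Suc m \<le> n"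
    define h where "h = t / real n"
    have n0: "0 < real n" and h0: "0 \<le> h" and nh: "real n * h = t" using n t by (auto simp: h_def)
    have "t / d < real n" using m n by linarith
    then have hd: "h < d" using d(1) n0 by (simp add: h_def field_simps)
    \<comment> \<open>The discrete Gronwall inequality, in the closed form that is preserved by a step.\<close>
    have bound: "norm (y (real k * h) - euler B y0 w h k) \<le> e * ((1 + L * h) ^ k - 1)" if "k \<le> n" for k
      using that
    proof (induction k)
      case 0
      then show ?case using eq[of 0] by simp
    next
      case (Suc k)
      let ?a = "real k * h" and ?b = "real (Suc k) * h" and ?e = "euler B y0 w h k"
      have le: "?a \<le> ?b" "0 \<le> ?a" using h0 by (auto simp: distrib_right)
      have "?b \<le> real n * h" using Suc.prems h0 by (intro mult_right_mono) auto
      then have bt: "?b \<le> t" using nh by simp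
      have near: "norm (B (y u) - B (y ?a)) \<le> L * e" if "u \<in> {?a..?b}" for u
      proof -
        have "dist u ?a < d" using that hd by (auto simp: dist_real_def distrib_right)
        then have "norm (y u - y ?a) < e" using d(2)[of ?a u] that le bt by (auto simp: dist_norm)
        then show ?thesis using Lip[of "y u" "y ?a"] L0 by (meson less_imp_le mult_left_mono order_trans)
      qed
      have "norm (integral {?a..?b} (\<lambda>u. B (y u)) - (?b - ?a) *\<^sub>R B (y ?a)) \<le> L * e * (?b - ?a)"
        by (rule norm_integral_minus_const_le[OF le(1) _ near]) (use le contB in \<open>auto elim: continuous_on_subset\<close>)
      then have I: "norm (integral {?a..?b} (\<lambda>u. B (y u)) - h *\<^sub>R B (y ?a)) \<le> L * e * h"
        by (simp add: distrib_right)
      have "y ?b - euler B y0 w h (Suc k) =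
        (y ?a - ?e) + (integral {?a..?b} (\<lambda>u. B (y u)) - h *\<^sub>R B (y ?a)) + h *\<^sub>R (B (y ?a) - B ?e)"
        using integral_equation_increment[OF eq contB le(2,1)] by (simp add: algebra_simps)
      also have "norm \<dots> \<le> norm (y ?a - ?e) + L * e * h + h * (L * norm (y ?a - ?e))"
        using I h0 Lip by (intro norm_triangle_mono order_refl) (auto intro: mult_left_mono)
      also have "\<dots> = (1 + L * h) * norm (y ?a - ?e) + L * e * h" by (simp add: algebra_simps)
      also have "\<dots> \<le> (1 + L * h) * (e * ((1 + L * h) ^ k - 1)) + L * e * h"
        using Suc L0 h0 by (intro add_right_mono mult_left_mono) auto
      also have "\<dots> = e * ((1 + L * h) ^ Suc k - 1)" by (simp add: algebra_simps)
      finally show ?case .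
    qed
    have "norm (euler B y0 w h n - y t) \<le> e * ((1 + L * h) ^ n - 1)"
      using bound[of n] nh by (simp add: norm_minus_commute)
    also have "\<dots> \<le> e * (1 + L * h) ^ n" using e by simp
    also have "(1 + L * h) ^ n \<le> exp (L * h) ^ n" using L0 h0 by (intro power_mono) auto
    also have "exp (L * h) ^ n = exp (L * t)" using nh by (simp add: exp_of_nat_mult[symmetric] mult.left_commute)
    also have "e * exp (L * t) = r / 2" by (simp add: e_def)
    finally show "norm (euler B y0 w (t / real n) n - y t) < r" using r e unfolding h_def by simp
  qed
qed

section \<open>The past of a Wiener process\<close>

text \<open>Generated by the process itself, without adding null sets; solutions are therefore adapted only up to
modification.\<close>

definition past :: "'w measure \<Rightarrow> (real \<Rightarrow> 'w \<Rightarrow> 'b::topological_space) \<Rightarrow> real \<Rightarrow> 'w measure" where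
  "past P W t = sigma (space P) (process_events P {0..t} W)"

lemma process_events_subset_Pow: "process_events P I W \<subseteq> Pow (space P)"
  unfolding process_events_def
proof (intro subsetI PowI)
  fix A x assume "A \<in> sigma_sets (space P) {W t -` A \<inter> space P |t A. t \<in> I \<and> A \<in> sets borel}" "x \<in> A"
  then show "x \<in> space P" by (rule set_mp[OF sigma_sets_into_sp, rotated]) auto
qed

lemma space_past [simp]: "space (past P W t) = space P"
  by (simp add: past_def space_measure_of process_events_subset_Pow)

lemma sets_past: "sets (past P W t) = process_events P {0..t} W"
  unfolding past_def
  by (simp add: sets_measure_of process_events_subset_Pow) (unfold process_events_def, rule sigma_sets_sigma_sets_eq, blast)

lemma process_events_mono: "I \<subseteq> J \<Longrightarrow> process_events P I W \<subseteq> process_events P J W"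
  unfolding process_events_def by (rule sigma_sets_subseteq) blast

lemma process_events_subset_sets:
  assumes "\<And>t. t \<in> I \<Longrightarrow> W t \<in> borel_measurable P"
  shows "process_events P I W \<subseteq> sets P"
  unfolding process_events_def by (rule sets.sigma_sets_subset) (use assms in \<open>auto intro: measurable_sets\<close>)

lemma measurable_past:
  fixes W :: "real \<Rightarrow> 'w \<Rightarrow> 'b::topological_space"
  assumes "0 \<le> s" "s \<le> t"
  shows "W s \<in> borel_measurable (past P W t)"
proof (rule measurableI)
  fix A :: "'b set" assume "A \<in> sets borel"
  then show "W s -` A \<inter> space (past P W t) \<in> sets (past P W t)"
    unfolding sets_past space_past process_events_def using assms by (intro sigma_sets.Basic) auto
qed auto

lemma wiener_gaussian_innovations:
  fixes W :: "real \<Rightarrow> 'w \<Rightarrow> real^'r"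
  assumes P: "prob_space P" and W: "wiener_process P W" and h: "0 < h"
  shows "gaussian_innovations P (\<lambda>k. past P W (real k * h))
     (\<lambda>k \<omega>. (1 / sqrt h) *\<^sub>R (W (real (Suc k) * h) \<omega> - W (real k * h) \<omega>))"
proof -
  interpret prob_space P by (rule P)
  have Wm: "0 \<le> t \<Longrightarrow> W t \<in> borel_measurable P" for t using W by (simp add: wiener_process_def)
  show ?thesis
  proof
    fix k :: nat
    have lt: "0 \<le> real k * h" "real k * h < real (Suc k) * h" "0 \<le> real (Suc k) * h"
      using h by (auto simp: distrib_right)
    let ?D = "\<lambda>\<omega>. W (real (Suc k) * h) \<omega> - W (real k * h) \<omega>"
    have D[measurable]: "?D \<in> borel_measurable P"
      using Wm[OF lt(1)] Wm[OF lt(3)] by measurable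
    have law: "is_normal_law 0 (mat (real (Suc k) * h - real k * h)) (distr P borel ?D)"
      and ind: "indep_set (process_events P {0..real k * h} W) {?D -` A \<inter> space P |A. A \<in> sets borel}"
      using W lt unfolding wiener_process_def by blast+
    have hh: "real (Suc k) * h - real k * h = h" by (simp add: distrib_right)
    show "standard_gaussian (\<lambda>\<omega>. (1 / sqrt h) *\<^sub>R ?D \<omega>)"
      by (rule normal_law_standardize[OF P D h]) (use law in \<open>simp only: hh\<close>)
    show "sets (past P W (real k * h)) \<subseteq> events"
      unfolding sets_past by (rule process_events_subset_sets) (auto intro: Wm)
    show "(\<lambda>\<omega>. (1 / sqrt h) *\<^sub>R ?D \<omega>) \<in> borel_measurable (past P W (real (Suc k) * h))"
      using lt by (intro borel_measurable_scaleR borel_measurable_const borel_measurable_diff measurable_past) auto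
    show "indep_set (sets (past P W (real k * h)))
        {(\<lambda>\<omega>. (1 / sqrt h) *\<^sub>R ?D \<omega>) -` A \<inter> space P |A. A \<in> sets borel}"
      unfolding sets_past
    proof (rule indep_set_mono[OF ind order_refl], rule subsetI)
      fix S assume "S \<in> {(\<lambda>\<omega>. (1 / sqrt h) *\<^sub>R ?D \<omega>) -` A \<inter> space P |A. A \<in> sets borel}"
      then obtain A where A: "A \<in> sets borel" "S = (\<lambda>\<omega>. (1 / sqrt h) *\<^sub>R ?D \<omega>) -` A \<inter> space P" by blast
      have "(\<lambda>x::real^'r. (1 / sqrt h) *\<^sub>R x) \<in> borel_measurable borel" by measurable
      from measurable_sets[OF this A(1)]
      have "(\<lambda>x::real^'r. (1 / sqrt h) *\<^sub>R x) -` A \<in> sets borel" by simp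
      moreover have "S = ?D -` ((\<lambda>x. (1 / sqrt h) *\<^sub>R x) -` A) \<inter> space P" unfolding A(2) by auto
      ultimately show "S \<in> {?D -` A \<inter> space P |A. A \<in> sets borel}" by blast
    qed
  next
    fix j k :: nat assume "j \<le> k"
    then show "sets (past P W (real j * h)) \<subseteq> sets (past P W (real k * h))"
      unfolding sets_past using h by (intro process_events_mono) (auto intro: order_trans mult_right_mono)
  qed simp
qed

lemma lipschitz_borel_measurable:
  fixes B :: "'a::euclidean_space \<Rightarrow> 'b::euclidean_space"
  shows "L-lipschitz_on UNIV B \<Longrightarrow> B \<in> borel_measurable borel"
  by (rule borel_measurable_continuous_onI[OF lipschitz_on_continuous_on])

lemma matrix_vector_measurable [measurable (raw)]:
  fixes f :: "'w \<Rightarrow> real^'i" and C :: "real^'i^'j"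
  assumes "f \<in> borel_measurable N"
  shows "(\<lambda>\<omega>. C *v f \<omega>) \<in> borel_measurable N"
  by (rule borel_measurable_continuous_on[OF linear_continuous_on assms]) auto

lemma vec_nth_measurable [measurable (raw)]:
  fixes f :: "'w \<Rightarrow> real^'i"
  assumes "f \<in> borel_measurable N"
  shows "(\<lambda>\<omega>. f \<omega> $ a) \<in> borel_measurable N"
  by (rule borel_measurable_continuous_on[OF _ assms]) (intro continuous_intros)

text \<open>The solution at time \<open>t\<close> is almost surely the limit of Euler approximations, each of which is a
continuous function of finitely many values of \<open>W\<close> up to time \<open>t\<close>.\<close>

lemma sde_solution_adapted:
  fixes W :: "real \<Rightarrow> 'w \<Rightarrow> real^'r" and Y :: "real \<Rightarrow> 'w \<Rightarrow> real^'k"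
  assumes Y: "solves_sde P B S y0 W Y" and L: "L-lipschitz_on UNIV B" and t: "0 \<le> t"
  shows "\<exists>Y'. Y' \<in> borel_measurable (past P W t) \<and> (AE \<omega> in P. Y t \<omega> = Y' \<omega>)"
proof (intro exI conjI)
  note [measurable] = lipschitz_borel_measurable[OF L]
  have e: "(\<lambda>\<omega>. euler B y0 (\<lambda>s. S *v W s \<omega>) h k) \<in> borel_measurable (past P W t)"
    if h: "0 \<le> h" "real k * h \<le> t" for h k
    using h(2)
  proof (induction k)
    case 0
    have [measurable]: "W 0 \<in> borel_measurable (past P W t)" using t by (intro measurable_past) auto
    have "(\<lambda>\<omega>. S *v W 0 \<omega>) \<in> borel_measurable (past P W t)"
      by (rule borel_measurable_continuous_on[OF linear_continuous_on]) auto
    then show ?case by simp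
  next
    case (Suc k)
    have le: "real k * h \<le> t" using Suc.prems h(1) by (simp add: distrib_right)
    note [measurable] = Suc.IH[OF le]
    have [measurable]: "W (real k * h) \<in> borel_measurable (past P W t)"
        "W (real (Suc k) * h) \<in> borel_measurable (past P W t)"
      using le Suc.prems h(1) by (auto intro!: measurable_past)
    have [measurable]: "(\<lambda>\<omega>. S *v W s \<omega>) \<in> borel_measurable (past P W t)"
      if "W s \<in> borel_measurable (past P W t)" for s
      by (rule borel_measurable_continuous_on[OF linear_continuous_on that]) auto
    show ?case by (simp del: of_nat_Suc)
  qed
  show "(\<lambda>\<omega>. lim (\<lambda>n. euler B y0 (\<lambda>s. S *v W s \<omega>) (t / real n) n)) \<in> borel_measurable (past P W t)"
  proof (rule borel_measurable_lim_metric)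
    fix n show "(\<lambda>\<omega>. euler B y0 (\<lambda>s. S *v W s \<omega>) (t / real n) n) \<in> borel_measurable (past P W t)"
      by (rule e) (use t in auto)
  qed
  have "AE \<omega> in P. continuous_on {0..} (\<lambda>t. Y t \<omega>) \<and>
        (\<forall>t\<ge>0. Y t \<omega> = y0 + integral {0..t} (\<lambda>s. B (Y s \<omega>)) + S *v W t \<omega>)"
    using Y by (simp add: solves_sde_def)
  then show "AE \<omega> in P. Y t \<omega> = lim (\<lambda>n. euler B y0 (\<lambda>s. S *v W s \<omega>) (t / real n) n)"
  proof eventually_elim
    case (elim \<omega>)
    then have "(\<lambda>n. euler B y0 (\<lambda>s. S *v W s \<omega>) (t / real n) n) \<longlonglongrightarrow> Y t \<omega>"
      by (intro euler_converges[where y="\<lambda>t. Y t \<omega>", OF _ L _ t]) auto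
    then show ?case by (rule limI[symmetric])
  qed
qed

section \<open>Increments of a linearly observed diffusion\<close>

lemma integrable_of_nn_integral_le:
  fixes f :: "'w \<Rightarrow> real"
  assumes [measurable]: "f \<in> borel_measurable M" and f: "\<And>\<omega>. 0 \<le> f \<omega>"
    and c: "(\<integral>\<^sup>+\<omega>. ennreal (f \<omega>) \<partial>M) \<le> ennreal c" "0 \<le> c"
  shows "integrable M f" "(\<integral>\<omega>. f \<omega> \<partial>M) \<le> c"
proof -
  show i: "integrable M f"
  proof (rule integrableI_nonneg)
    show "(\<integral>\<^sup>+\<omega>. ennreal (f \<omega>) \<partial>M) < \<infinity>" using c(1) by (rule le_less_trans) simp
  qed (use f in auto)
  show "(\<integral>\<omega>. f \<omega> \<partial>M) \<le> c"
    using c nn_integral_eq_integral[OF i] f by simp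
qed

lemma norm_matrix_vector_le: "norm ((C :: real^'i^'j) *v x) \<le> onorm ((*v) C) * norm x"
  by (rule onorm) simp

lemma norm_matrix_le_sum_abs: "norm (M :: real^'i^'j) \<le> (\<Sum>a\<in>UNIV. \<Sum>b\<in>UNIV. \<bar>M $ a $ b\<bar>)"
proof -
  have "norm M \<le> (\<Sum>a\<in>UNIV. norm (M $ a))" unfolding norm_vec_def by (rule L2_set_le_sum) simp
  also have "\<dots> \<le> (\<Sum>a\<in>UNIV. \<Sum>b\<in>UNIV. \<bar>M $ a $ b\<bar>)" by (intro sum_mono norm_le_l1_cart)
  finally show ?thesis .
qed

lemma nn_integral_norm_add_sq_le:
  fixes a b :: "'w \<Rightarrow> 'c::{real_normed_vector, second_countable_topology}"
  assumes "a \<in> borel_measurable P" "b \<in> borel_measurable P"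
  shows "mean_square P (\<lambda>\<omega>. a \<omega> + b \<omega>) \<le>
     2 * mean_square P a + 2 * mean_square P b"
proof -
  have pw: "(norm (x + y))\<^sup>2 \<le> 2 * (norm x)\<^sup>2 + 2 * (norm y)\<^sup>2" for x y :: 'c
  proof -
    have "(norm (x + y))\<^sup>2 \<le> (norm x + norm y)\<^sup>2" by (rule power_mono[OF norm_triangle_ineq]) simp
    also have "\<dots> \<le> 2 * (norm x)\<^sup>2 + 2 * (norm y)\<^sup>2"
      using sum_squares_bound[of "norm x" "norm y"] by (simp add: power2_sum)
    finally show ?thesis .
  qed
  have e2: "(2::ennreal) = ennreal 2" by simp
  have "mean_square P (\<lambda>\<omega>. a \<omega> + b \<omega>) \<le>
      (\<integral>\<^sup>+\<omega>. 2 * ennreal ((norm (a \<omega>))\<^sup>2) + 2 * ennreal ((norm (b \<omega>))\<^sup>2) \<partial>P)"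
    unfolding e2 using pw
    by (intro nn_integral_mono) (simp add: ennreal_mult[symmetric] ennreal_plus[symmetric] del: ennreal_plus ennreal_numeral)
  also have "\<dots> = 2 * mean_square P a + 2 * mean_square P b"
    using assms by (subst nn_integral_add) (auto simp: nn_integral_cmult)
  finally show ?thesis .
qed

lemma nn_integral_norm_matrix_sq_le:
  assumes "f \<in> borel_measurable P"
  shows "mean_square P (\<lambda>\<omega>. (C :: real^'i^'j) *v f \<omega>) \<le>
     ennreal ((onorm ((*v) C))\<^sup>2) * mean_square P f"
proof -
  have "(norm (C *v x))\<^sup>2 \<le> (onorm ((*v) C))\<^sup>2 * (norm x)\<^sup>2" for x
    using power_mono[OF norm_matrix_vector_le[of C x], of 2] by (simp add: power_mult_distrib)
  then have "mean_square P (\<lambda>\<omega>. C *v f \<omega>) \<le>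
      (\<integral>\<^sup>+\<omega>. ennreal ((onorm ((*v) C))\<^sup>2) * ennreal ((norm (f \<omega>))\<^sup>2) \<partial>P)"
    by (intro nn_integral_mono) (simp add: ennreal_mult[symmetric])
  then show ?thesis using assms by (simp add: nn_integral_cmult)
qed

text \<open>The observed process is a linear image of a diffusion with constant diffusion coefficient.
The bound \<open>K\<close> is uniform in time, so that the estimates below hold with the same constants for every
step.\<close>

locale linear_sde_observation = prob_space P for P :: "'w measure" +
  fixes W :: "real \<Rightarrow> 'w \<Rightarrow> real^'r" and Y :: "real \<Rightarrow> 'w \<Rightarrow> real^'k" and B S y0
    and A :: "real^'k^'p" and X :: "real \<Rightarrow> 'w \<Rightarrow> real^'p" and L K :: real
  assumes wiener: "wiener_process P W"
    and sde: "solves_sde P B S y0 W Y"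
    and lip: "L-lipschitz_on UNIV B"
    and moment: "\<And>t. 0 \<le> t \<Longrightarrow> mean_square P (Y t) \<le> ennreal K"
    and K_nonneg: "0 \<le> K"
    and X_eq: "\<And>t \<omega>. 0 \<le> t \<Longrightarrow> \<omega> \<in> space P \<Longrightarrow> X t \<omega> = A *v Y t \<omega>"
begin

definition G :: "real^'r^'p" where "G = A ** S"

definition innov :: "real \<Rightarrow> nat \<Rightarrow> 'w \<Rightarrow> real^'r" where
  "innov h k \<omega> = (1 / sqrt h) *\<^sub>R (W (real (Suc k) * h) \<omega> - W (real k * h) \<omega>)"

text \<open>What the increment of \<open>X\<close> contains beyond its Gaussian part: almost surely the image under \<open>A\<close> of
the integral of the drift over the step. Defined as a difference it is measurable and the decomposition
holds everywhere.\<close>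

definition drift_part :: "real \<Rightarrow> nat \<Rightarrow> 'w \<Rightarrow> real^'p" where
  "drift_part h k \<omega> = X (real (Suc k) * h) \<omega> - X (real k * h) \<omega> - sqrt h *\<^sub>R (G *v innov h k \<omega>)"

lemma innovations: "0 < h \<Longrightarrow> gaussian_innovations P (\<lambda>k. past P W (real k * h)) (innov h)"
  using wiener_gaussian_innovations[OF prob_space_axioms wiener] unfolding innov_def[abs_def] by simp

lemma Y_measurable: "0 \<le> t \<Longrightarrow> Y t \<in> borel_measurable P"
  using sde by (simp add: solves_sde_def)

lemma W_measurable: "0 \<le> t \<Longrightarrow> W t \<in> borel_measurable P"
  using wiener by (simp add: wiener_process_def)

lemma X_measurable:
  assumes t: "0 \<le> t"
  shows "X t \<in> borel_measurable P"
proof -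
  have [measurable]: "Y t \<in> borel_measurable P" by (rule Y_measurable[OF t])
  have "(\<lambda>\<omega>. A *v Y t \<omega>) \<in> borel_measurable P" by measurable
  then show ?thesis using X_eq[OF t] by (simp cong: measurable_cong)
qed

lemma innov_measurable: "0 < h \<Longrightarrow> innov h k \<in> borel_measurable P"
  by (rule gaussian_innovations.g_measurable[OF innovations])

lemma drift_part_measurable:
  assumes "0 < h"
  shows "drift_part h k \<in> borel_measurable P"
proof -
  have [measurable]: "X (real (Suc k) * h) \<in> borel_measurable P" "X (real k * h) \<in> borel_measurable P"
      "innov h k \<in> borel_measurable P"
    using assms by (auto intro!: X_measurable innov_measurable simp del: of_nat_Suc)
  show ?thesis unfolding drift_part_def by measurable
qed

lemma B_measurable: "B \<in> borel_measurable borel"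
  by (rule lipschitz_borel_measurable[OF lip])

lemma drift_second_moment:
  "\<exists>C\<ge>0. \<forall>t\<ge>0. mean_square P (\<lambda>\<omega>. B (Y t \<omega>)) \<le> ennreal C"
proof (intro exI conjI allI impI)
  note [measurable] = B_measurable
  show "0 \<le> 2 * (norm (B 0))\<^sup>2 + 2 * L\<^sup>2 * K" using K_nonneg by simp
  fix t :: real assume t: "0 \<le> t"
  have [measurable]: "Y t \<in> borel_measurable P" by (rule Y_measurable[OF t])
  have pw: "(norm (B y))\<^sup>2 \<le> 2 * (norm (B 0))\<^sup>2 + 2 * L\<^sup>2 * (norm y)\<^sup>2" for y
  proof -
    have "norm (B y) \<le> norm (B 0) + L * norm y"
      using lipschitz_onD[OF lip, of y 0] norm_triangle_sub[of "B y" "B 0"] by (simp add: dist_norm)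
    then have "(norm (B y))\<^sup>2 \<le> (norm (B 0) + L * norm y)\<^sup>2" by (rule power_mono) simp
    also have "\<dots> \<le> 2 * (norm (B 0))\<^sup>2 + 2 * (L * norm y)\<^sup>2"
      using sum_squares_bound[of "norm (B 0)" "L * norm y"] by (simp add: power2_sum)
    finally show ?thesis by (simp add: power_mult_distrib)
  qed
  have "mean_square P (\<lambda>\<omega>. B (Y t \<omega>)) \<le>
      (\<integral>\<^sup>+\<omega>. ennreal (2 * (norm (B 0))\<^sup>2) + ennreal (2 * L\<^sup>2) * ennreal ((norm (Y t \<omega>))\<^sup>2) \<partial>P)"
    using pw by (intro nn_integral_mono) (simp add: ennreal_mult[symmetric] ennreal_plus[symmetric] del: ennreal_plus)
  also have "\<dots> = ennreal (2 * (norm (B 0))\<^sup>2) + ennreal (2 * L\<^sup>2) * mean_square P (Y t)"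
    by (subst nn_integral_add) (auto simp: nn_integral_cmult emeasure_space_1)
  also have "\<dots> \<le> ennreal (2 * (norm (B 0))\<^sup>2) + ennreal (2 * L\<^sup>2) * ennreal K"
    by (intro add_left_mono mult_left_mono moment t) simp
  also have "\<dots> = ennreal (2 * (norm (B 0))\<^sup>2 + 2 * L\<^sup>2 * K)"
    using K_nonneg by (simp add: ennreal_mult[symmetric] ennreal_plus[symmetric] del: ennreal_plus)
  finally show "mean_square P (\<lambda>\<omega>. B (Y t \<omega>)) \<le> ennreal (2 * (norm (B 0))\<^sup>2 + 2 * L\<^sup>2 * K)" .
qed

lemma path_continuous: "AE \<omega> in P. continuous_on {0..} (\<lambda>v. B (Y v \<omega>))"
proof -
  have "AE \<omega> in P. continuous_on {0..} (\<lambda>t. Y t \<omega>)" using sde by (auto simp: solves_sde_def)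
  then show ?thesis
    by eventually_elim (rule continuous_on_compose2[OF lipschitz_on_continuous_on[OF lip]], auto)
qed

lemma Y_increment:
  "AE \<omega> in P. \<forall>s u. 0 \<le> s \<and> s \<le> u \<longrightarrow>
     Y u \<omega> - Y s \<omega> = integral {s..u} (\<lambda>v. B (Y v \<omega>)) + S *v (W u \<omega> - W s \<omega>)"
proof -
  have "AE \<omega> in P. \<forall>t\<ge>0. Y t \<omega> = y0 + integral {0..t} (\<lambda>s. B (Y s \<omega>)) + S *v W t \<omega>"
    using sde by (auto simp: solves_sde_def)
  with path_continuous show ?thesis
  proof eventually_elim
    case (elim \<omega>)
    show ?case
      using integral_equation_increment[of "\<lambda>t. Y t \<omega>" y0 "\<lambda>v. B (Y v \<omega>)" "\<lambda>t. S *v W t \<omega>"] elim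
      by (auto simp: matrix_vector_mult_diff_distrib)
  qed
qed

lemma drift_integral_second_moment:
  "\<exists>C\<ge>0. \<forall>s u. 0 \<le> s \<and> s \<le> u \<longrightarrow>
    mean_square P (\<lambda>\<omega>. integral {s..u} (\<lambda>v. B (Y v \<omega>))) \<le> ennreal (C * (u - s)\<^sup>2)"
proof -
  obtain C where C: "0 \<le> C" "\<And>t. 0 \<le> t \<Longrightarrow> mean_square P (\<lambda>\<omega>. B (Y t \<omega>)) \<le> ennreal C"
    using drift_second_moment by blast
  note [measurable] = B_measurable
  show ?thesis
  proof (intro exI[of _ C] conjI allI impI C(1))
    fix s u :: real assume su: "0 \<le> s \<and> s \<le> u"
    have [measurable]: "v \<in> {s..u} \<Longrightarrow> Y v \<in> borel_measurable P" for v using su by (intro Y_measurable) auto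
    show "mean_square P (\<lambda>\<omega>. integral {s..u} (\<lambda>v. B (Y v \<omega>))) \<le> ennreal (C * (u - s)\<^sup>2)"
    proof (rule nn_integral_norm_integral_sq_le)
      show "AE \<omega> in P. continuous_on {s..u} (\<lambda>v. B (Y v \<omega>))"
        using path_continuous by eventually_elim (erule continuous_on_subset, use su in auto)
    qed (use su C in \<open>auto\<close>)
  qed
qed

lemma W_increment_second_moment:
  "\<exists>C\<ge>0. \<forall>s u. 0 \<le> s \<and> s \<le> u \<longrightarrow>
    mean_square P (\<lambda>\<omega>. W u \<omega> - W s \<omega>) \<le> ennreal (C * (u - s))"
proof -
  obtain C where C: "\<And>g :: 'w \<Rightarrow> real^'r. standard_gaussian g \<Longrightarrow>
     integrable P (\<lambda>\<omega>. norm (g \<omega>) ^ (2 * 1)) \<and> expectation (\<lambda>\<omega>. norm (g \<omega>) ^ (2 * 1)) \<le> C"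
    using standard_gaussian_norm_moment[of 1, where 'b="real^'r"] by blast
  define C' where "C' = max 0 C"
  have C': "0 \<le> C'" "C \<le> C'" by (auto simp: C'_def)
  show ?thesis
  proof (intro exI[of _ C'] conjI allI impI C'(1))
    fix s u :: real assume su: "0 \<le> s \<and> s \<le> u"
    show "mean_square P (\<lambda>\<omega>. W u \<omega> - W s \<omega>) \<le> ennreal (C' * (u - s))"
    proof (cases "s = u")
      case False
      have [measurable]: "W u \<in> borel_measurable P" "W s \<in> borel_measurable P" using su by (auto intro: W_measurable)
      define g where "g \<omega> = (1 / sqrt (u - s)) *\<^sub>R (W u \<omega> - W s \<omega>)" for \<omega>
      have lt: "s < u" using su False by simp
      have law: "is_normal_law 0 (mat (u - s)) (distr P borel (\<lambda>\<omega>. W u \<omega> - W s \<omega>))"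
        using wiener lt su unfolding wiener_process_def by blast
      have g: "standard_gaussian g" unfolding g_def[abs_def]
        by (rule normal_law_standardize[OF prob_space_axioms _ _ law]) (use lt in auto)
      have "(norm (W u \<omega> - W s \<omega>))\<^sup>2 = (u - s) * norm (g \<omega>) ^ (2 * 1)" for \<omega>
        using lt by (simp add: g_def power_divide)
      then have "mean_square P (\<lambda>\<omega>. W u \<omega> - W s \<omega>) = ennreal (u - s) * (\<integral>\<^sup>+\<omega>. ennreal (norm (g \<omega>) ^ (2 * 1)) \<partial>P)"
        using lt standard_gaussian_measurable[OF g] by (subst nn_integral_cmult[symmetric]) (auto simp: ennreal_mult)
      also have "\<dots> = ennreal (u - s) * ennreal (expectation (\<lambda>\<omega>. norm (g \<omega>) ^ (2 * 1)))"
        by (subst nn_integral_eq_integral) (use C[OF g] in auto)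
      also have "\<dots> \<le> ennreal (u - s) * ennreal C'"
        using C[OF g] C' by (intro mult_left_mono ennreal_leI) auto
      finally show ?thesis using lt C' by (simp add: ennreal_mult[symmetric] mult.commute)
    qed simp
  qed
qed

text \<open>The noise dominates: it contributes \<open>u - s\<close>, while the drift contributes \<open>(u - s)\<^sup>2\<close>, which is smaller
on intervals of length at most one.\<close>

lemma Y_increment_second_moment:
  "\<exists>C\<ge>0. \<forall>s u. 0 \<le> s \<and> s \<le> u \<and> u \<le> s + 1 \<longrightarrow>
    mean_square P (\<lambda>\<omega>. Y u \<omega> - Y s \<omega>) \<le> ennreal (C * (u - s))"
proof -
  obtain C1 where C1: "0 \<le> C1" "\<And>s u. 0 \<le> s \<and> s \<le> u \<Longrightarrow>
    mean_square P (\<lambda>\<omega>. integral {s..u} (\<lambda>v. B (Y v \<omega>))) \<le> ennreal (C1 * (u - s)\<^sup>2)"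
    using drift_integral_second_moment by blast
  obtain C2 where C2: "0 \<le> C2" "\<And>s u. 0 \<le> s \<and> s \<le> u \<Longrightarrow>
    mean_square P (\<lambda>\<omega>. W u \<omega> - W s \<omega>) \<le> ennreal (C2 * (u - s))"
    using W_increment_second_moment by blast
  let ?o = "(onorm ((*v) S))\<^sup>2"
  show ?thesis
  proof (intro exI[of _ "2 * C1 + 2 * (?o * C2)"] conjI allI impI)
    show "0 \<le> 2 * C1 + 2 * (?o * C2)" using C1(1) C2(1) by simp
    fix s u :: real assume su: "0 \<le> s \<and> s \<le> u \<and> u \<le> s + 1"
    then have su': "0 \<le> s \<and> s \<le> u" by simp
    have [measurable]: "W u \<in> borel_measurable P" "W s \<in> borel_measurable P"
        "Y u \<in> borel_measurable P" "Y s \<in> borel_measurable P"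
      using su by (auto intro: W_measurable Y_measurable)
    let ?dW = "\<lambda>\<omega>. W u \<omega> - W s \<omega>"
    let ?J = "\<lambda>\<omega>. Y u \<omega> - Y s \<omega> - S *v ?dW \<omega>"
    have "mean_square P (\<lambda>\<omega>. ?J \<omega>) =
        mean_square P (\<lambda>\<omega>. integral {s..u} (\<lambda>v. B (Y v \<omega>)))"
      by (rule nn_integral_cong_AE) (use Y_increment su' in \<open>auto elim!: eventually_mono\<close>)
    also have "\<dots> \<le> ennreal (C1 * (u - s)\<^sup>2)" by (rule C1(2)[OF su'])
    also have "\<dots> \<le> ennreal (C1 * (u - s))"
    proof (rule ennreal_leI, rule mult_left_mono[OF _ C1(1)])
      have "(u - s) * (u - s) \<le> (u - s) * 1" using su by (intro mult_left_mono) auto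
      then show "(u - s)\<^sup>2 \<le> u - s" by (simp add: power2_eq_square)
    qed
    finally have J: "mean_square P (\<lambda>\<omega>. ?J \<omega>) \<le> ennreal (C1 * (u - s))" .
    have "mean_square P (\<lambda>\<omega>. S *v ?dW \<omega>) \<le> ennreal ?o * mean_square P (\<lambda>\<omega>. ?dW \<omega>)"
      by (rule nn_integral_norm_matrix_sq_le) measurable
    also have "\<dots> \<le> ennreal ?o * ennreal (C2 * (u - s))" by (intro mult_left_mono C2(2) su') simp
    also have "\<dots> = ennreal (?o * C2 * (u - s))" using C2(1) su by (simp add: ennreal_mult[symmetric] mult.assoc)
    finally have N: "mean_square P (\<lambda>\<omega>. S *v ?dW \<omega>) \<le> ennreal (?o * C2 * (u - s))" .
    have "mean_square P (\<lambda>\<omega>. ?J \<omega> + S *v ?dW \<omega>) \<le>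
       2 * mean_square P (\<lambda>\<omega>. ?J \<omega>) + 2 * mean_square P (\<lambda>\<omega>. S *v ?dW \<omega>)"
      by (rule nn_integral_norm_add_sq_le) measurable
    also have "\<dots> \<le> ennreal 2 * ennreal (C1 * (u - s)) + ennreal 2 * ennreal (?o * C2 * (u - s))"
      using J N by (intro add_mono mult_mono) auto
    also have "\<dots> = ennreal ((2 * C1 + 2 * (?o * C2)) * (u - s))"
      using C1(1) C2(1) su
      by (simp add: ennreal_mult[symmetric] ennreal_plus[symmetric] distrib_right mult.assoc del: ennreal_plus ennreal_numeral)
    finally show "mean_square P (\<lambda>\<omega>. Y u \<omega> - Y s \<omega>) \<le> ennreal ((2 * C1 + 2 * (?o * C2)) * (u - s))"
      by simp
  qed
qed

text \<open>During the step the drift moves away from its initial value by at most \<open>L\<close> times the increment of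
\<open>Y\<close>, whose mean square is of order \<open>h\<close>; integrating over the step gives the further factor \<open>h\<^sup>2\<close>.\<close>

lemma drift_freezing_error:
  "\<exists>C\<ge>0. \<forall>s h. 0 \<le> s \<and> 0 < h \<and> h \<le> 1 \<longrightarrow>
    mean_square P (\<lambda>\<omega>. integral {s..s + h} (\<lambda>v. B (Y v \<omega>)) - h *\<^sub>R B (Y s \<omega>)) \<le> ennreal (C * h ^ 3)"
proof -
  obtain C where C: "0 \<le> C" "\<And>s u. 0 \<le> s \<and> s \<le> u \<and> u \<le> s + 1 \<Longrightarrow>
    mean_square P (\<lambda>\<omega>. Y u \<omega> - Y s \<omega>) \<le> ennreal (C * (u - s))"
    using Y_increment_second_moment by blast
  note [measurable] = B_measurable
  show ?thesis
  proof (intro exI[of _ "L\<^sup>2 * C"] conjI allI impI)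
    show "0 \<le> L\<^sup>2 * C" using C(1) by simp
    fix s h :: real assume sh: "0 \<le> s \<and> 0 < h \<and> h \<le> 1"
    have Ym[measurable]: "v \<in> {s..s + h} \<Longrightarrow> Y v \<in> borel_measurable P" for v using sh by (intro Y_measurable) auto
    have [measurable]: "Y s \<in> borel_measurable P" using sh by (intro Ym) auto
    have cont: "AE \<omega> in P. continuous_on {s..s + h} (\<lambda>v. B (Y v \<omega>))"
      using path_continuous by eventually_elim (erule continuous_on_subset, use sh in auto)
    have "mean_square P (\<lambda>\<omega>. integral {s..s + h} (\<lambda>v. B (Y v \<omega>)) - h *\<^sub>R B (Y s \<omega>)) =
        mean_square P (\<lambda>\<omega>. integral {s..s + h} (\<lambda>v. B (Y v \<omega>) - B (Y s \<omega>)))"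
    proof (rule nn_integral_cong_AE)
      from cont show "AE \<omega> in P. ennreal ((norm (integral {s..s + h} (\<lambda>v. B (Y v \<omega>)) - h *\<^sub>R B (Y s \<omega>)))\<^sup>2) =
          ennreal ((norm (integral {s..s + h} (\<lambda>v. B (Y v \<omega>) - B (Y s \<omega>))))\<^sup>2)"
        by eventually_elim (subst Henstock_Kurzweil_Integration.integral_diff,
            use sh in \<open>auto intro: integrable_continuous_real\<close>)
    qed
    also have "\<dots> \<le> ennreal (L\<^sup>2 * C * h * (s + h - s)\<^sup>2)"
    proof (rule nn_integral_norm_integral_sq_le)
      show "AE \<omega> in P. continuous_on {s..s + h} (\<lambda>v. B (Y v \<omega>) - B (Y s \<omega>))"
        using cont by eventually_elim (intro continuous_intros)
      fix v assume v: "v \<in> {s..s + h}"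
      have "(norm (B y - B z))\<^sup>2 \<le> L\<^sup>2 * (norm (y - z))\<^sup>2" for y z
        using power_mono[OF lipschitz_onD[OF lip, of y z], of 2] by (simp add: dist_norm power_mult_distrib)
      then have "mean_square P (\<lambda>\<omega>. B (Y v \<omega>) - B (Y s \<omega>)) \<le>
          (\<integral>\<^sup>+\<omega>. ennreal (L\<^sup>2) * ennreal ((norm (Y v \<omega> - Y s \<omega>))\<^sup>2) \<partial>P)"
        by (intro nn_integral_mono) (simp add: ennreal_mult[symmetric])
      also have "\<dots> = ennreal (L\<^sup>2) * mean_square P (\<lambda>\<omega>. Y v \<omega> - Y s \<omega>)"
      proof -
        have [measurable]: "Y v \<in> borel_measurable P" by (rule Ym[OF v])
        show ?thesis by (rule nn_integral_cmult) measurable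
      qed
      also have "\<dots> \<le> ennreal (L\<^sup>2) * ennreal (C * h)"
        using v sh C(1) by (intro mult_left_mono order_trans[OF C(2)] ennreal_leI) auto
      also have "\<dots> = ennreal (L\<^sup>2 * C * h)" using C(1) sh by (simp add: ennreal_mult[symmetric] mult.assoc)
      finally show "mean_square P (\<lambda>\<omega>. B (Y v \<omega>) - B (Y s \<omega>)) \<le> ennreal (L\<^sup>2 * C * h)" .
    qed (use sh C(1) in auto)
    also have "L\<^sup>2 * C * h * (s + h - s)\<^sup>2 = L\<^sup>2 * C * h ^ 3" by (simp add: power2_eq_square power3_eq_cube)
    finally show "mean_square P (\<lambda>\<omega>. integral {s..s + h} (\<lambda>v. B (Y v \<omega>)) - h *\<^sub>R B (Y s \<omega>)) \<le> ennreal (L\<^sup>2 * C * h ^ 3)" .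
  qed
qed

lemma drift_part_eq:
  assumes h: "0 < h" and \<omega>: "\<omega> \<in> space P"
  shows "drift_part h k \<omega> = A *v (Y (real (Suc k) * h) \<omega> - Y (real k * h) \<omega> -
    S *v (W (real (Suc k) * h) \<omega> - W (real k * h) \<omega>))"
proof -
  have "sqrt h *\<^sub>R (G *v innov h k \<omega>) = A *v (S *v (W (real (Suc k) * h) \<omega> - W (real k * h) \<omega>))"
    using h by (simp add: innov_def G_def matrix_vector_mult_scaleR matrix_vector_mul_assoc del: of_nat_Suc)
  then show ?thesis
    using assms by (simp add: drift_part_def X_eq matrix_vector_mult_diff_distrib del: of_nat_Suc)
qed

text \<open>\<open>\<beta>\<close> is a version of the drift of the component \<open>a\<close> at the beginning of step \<open>k\<close> that is
determined by the past, and \<open>C\<close> collects all constants.\<close>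

definition frozen_drift :: "real \<Rightarrow> real \<Rightarrow> nat \<Rightarrow> 'p \<Rightarrow> ('w \<Rightarrow> real) \<Rightarrow> bool" where
  "frozen_drift C h k a \<beta> \<longleftrightarrow> \<beta> \<in> borel_measurable (past P W (real k * h)) \<and>
     integrable P (\<lambda>\<omega>. (\<beta> \<omega>)\<^sup>2) \<and> expectation (\<lambda>\<omega>. (\<beta> \<omega>)\<^sup>2) \<le> C \<and>
     integrable P (\<lambda>\<omega>. (drift_part h k \<omega> $ a - h * \<beta> \<omega>)\<^sup>2) \<and>
     expectation (\<lambda>\<omega>. (drift_part h k \<omega> $ a - h * \<beta> \<omega>)\<^sup>2) \<le> C * h ^ 3"

text \<open>The frozen drift is evaluated at the adapted version of \<open>Y\<close> at the beginning of the step. Being almost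
surely equal to \<open>Y\<close> there, this version inherits all moment bounds.\<close>

lemma drift_part_moments:
  "\<exists>C\<ge>0. \<forall>h k a. 0 < h \<and> h \<le> 1 \<longrightarrow>
     integrable P (\<lambda>\<omega>. (drift_part h k \<omega> $ a)\<^sup>2) \<and>
     expectation (\<lambda>\<omega>. (drift_part h k \<omega> $ a)\<^sup>2) \<le> C * h\<^sup>2 \<and> (\<exists>\<beta>. frozen_drift C h k a \<beta>)"
proof -
  note [measurable] = B_measurable
  obtain C1 where C1: "0 \<le> C1" "\<And>s u. 0 \<le> s \<and> s \<le> u \<Longrightarrow>
    mean_square P (\<lambda>\<omega>. integral {s..u} (\<lambda>v. B (Y v \<omega>))) \<le> ennreal (C1 * (u - s)\<^sup>2)"
    using drift_integral_second_moment by blast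
  obtain C2 where C2: "0 \<le> C2" "\<And>s h. 0 \<le> s \<and> 0 < h \<and> h \<le> 1 \<Longrightarrow>
    mean_square P (\<lambda>\<omega>. integral {s..s + h} (\<lambda>v. B (Y v \<omega>)) - h *\<^sub>R B (Y s \<omega>)) \<le> ennreal (C2 * h ^ 3)"
    using drift_freezing_error by blast
  obtain C3 where C3: "0 \<le> C3" "\<And>t. 0 \<le> t \<Longrightarrow> mean_square P (\<lambda>\<omega>. B (Y t \<omega>)) \<le> ennreal C3"
    using drift_second_moment by blast
  let ?o = "(onorm ((*v) A))\<^sup>2"
  define C where "C = ?o * (C1 + C2 + C3)"
  have C0: "0 \<le> C" using C1(1) C2(1) C3(1) by (simp add: C_def)
  have oC: "?o * C1 \<le> C" "?o * C2 \<le> C" "?o * C3 \<le> C"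
    using C1(1) C2(1) C3(1) unfolding C_def by (auto intro!: mult_left_mono)
  have comp: "integrable P (\<lambda>\<omega>. ((A *v f \<omega>) $ a)\<^sup>2) \<and> expectation (\<lambda>\<omega>. ((A *v f \<omega>) $ a)\<^sup>2) \<le> C * z"
    if f[measurable]: "f \<in> borel_measurable P" and le: "mean_square P f \<le> ennreal (c * z)"
      and c: "0 \<le> c" "?o * c \<le> C" "0 \<le> z" for f c z a
  proof -
    have "((A *v x) $ a)\<^sup>2 \<le> (norm (A *v x))\<^sup>2" for x
      using power_mono[OF component_le_norm_cart[of "A *v x" a], of 2] by simp
    then have "(\<integral>\<^sup>+\<omega>. ennreal (((A *v f \<omega>) $ a)\<^sup>2) \<partial>P) \<le> mean_square P (\<lambda>\<omega>. A *v f \<omega>)"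
      by (intro nn_integral_mono ennreal_leI)
    also have "\<dots> \<le> ennreal ?o * mean_square P f"
      by (rule nn_integral_norm_matrix_sq_le[OF f])
    also have "\<dots> \<le> ennreal ?o * ennreal (c * z)" by (intro mult_left_mono le) simp
    also have "\<dots> \<le> ennreal (C * z)"
      using c mult_right_mono[OF c(2,3)] by (simp add: ennreal_mult[symmetric] mult.assoc ennreal_leI)
    finally have le: "(\<integral>\<^sup>+\<omega>. ennreal (((A *v f \<omega>) $ a)\<^sup>2) \<partial>P) \<le> ennreal (C * z)" .
    have m: "(\<lambda>\<omega>. ((A *v f \<omega>) $ a)\<^sup>2) \<in> borel_measurable P" by measurable
    have z: "0 \<le> C * z" using C0 c by simp
    show ?thesis
      by (rule conjI[OF integrable_of_nn_integral_le[OF m zero_le_power2 le z]])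
  qed
  show ?thesis
  proof (intro exI[of _ C] conjI allI impI C0)
    fix h k a assume h: "0 < h \<and> h \<le> (1::real)"
    define s u where "s = real k * h" and "u = real (Suc k) * h"
    have su: "0 \<le> s" "s \<le> u" "0 \<le> u" "u = s + h" "u - s = h" using h by (auto simp: s_def u_def distrib_right)
    have [measurable]: "W u \<in> borel_measurable P" "W s \<in> borel_measurable P"
        "Y u \<in> borel_measurable P" "Y s \<in> borel_measurable P"
      using su by (auto intro: W_measurable Y_measurable simp del: su(4))
    define J where "J \<omega> = Y u \<omega> - Y s \<omega> - S *v (W u \<omega> - W s \<omega>)" for \<omega>
    have [measurable]: "J \<in> borel_measurable P" unfolding J_def by measurable
    have D: "drift_part h k \<omega> = A *v J \<omega>" if "\<omega> \<in> space P" for \<omega>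
      using drift_part_eq[OF _ that, of h k] h unfolding J_def s_def u_def by simp
    have JI: "AE \<omega> in P. J \<omega> = integral {s..s + h} (\<lambda>v. B (Y v \<omega>))"
      using Y_increment by eventually_elim (use su in \<open>auto simp: J_def\<close>)
    have "mean_square P J = mean_square P (\<lambda>\<omega>. integral {s..s + h} (\<lambda>v. B (Y v \<omega>)))"
      using JI by (intro nn_integral_cong_AE) auto
    also have "\<dots> \<le> ennreal (C1 * h\<^sup>2)" using C1(2)[of s "s + h"] su h by simp
    finally have J: "mean_square P J \<le> ennreal (C1 * h\<^sup>2)" .
    have cong: "integrable P (\<lambda>\<omega>. (drift_part h k \<omega> $ a)\<^sup>2) \<longleftrightarrow> integrable P (\<lambda>\<omega>. ((A *v J \<omega>) $ a)\<^sup>2)"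
        "expectation (\<lambda>\<omega>. (drift_part h k \<omega> $ a)\<^sup>2) = expectation (\<lambda>\<omega>. ((A *v J \<omega>) $ a)\<^sup>2)"
      by (auto intro!: Bochner_Integration.integrable_cong Bochner_Integration.integral_cong simp: D)
    show "integrable P (\<lambda>\<omega>. (drift_part h k \<omega> $ a)\<^sup>2)" "expectation (\<lambda>\<omega>. (drift_part h k \<omega> $ a)\<^sup>2) \<le> C * h\<^sup>2"
      unfolding cong using comp[OF _ J C1(1) oC(1), of a] by auto
    obtain Y' where Y': "Y' \<in> borel_measurable (past P W s)" "AE \<omega> in P. Y s \<omega> = Y' \<omega>"
      using sde_solution_adapted[OF sde lip su(1)] by blast
    have subalg: "sets (past P W s) \<subseteq> sets P" unfolding sets_past
      by (rule process_events_subset_sets) (auto intro: W_measurable)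
    have Y'P[measurable]: "Y' \<in> borel_measurable P"
      using Y'(1) subalg by (auto simp: measurable_def)
    define \<beta> where "\<beta> \<omega> = (A *v B (Y' \<omega>)) $ a" for \<omega>
    have b1: "mean_square P (\<lambda>\<omega>. B (Y' \<omega>)) \<le> ennreal (C3 * 1)"
    proof -
      have "mean_square P (\<lambda>\<omega>. B (Y' \<omega>)) = mean_square P (\<lambda>\<omega>. B (Y s \<omega>))"
        using Y'(2) by (intro nn_integral_cong_AE) auto
      then show ?thesis using C3(2)[OF su(1)] by simp
    qed
    have b2: "mean_square P (\<lambda>\<omega>. J \<omega> - h *\<^sub>R B (Y' \<omega>)) \<le> ennreal (C2 * h ^ 3)"
    proof -
      have "mean_square P (\<lambda>\<omega>. J \<omega> - h *\<^sub>R B (Y' \<omega>)) =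
          mean_square P (\<lambda>\<omega>. integral {s..s + h} (\<lambda>v. B (Y v \<omega>)) - h *\<^sub>R B (Y s \<omega>))"
        by (rule nn_integral_cong_AE) (use Y'(2) JI in eventually_elim, simp)
      then show ?thesis using C2(2)[of s h] su h by simp
    qed
    have r: "(drift_part h k \<omega> $ a - h * \<beta> \<omega>)\<^sup>2 = ((A *v (J \<omega> - h *\<^sub>R B (Y' \<omega>))) $ a)\<^sup>2" if "\<omega> \<in> space P" for \<omega>
      by (simp add: D[OF that] \<beta>_def matrix_vector_mult_diff_distrib matrix_vector_mult_scaleR)
    have rcong: "integrable P (\<lambda>\<omega>. (drift_part h k \<omega> $ a - h * \<beta> \<omega>)\<^sup>2) \<longleftrightarrow>
          integrable P (\<lambda>\<omega>. ((A *v (J \<omega> - h *\<^sub>R B (Y' \<omega>))) $ a)\<^sup>2)"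
        "expectation (\<lambda>\<omega>. (drift_part h k \<omega> $ a - h * \<beta> \<omega>)\<^sup>2) =
          expectation (\<lambda>\<omega>. ((A *v (J \<omega> - h *\<^sub>R B (Y' \<omega>))) $ a)\<^sup>2)"
      by (auto intro!: Bochner_Integration.integrable_cong Bochner_Integration.integral_cong simp: r)
    have m\<beta>: "\<beta> \<in> borel_measurable (past P W s)" unfolding \<beta>_def using Y'(1) by measurable
    have i\<beta>: "integrable P (\<lambda>\<omega>. (\<beta> \<omega>)\<^sup>2) \<and> expectation (\<lambda>\<omega>. (\<beta> \<omega>)\<^sup>2) \<le> C"
      using comp[OF _ b1 C3(1) oC(3), of a] unfolding \<beta>_def by simp
    have "integrable P (\<lambda>\<omega>. ((A *v (J \<omega> - h *\<^sub>R B (Y' \<omega>))) $ a)\<^sup>2) \<and>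
        expectation (\<lambda>\<omega>. ((A *v (J \<omega> - h *\<^sub>R B (Y' \<omega>))) $ a)\<^sup>2) \<le> C * h ^ 3"
      by (rule comp[OF _ b2 C2(1) oC(2)]) (use h in auto)
    then have "frozen_drift C h k a \<beta>"
      using m\<beta> i\<beta> unfolding frozen_drift_def s_def[symmetric] rcong by (intro conjI) (erule conjE, assumption)+
    then show "\<exists>\<beta>. frozen_drift C h k a \<beta>" by blast
  qed
qed

end

section \<open>The asymptotic covariance matrix\<close>

text \<open>Uniqueness of the pseudo-inverse: the projections \<open>A X\<close> and \<open>X A\<close> are the same for both
candidates, since symmetric projections with the same range coincide.\<close>

lemma moore_penrose_eqI:
  fixes A :: "real^'n^'m" and X :: "real^'m^'n"
  assumes X: "A ** X ** A = A" "X ** A ** X = X" "transpose (A ** X) = A ** X" "transpose (X ** A) = X ** A"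
  shows "moore_penrose A = X"
  unfolding moore_penrose_def
proof (rule the_equality)
  show "A ** X ** A = A \<and> X ** A ** X = X \<and> transpose (A ** X) = A ** X \<and> transpose (X ** A) = X ** A"
    using X by blast
  fix Y :: "real^'m^'n"
  assume "A ** Y ** A = A \<and> Y ** A ** Y = Y \<and> transpose (A ** Y) = A ** Y \<and> transpose (Y ** A) = Y ** A"
  then have Y: "A ** Y ** A = A" "Y ** A ** Y = Y" "transpose (A ** Y) = A ** Y" "transpose (Y ** A) = Y ** A" by auto
  have "A ** Y = transpose ((A ** X ** A) ** Y)" using X(1) Y(3) by simp
  also have "\<dots> = transpose ((A ** X) ** (A ** Y))" by (simp add: matrix_mul_assoc)
  also have "\<dots> = (A ** Y) ** (A ** X)" by (simp only: matrix_transpose_mul[of "A ** X" "A ** Y"] X(3) Y(3))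
  also have "\<dots> = (A ** Y ** A) ** X" by (simp add: matrix_mul_assoc)
  finally have AY: "A ** Y = A ** X" using Y(1) by simp
  have "Y ** A = transpose (Y ** (A ** X ** A))" using X(1) Y(4) by simp
  also have "\<dots> = transpose ((Y ** A) ** (X ** A))" by (simp add: matrix_mul_assoc)
  also have "\<dots> = (X ** A) ** (Y ** A)" by (simp only: matrix_transpose_mul[of "Y ** A" "X ** A"] X(4) Y(4))
  also have "\<dots> = X ** (A ** Y ** A)" by (simp add: matrix_mul_assoc)
  finally have YA: "Y ** A = X ** A" using Y(1) by simp
  have "Y = X ** A ** Y" using Y(2) YA by simp
  also have "\<dots> = X ** (A ** X)" by (simp add: matrix_mul_assoc[symmetric] AY)
  finally show "Y = X" using X(2) by (simp add: matrix_mul_assoc)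
qed

text \<open>The Moore--Penrose inverse of the duplication matrix: it reads off the lower triangle after averaging
the entries at mirrored positions. At a diagonal position both indicators refer to the same entry,
whose weight is then one.\<close>

definition lower_part :: "real^('n \<times> 'n)^(('n::{finite,linorder}) tri)" where
  "lower_part = (\<chi> v ji. (of_bool (ji = Rep_tri v) + of_bool (ji = prod.swap (Rep_tri v))) / 2)"

lemma sum_lower_part:
  fixes f :: "'n::{finite,linorder} \<times> 'n \<Rightarrow> real"
  shows "(\<Sum>ji\<in>UNIV. lower_part $ v $ ji * f ji) = (f (Rep_tri v) + f (prod.swap (Rep_tri v))) / 2"
proof -
  have "(\<Sum>ji\<in>UNIV. lower_part $ v $ ji * f ji) =
      (\<Sum>ji\<in>UNIV. (of_bool (ji = Rep_tri v) * f ji + of_bool (ji = prod.swap (Rep_tri v)) * f ji) / 2)"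
    by (simp add: lower_part_def distrib_right)
  also have "\<dots> = ((\<Sum>ji\<in>UNIV. of_bool (ji = Rep_tri v) * f ji) + (\<Sum>ji\<in>UNIV. of_bool (ji = prod.swap (Rep_tri v)) * f ji)) / 2"
    by (simp add: sum.distrib flip: sum_divide_distrib)
  also have "\<dots> = (f (Rep_tri v) + f (prod.swap (Rep_tri v))) / 2"
    by (simp add: of_bool_def if_distrib[of "\<lambda>x. x * _"] cong: if_cong)
  finally show ?thesis .
qed

lemma Rep_tri_le: "fst (Rep_tri v) \<le> snd (Rep_tri v)"
  using Rep_tri[of v] by (auto simp: case_prod_beta)

lemma lower_part_duplication: "lower_part ** (duplication :: real^(('n::{finite,linorder}) tri)^('n \<times> 'n)) = mat 1"
proof (simp add: vec_eq_iff, intro allI)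
  fix v w :: "'n tri"
  have D: "(duplication :: real^('n tri)^('n \<times> 'n)) $ Rep_tri v $ w = of_bool (v = w)"
    "(duplication :: real^('n tri)^('n \<times> 'n)) $ prod.swap (Rep_tri v) $ w = of_bool (v = w)"
    using Rep_tri_le[of v] Rep_tri_inject[of w v]
    by (auto simp: duplication_def min_absorb1 max_absorb2 min_absorb2 max_absorb1)
  have "(lower_part ** (duplication :: real^('n tri)^('n \<times> 'n))) $ v $ w =
      (\<Sum>ji\<in>UNIV. lower_part $ v $ ji * (duplication :: real^('n tri)^('n \<times> 'n)) $ ji $ w)"
    by (simp add: matrix_matrix_mult_def)
  also have "\<dots> = of_bool (v = w)" unfolding sum_lower_part D by simp
  finally show "(lower_part ** (duplication :: real^('n tri)^('n \<times> 'n))) $ v $ w = mat 1 $ v $ w"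
    by (simp add: mat_def)
qed

text \<open>Duplicating the averaged lower triangle symmetrizes a matrix, which is an orthogonal projection.\<close>

lemma duplication_lower_part:
  "((duplication :: real^(('n::{finite,linorder}) tri)^('n \<times> 'n)) ** lower_part) $ ji $ kl =
    (of_bool (kl = ji) + of_bool (kl = prod.swap ji)) / 2"
proof -
  let ?v = "Abs_tri (min (fst ji) (snd ji), max (fst ji) (snd ji)) :: 'n tri"
  have rep: "Rep_tri ?v = (min (fst ji) (snd ji), max (fst ji) (snd ji))"
    by (rule Abs_tri_inverse) (auto simp: min_def max_def)
  have eq: "Rep_tri w = (min (fst ji) (snd ji), max (fst ji) (snd ji)) \<longleftrightarrow> w = ?v" for w :: "'n tri"
    using rep by (metis Rep_tri_inverse)
  have "((duplication :: real^('n tri)^('n \<times> 'n)) ** lower_part) $ ji $ kl = (\<Sum>w\<in>UNIV. of_bool (w = ?v) * lower_part $ w $ kl)"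
    by (simp add: matrix_matrix_mult_def duplication_def eq)
  also have "\<dots> = lower_part $ ?v $ kl"
    by (simp add: of_bool_def if_distrib[of "\<lambda>x. x * _"] cong: if_cong)
  also have "\<dots> = (of_bool (kl = ji) + of_bool (kl = prod.swap ji)) / 2"
  proof -
    have "Rep_tri ?v = ji \<or> Rep_tri ?v = prod.swap ji" unfolding rep by (cases ji) (auto simp: min_def max_def)
    then show ?thesis by (elim disjE) (simp_all add: lower_part_def)
  qed
  finally show ?thesis .
qed

lemma moore_penrose_duplication:
  "moore_penrose (duplication :: real^(('n::{finite,linorder}) tri)^('n \<times> 'n)) = lower_part"
proof (rule moore_penrose_eqI)
  let ?D = "duplication :: real^('n tri)^('n \<times> 'n)"
  show "?D ** lower_part ** ?D = ?D" by (simp add: matrix_mul_assoc[symmetric] lower_part_duplication)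
  show "lower_part ** ?D ** lower_part = lower_part" by (simp add: lower_part_duplication)
  show "transpose (lower_part ** ?D) = lower_part ** ?D" by (simp add: lower_part_duplication)
  have "(kl = prod.swap ji) = (ji = prod.swap kl)" for ji kl :: "'n \<times> 'n" by auto
  then show "transpose (?D ** lower_part) = ?D ** lower_part"
    by (simp add: vec_eq_iff duplication_lower_part transpose_def eq_commute)
qed

lemma asym_cov_entry:
  fixes \<Sigma> :: "real^('p::{finite,linorder})^('p::{finite,linorder})"
  shows "asym_cov \<Sigma> $ v $ w =
    \<Sigma> $ fst (Rep_tri v) $ fst (Rep_tri w) * \<Sigma> $ snd (Rep_tri v) $ snd (Rep_tri w) +
    \<Sigma> $ fst (Rep_tri v) $ snd (Rep_tri w) * \<Sigma> $ snd (Rep_tri v) $ fst (Rep_tri w)"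
proof -
  let ?E = "lower_part :: real^('p \<times> 'p)^('p tri)" and ?K = "kronecker \<Sigma> \<Sigma>"
  have "(?E ** ?K ** transpose ?E) $ v $ w = (\<Sum>kl\<in>UNIV. ?E $ w $ kl * (\<Sum>ji\<in>UNIV. ?E $ v $ ji * ?K $ ji $ kl))"
    by (simp add: matrix_matrix_mult_def transpose_def mult.commute)
  then show ?thesis
    unfolding sum_lower_part asym_cov_def moore_penrose_duplication
    by (simp add: kronecker_def algebra_simps)
qed

lemma kronecker_gram:
  fixes G :: "real^'r^'p" and H :: "real^'s^'q"
  shows "kronecker (G ** transpose G) (H ** transpose H) = kronecker G H ** transpose (kronecker G H)"
proof (simp add: vec_eq_iff, intro allI)
  fix a b c d
  have "(kronecker G H ** transpose (kronecker G H)) $ (a, b) $ (c, d) =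
      (\<Sum>rs\<in>UNIV \<times> UNIV. (G $ a $ fst rs * G $ c $ fst rs) * (H $ b $ snd rs * H $ d $ snd rs))"
    by (simp add: matrix_matrix_mult_def transpose_def kronecker_def mult_ac)
  also have "\<dots> = (\<Sum>r\<in>UNIV. G $ a $ r * G $ c $ r) * (\<Sum>s\<in>UNIV. H $ b $ s * H $ d $ s)"
    by (simp only: sum_product sum.cartesian_product case_prod_beta')
  also have "\<dots> = kronecker (G ** transpose G) (H ** transpose H) $ (a, b) $ (c, d)"
    by (simp add: matrix_matrix_mult_def transpose_def kronecker_def)
  finally show "kronecker (G ** transpose G) (H ** transpose H) $ (a, b) $ (c, d) =
      (kronecker G H ** transpose (kronecker G H)) $ (a, b) $ (c, d)" by simp
qed

lemma gram_scaleR: "(c *\<^sub>R M) ** transpose (c *\<^sub>R M) = (c * c) *\<^sub>R (M ** transpose (M :: real^'i^'j))"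
  by (simp add: vec_eq_iff matrix_matrix_mult_def transpose_def sum_distrib_left mult_ac)

text \<open>For \<open>\<Sigma> = G G\<^sup>T\<close> the asymptotic covariance has the form \<open>A A\<^sup>T\<close>, because the Kronecker product of
Gram matrices is a Gram matrix.\<close>

lemma asym_cov_normal_law:
  fixes G :: "real^'r^('p::{finite,linorder})"
  shows "\<exists>N. is_normal_law 0 (asym_cov (G ** transpose G)) N"
proof -
  define E where "E = (lower_part :: real^('p \<times> 'p)^('p tri))"
  let ?A = "sqrt 2 *\<^sub>R (E ** kronecker G G)"
  have "?A ** transpose ?A = 2 *\<^sub>R (E ** (kronecker G G ** transpose (kronecker G G)) ** transpose E)"
    by (simp add: gram_scaleR matrix_transpose_mul matrix_mul_assoc)
  also have "\<dots> = asym_cov (G ** transpose G)"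
    by (simp add: asym_cov_def moore_penrose_duplication kronecker_gram E_def)
  finally show ?thesis using normal_law_exists[of ?A] by simp
qed

section \<open>Limit theorems for the realized covariance\<close>

context linear_sde_observation begin

definition \<Sigma>X :: "real^'p^'p" where "\<Sigma>X = G ** transpose G"

lemma \<Sigma>X_entry: "\<Sigma>X $ a $ b = G $ a \<bullet> G $ b"
  by (simp add: \<Sigma>X_def matrix_matrix_mult_def transpose_def inner_vec_def)

text \<open>The main term: the centred empirical covariance of the Gaussian parts, multiplied by \<open>\<surd>n\<close>.\<close>

definition fluct :: "real \<Rightarrow> nat \<Rightarrow> 'w \<Rightarrow> real^'p^'p" where
  "fluct h n \<omega> = (1 / sqrt (real n)) *\<^sub>R
     (\<Sum>k<n. outer (G *v innov h k \<omega>) (G *v innov h k \<omega>) - \<Sigma>X)"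

definition remainder :: "real \<Rightarrow> nat \<Rightarrow> 'w \<Rightarrow> real^'p^'p" where
  "remainder h n \<omega> = realized_cov X h n \<omega> - \<Sigma>X - (1 / sqrt (real n)) *\<^sub>R fluct h n \<omega>"

lemma fluct_entry: "fluct h n \<omega> $ a $ b = (1 / sqrt (real n)) *
    (\<Sum>k<n. (G $ a \<bullet> innov h k \<omega>) * (G $ b \<bullet> innov h k \<omega>) - G $ a \<bullet> G $ b)"
  by (simp add: fluct_def outer_def \<Sigma>X_entry matrix_vector_mul_component)

lemma remainder_entry:
  assumes h: "0 < h" and n: "0 < n"
  shows "remainder h n \<omega> $ a $ b =
    1 / (real n * h) * (\<Sum>k<n. drift_part h k \<omega> $ a * drift_part h k \<omega> $ b) +
    1 / (real n * sqrt h) * ((\<Sum>k<n. drift_part h k \<omega> $ a * (G $ b \<bullet> innov h k \<omega>)) +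
      (\<Sum>k<n. drift_part h k \<omega> $ b * (G $ a \<bullet> innov h k \<omega>)))"
proof -
  define d where "d k a = drift_part h k \<omega> $ a" for k a
  define z where "z k a = G $ a \<bullet> innov h k \<omega>" for k a
  have X: "X (real (Suc k) * h) \<omega> $ a - X (real k * h) \<omega> $ a = d k a + sqrt h * z k a" for k a
    by (simp add: d_def z_def drift_part_def matrix_vector_mul_component del: of_nat_Suc)
  have sn: "sqrt (real n) * sqrt (real n) = real n" by simp
  have hs: "h = sqrt h * sqrt h" using h by simp
  have "realized_cov X h n \<omega> $ a $ b = 1 / (real n * h) *
      (\<Sum>k<n. (X (real (Suc k) * h) \<omega> $ a - X (real k * h) \<omega> $ a) * (X (real (Suc k) * h) \<omega> $ b - X (real k * h) \<omega> $ b))"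
  proof -
    have shift: "(\<Sum>i=1..n. f i) = (\<Sum>k<n. f (Suc k))" for f :: "nat \<Rightarrow> real^'p^'p"
      by (simp add: sum.atLeast1_atMost_eq)
    show ?thesis unfolding realized_cov_def shift diff_Suc_1 by (simp add: outer_def del: of_nat_Suc)
  qed
  also have "\<dots> = 1 / (real n * h) * ((\<Sum>k<n. d k a * d k b) + sqrt h * ((\<Sum>k<n. d k a * z k b) + (\<Sum>k<n. d k b * z k a)) +
      h * (\<Sum>k<n. z k a * z k b))"
  proof -
    have "(d k a + sqrt h * z k a) * (d k b + sqrt h * z k b) =
        d k a * d k b + sqrt h * (d k a * z k b) + sqrt h * (d k b * z k a) + h * (z k a * z k b)" for k
      using h by (simp add: algebra_simps)
    then show ?thesis unfolding X by (simp only: sum.distrib sum_distrib_left[symmetric] distrib_left add.assoc)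
  qed
  also have "\<dots> = 1 / (real n * h) * (\<Sum>k<n. d k a * d k b) +
      sqrt h / (real n * h) * ((\<Sum>k<n. d k a * z k b) + (\<Sum>k<n. d k b * z k a)) + 1 / real n * (\<Sum>k<n. z k a * z k b)"
    using h by (simp add: distrib_left)
  also have "sqrt h / (real n * h) = 1 / (real n * sqrt h)"
    using h n by (simp add: field_simps)
  finally have Q: "realized_cov X h n \<omega> $ a $ b = 1 / (real n * h) * (\<Sum>k<n. d k a * d k b) +
      1 / (real n * sqrt h) * ((\<Sum>k<n. d k a * z k b) + (\<Sum>k<n. d k b * z k a)) + 1 / real n * (\<Sum>k<n. z k a * z k b)" .
  have "((1 / sqrt (real n)) *\<^sub>R fluct h n \<omega>) $ a $ b = 1 / real n * (\<Sum>k<n. z k a * z k b) - G $ a \<bullet> G $ b"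
    using n by (simp add: fluct_entry z_def sum_subtractf right_diff_distrib sn diff_divide_distrib)
  then show ?thesis
    unfolding remainder_def by (simp add: Q \<Sigma>X_entry d_def z_def)
qed

text \<open>The rate decides the theorem: it tends to zero with \<open>h\<close>, and its product with \<open>\<surd>n\<close> tends to zero
if moreover \<open>n h\<^sup>2\<close> does.\<close>

lemma remainder_bound:
  "\<exists>C\<ge>0. \<forall>h n a b. 0 < h \<and> h \<le> 1 \<and> 0 < n \<longrightarrow>
     mean_abs_le (\<lambda>\<omega>. remainder h n \<omega> $ a $ b) (C * (h + sqrt (h / real n)))"
proof -
  obtain C where C: "0 \<le> C"
    and all: "\<And>h k a. 0 < h \<and> h \<le> 1 \<Longrightarrow> integrable P (\<lambda>\<omega>. (drift_part h k \<omega> $ a)\<^sup>2) \<and>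
      expectation (\<lambda>\<omega>. (drift_part h k \<omega> $ a)\<^sup>2) \<le> C * h\<^sup>2 \<and> (\<exists>\<beta>. frozen_drift C h k a \<beta>)"
    using drift_part_moments by blast
  note D2 = all[THEN conjunct1] all[THEN conjunct2, THEN conjunct1]
  note \<beta> = all[THEN conjunct2, THEN conjunct2]
  \<comment> \<open>The rows of \<open>G\<close> have norm at most \<open>norm G\<close>, so one constant serves all entries.\<close>
  define M where "M = (C + (norm G)\<^sup>2) / 2 + (C * (norm G)\<^sup>2 + 1) / 2"
  have M: "0 \<le> M" using C by (simp add: M_def)
  show ?thesis
  proof (rule exI[of _ "C + 2 * M"], rule conjI, use C M in simp, intro allI impI)
    fix h :: real and n :: nat and a b assume hn: "0 < h \<and> h \<le> 1 \<and> 0 < n"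
    then have h: "0 < h" "h \<le> 1" and n: "0 < n" by auto
    have h1: "0 < h \<and> h \<le> 1" using h by simp
    interpret I: gaussian_innovations P "\<lambda>k. past P W (real k * h)" "innov h" by (rule innovations[OF h(1)])
    have Dm[measurable]: "drift_part h k \<in> borel_measurable P" for k by (rule drift_part_measurable[OF h(1)])
    define e where "e = h + sqrt (h / real n)"
    have e: "h \<le> e" "sqrt (h / real n) \<le> e" using h by (auto simp: e_def)
    have cross: "mean_abs_le (\<lambda>\<omega>. \<Sum>k<n. drift_part h k \<omega> $ a * (G $ b \<bullet> innov h k \<omega>)) (real n * sqrt h * (M * e))" for a b
    proof -
      obtain \<beta> where "\<And>k. frozen_drift C h k a (\<beta> k)" using \<beta>[OF h1, of _ a] by metis
      then have b: "\<And>k. \<beta> k \<in> borel_measurable (past P W (real k * h))"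
        "\<And>k. integrable P (\<lambda>\<omega>. (\<beta> k \<omega>)\<^sup>2)" "\<And>k. expectation (\<lambda>\<omega>. (\<beta> k \<omega>)\<^sup>2) \<le> C"
        "\<And>k. integrable P (\<lambda>\<omega>. (drift_part h k \<omega> $ a - h * \<beta> k \<omega>)\<^sup>2)"
        "\<And>k. expectation (\<lambda>\<omega>. (drift_part h k \<omega> $ a - h * \<beta> k \<omega>)\<^sup>2) \<le> C * h ^ 3"
        unfolding frozen_drift_def by auto
      have dm: "(\<lambda>\<omega>. drift_part h k \<omega> $ a) \<in> borel_measurable P" for k by measurable
      have v: "G $ b \<bullet> G $ b \<le> (norm G)\<^sup>2"
        using power_mono[OF Finite_Cartesian_Product.norm_nth_le[where x=G and i=b], of 2] by (simp add: dot_square_norm)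
      have "(C + G $ b \<bullet> G $ b) / 2 * h + (C * (G $ b \<bullet> G $ b) + 1) / 2 * sqrt (h / real n) \<le>
         (C + (norm G)\<^sup>2) / 2 * e + (C * (norm G)\<^sup>2 + 1) / 2 * e"
        using v C e h by (intro add_mono mult_mono divide_right_mono mult_left_mono) auto
      also have "\<dots> = M * e" by (simp add: M_def distrib_right)
      finally have "real n * sqrt h * ((C + G $ b \<bullet> G $ b) / 2 * h + (C * (G $ b \<bullet> G $ b) + 1) / 2 * sqrt (h / real n)) \<le>
          real n * sqrt h * (M * e)"
        using h by (intro mult_left_mono) auto
      then show ?thesis
        by (rule mean_abs_le_mono[OF I.innovation_cross_sum_bound[of "\<lambda>k \<omega>. drift_part h k \<omega> $ a", OF dm b h(1) n]])
    qed
    have "mean_abs_le (\<lambda>\<omega>. drift_part h k \<omega> $ a * drift_part h k \<omega> $ b) ((C * h\<^sup>2 / 1 + 1 * (C * h\<^sup>2)) / 2)" for k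
      by (rule mean_abs_le_mult) (use D2[OF h1] in auto)
    then have square: "mean_abs_le (\<lambda>\<omega>. \<Sum>k<n. drift_part h k \<omega> $ a * drift_part h k \<omega> $ b)
        (\<Sum>k<n. (C * h\<^sup>2 / 1 + 1 * (C * h\<^sup>2)) / 2)"
      by (rule mean_abs_le_sum)
    show "mean_abs_le (\<lambda>\<omega>. remainder h n \<omega> $ a $ b) ((C + 2 * M) * (h + sqrt (h / real n)))"
    proof (rule mean_abs_le_mono)
      show "mean_abs_le (\<lambda>\<omega>. remainder h n \<omega> $ a $ b)
          (\<bar>1 / (real n * h)\<bar> * (\<Sum>k<n. (C * h\<^sup>2 / 1 + 1 * (C * h\<^sup>2)) / 2) +
           \<bar>1 / (real n * sqrt h)\<bar> * (real n * sqrt h * (M * e) + real n * sqrt h * (M * e)))"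
        unfolding remainder_entry[OF h(1) n] by (intro mean_abs_le_add mean_abs_le_cmult square cross)
      have "\<bar>1 / (real n * h)\<bar> * (\<Sum>k<n. (C * h\<^sup>2 / 1 + 1 * (C * h\<^sup>2)) / 2) = C * h"
        using h n by (simp add: power2_eq_square)
      moreover have "\<bar>1 / (real n * sqrt h)\<bar> * (real n * sqrt h * (M * e) + real n * sqrt h * (M * e)) = 2 * M * e"
        using h n by (simp add: field_simps)
      moreover have "C * h \<le> C * e" by (rule mult_left_mono[OF e(1) C])
      ultimately show "\<bar>1 / (real n * h)\<bar> * (\<Sum>k<n. (C * h\<^sup>2 / 1 + 1 * (C * h\<^sup>2)) / 2) +
           \<bar>1 / (real n * sqrt h)\<bar> * (real n * sqrt h * (M * e) + real n * sqrt h * (M * e)) \<le> (C + 2 * M) * (h + sqrt (h / real n))"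
        by (simp add: e_def[symmetric] distrib_right)
    qed
  qed
qed

lemma fluct_bound:
  "\<exists>C\<ge>0. \<forall>h n a b. 0 < h \<and> 0 < n \<longrightarrow> mean_abs_le (\<lambda>\<omega>. fluct h n \<omega> $ a $ b) C"
proof (intro exI conjI allI impI)
  let ?N = "(norm G)\<^sup>2"
  show "0 \<le> (2 * (?N * ?N) + 1) / 2" by simp
  fix h :: real and n :: nat and a b assume hn: "0 < h \<and> 0 < n"
  then have h: "0 < h" and n: "0 < n" by auto
  interpret I: gaussian_innovations P "\<lambda>k. past P W (real k * h)" "innov h" by (rule innovations[OF h])
  define s where "s = (G $ a \<bullet> G $ a) * (G $ b \<bullet> G $ b) + (G $ a \<bullet> G $ b) * (G $ b \<bullet> G $ a)"
  define \<phi> where "\<phi> = centered_product (G $ a) (G $ b)"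
  have [measurable]: "\<phi> \<in> borel_measurable borel" unfolding \<phi>_def by measurable
  have N: "G $ c \<bullet> G $ c \<le> ?N" for c
    using power_mono[OF Finite_Cartesian_Product.norm_nth_le[where x=G and i=c], of 2] by (simp add: dot_square_norm)
  have s: "s \<le> 2 * (?N * ?N)"
  proof -
    have "(G $ a \<bullet> G $ b) * (G $ b \<bullet> G $ a) \<le> (G $ a \<bullet> G $ a) * (G $ b \<bullet> G $ b)"
      using Cauchy_Schwarz_ineq[of "G $ a" "G $ b"] by (simp add: power2_eq_square inner_commute)
    moreover have "(G $ a \<bullet> G $ a) * (G $ b \<bullet> G $ b) \<le> ?N * ?N" using N by (intro mult_mono) auto
    ultimately show ?thesis by (simp add: s_def)
  qed
  have gauss: "standard_gaussian (innov h k)" for k by (rule I.g_gaussian)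
  define m where "m \<omega> = (\<Sum>k<n. 1 * \<phi> (innov h k \<omega>))" for \<omega>
  have [measurable]: "m \<in> borel_measurable P" unfolding m_def by measurable
  have m2: "integrable P (\<lambda>\<omega>. (m \<omega>)\<^sup>2) \<and> expectation (\<lambda>\<omega>. (m \<omega>)\<^sup>2) \<le> real n * (1 * s)"
    unfolding m_def
  proof (rule I.innovation_sum_second_moment)
    show "integrable P (\<lambda>\<omega>. (\<phi> (innov h k \<omega>))\<^sup>2)" "expectation (\<lambda>\<omega>. \<phi> (innov h k \<omega>)) = 0"
      "expectation (\<lambda>\<omega>. (\<phi> (innov h k \<omega>))\<^sup>2) = s" for k
      using centered_product_covariance[OF gauss[of k], of "G $ a" "G $ b" "G $ a" "G $ b"]
        centered_product_expectation[OF gauss[of k], of "G $ a" "G $ b"]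
      unfolding \<phi>_def s_def by (auto simp: power2_eq_square)
  qed (auto simp: prob_space)
  have "mean_abs_le m (sqrt (real n) * ((s + 1) / 2))"
    by (rule mean_abs_le_second_moment) (use m2 n in auto)
  then have "mean_abs_le (\<lambda>\<omega>. (1 / sqrt (real n)) * m \<omega>) (\<bar>1 / sqrt (real n)\<bar> * (sqrt (real n) * ((s + 1) / 2)))"
    by (rule mean_abs_le_cmult)
  moreover have "fluct h n \<omega> $ a $ b = (1 / sqrt (real n)) * m \<omega>" for \<omega>
    by (simp add: fluct_entry m_def \<phi>_def centered_product_def)
  ultimately show "mean_abs_le (\<lambda>\<omega>. fluct h n \<omega> $ a $ b) ((2 * (?N * ?N) + 1) / 2)"
    using s n by (auto elim: mean_abs_le_mono)
qed

text \<open>Every linear functional of the main term is a normalized sum of the same quadratic form \<open>\<phi>\<close> evaluated at the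
innovations, so the central limit theorem for such arrays applies.\<close>

lemma fluct_clt:
  fixes u :: "'v::finite \<Rightarrow> real" and i j :: "'v \<Rightarrow> 'p"
  assumes h: "\<And>n. 0 < n \<Longrightarrow> 0 < h n"
  shows "(\<lambda>n. expectation (\<lambda>\<omega>. iexp (\<Sum>v\<in>UNIV. u v * fluct (h n) n \<omega> $ i v $ j v))) \<longlonglongrightarrow>
    exp (- complex_of_real (\<Sum>v\<in>UNIV. \<Sum>w\<in>UNIV. u v * u w *
        (\<Sigma>X $ i v $ i w * \<Sigma>X $ j v $ j w + \<Sigma>X $ i v $ j w * \<Sigma>X $ j v $ i w)) / 2)"
proof -
  define \<phi> where "\<phi> x = (\<Sum>v\<in>UNIV. u v * centered_product (G $ i v) (G $ j v) x)" for x
  have [measurable]: "\<phi> \<in> borel_measurable borel" unfolding \<phi>_def by measurable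
  obtain C where C: "\<And>g. standard_gaussian g \<Longrightarrow>
    integrable P (\<lambda>\<omega>. \<bar>\<phi> (g \<omega>)\<bar> ^ 3) \<and> expectation (\<lambda>\<omega>. \<bar>\<phi> (g \<omega>)\<bar> ^ 3) \<le> C"
    using centered_quadratic_third_moment[of u "\<lambda>v. G $ i v" "\<lambda>v. G $ j v"] unfolding \<phi>_def by blast
  have gauss: "standard_gaussian (innov (h n) k)" if "0 < n" for n k
    using gaussian_innovations.g_gaussian[OF innovations[OF h[OF that]]] .
  note q = centered_quadratic_moments[of _ u "\<lambda>v. G $ i v" "\<lambda>v. G $ j v", folded \<phi>_def]
  have "(\<lambda>n. expectation (\<lambda>\<omega>. iexp ((\<Sum>k<n. \<phi> (innov (h n) k \<omega>)) / sqrt (real n)))) \<longlonglongrightarrow>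
    exp (- complex_of_real (\<Sum>v\<in>UNIV. \<Sum>w\<in>UNIV. u v * u w *
        ((G $ i v \<bullet> G $ i w) * (G $ j v \<bullet> G $ j w) + (G $ i v \<bullet> G $ j w) * (G $ j v \<bullet> G $ i w))) / 2)"
    by (rule innovation_clt[where F="\<lambda>n k. past P W (real k * h n)" and c=C])
      (use innovations[OF h] q[OF gauss] C[OF gauss] in auto)
  moreover have "(\<Sum>k<n. \<phi> (innov (h n) k \<omega>)) / sqrt (real n) = (\<Sum>v\<in>UNIV. u v * fluct (h n) n \<omega> $ i v $ j v)" for n \<omega>
  proof -
    have "(\<Sum>k<n. \<phi> (innov (h n) k \<omega>)) = (\<Sum>v\<in>UNIV. \<Sum>k<n. u v * centered_product (G $ i v) (G $ j v) (innov (h n) k \<omega>))"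
      unfolding \<phi>_def by (rule sum.swap)
    then show ?thesis
      by (simp add: fluct_entry centered_product_def sum_divide_distrib sum_distrib_left)
  qed
  ultimately show ?thesis by (simp add: \<Sigma>X_entry)
qed

lemma realized_cov_entry:
  "realized_cov X h n \<omega> $ a $ b - \<Sigma>X $ a $ b = (1 / sqrt (real n)) * fluct h n \<omega> $ a $ b + remainder h n \<omega> $ a $ b"
  by (simp add: remainder_def)

lemma realized_cov_measurable:
  assumes "0 \<le> h"
  shows "realized_cov X h n \<in> borel_measurable P"
proof -
  have X[measurable]: "X (real m * h) \<in> borel_measurable P" for m using assms by (intro X_measurable) simp
  have entry: "(\<lambda>\<omega>. realized_cov X h n \<omega> $ a $ b) \<in> borel_measurable P" for a b
  proof -
    have "realized_cov X h n \<omega> $ a $ b = (1 / (real n * h)) * (\<Sum>i=1..n.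
        (X (real i * h) \<omega> $ a - X (real (i - 1) * h) \<omega> $ a) * (X (real i * h) \<omega> $ b - X (real (i - 1) * h) \<omega> $ b))" for \<omega>
      by (simp add: realized_cov_def outer_def)
    then show ?thesis by (simp only:) measurable
  qed
  show ?thesis
    by (subst borel_measurable_euclidean_space)
      (auto simp: Basis_vec_def inner_axis intro: entry)
qed

lemma error_first_moment:
  "\<exists>C\<ge>0. \<forall>h n a b. 0 < h \<and> h \<le> 1 \<and> 0 < n \<longrightarrow>
     mean_abs_le (\<lambda>\<omega>. realized_cov X h n \<omega> $ a $ b - \<Sigma>X $ a $ b) (C * (1 / sqrt (real n) + (h + sqrt (h / real n))))"
proof -
  obtain C1 where C1: "0 \<le> C1" "\<And>h n a b. 0 < h \<and> 0 < n \<Longrightarrow> mean_abs_le (\<lambda>\<omega>. fluct h n \<omega> $ a $ b) C1"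
    using fluct_bound by blast
  obtain C2 where C2: "0 \<le> C2" "\<And>h n a b. 0 < h \<and> h \<le> 1 \<and> 0 < n \<Longrightarrow>
     mean_abs_le (\<lambda>\<omega>. remainder h n \<omega> $ a $ b) (C2 * (h + sqrt (h / real n)))"
    using remainder_bound by blast
  show ?thesis
  proof (rule exI[of _ "C1 + C2"], rule conjI, use C1 C2 in simp, intro allI impI)
    fix h :: real and n :: nat and a b assume hn: "0 < h \<and> h \<le> 1 \<and> 0 < n"
    let ?c = "1 / sqrt (real n)"
    have "mean_abs_le (\<lambda>\<omega>. realized_cov X h n \<omega> $ a $ b - \<Sigma>X $ a $ b) (\<bar>?c\<bar> * C1 + C2 * (h + sqrt (h / real n)))"
      unfolding realized_cov_entry by (intro mean_abs_le_add mean_abs_le_cmult C1 C2) (use hn in auto)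
    moreover have "c * C1 + C2 * y \<le> (C1 + C2) * (c + y)" if "0 \<le> c" "0 \<le> y" for c y
      using mult_nonneg_nonneg[OF C1(1) that(2)] mult_nonneg_nonneg[OF C2(1) that(1)] by (simp add: algebra_simps)
    from this[of ?c "h + sqrt (h / real n)"]
    have "\<bar>?c\<bar> * C1 + C2 * (h + sqrt (h / real n)) \<le> (C1 + C2) * (?c + (h + sqrt (h / real n)))" using hn by simp
    ultimately show "mean_abs_le (\<lambda>\<omega>. realized_cov X h n \<omega> $ a $ b - \<Sigma>X $ a $ b)
        ((C1 + C2) * (?c + (h + sqrt (h / real n))))"
      by (rule mean_abs_le_mono)
  qed
qed

theorem realized_cov_consistent:
  assumes h: "\<And>n. 0 < n \<Longrightarrow> 0 < h n" "h \<longlonglongrightarrow> 0"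
  shows "converges_in_prob P sequentially (\<lambda>n. realized_cov X (h n) n) \<Sigma>X"
  unfolding converges_in_prob_def
proof (intro allI impI)
  fix \<epsilon> :: real assume \<epsilon>: "0 < \<epsilon>"
  obtain C where C: "\<And>h n a b. 0 < h \<and> h \<le> 1 \<and> 0 < n \<Longrightarrow>
     mean_abs_le (\<lambda>\<omega>. realized_cov X h n \<omega> $ a $ b - \<Sigma>X $ a $ b) (C * (1 / sqrt (real n) + (h + sqrt (h / real n))))"
    using error_first_moment by blast
  define K where "K = (\<Sum>a\<in>(UNIV::'p set). \<Sum>b\<in>(UNIV::'p set). C) / \<epsilon>"
  define q where "q n = 1 / sqrt (real n) + (h n + sqrt (h n / real n))" for n
  have ev: "eventually (\<lambda>n. 0 < h n \<and> h n \<le> 1 \<and> 0 < n) sequentially"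
    using order_tendstoD(2)[OF h(2) zero_less_one] eventually_gt_at_top[of 0]
    by eventually_elim (use h(1) in auto)
  have "eventually (\<lambda>n. norm (measure (completion P) {\<omega> \<in> space P. \<epsilon> < dist (realized_cov X (h n) n \<omega>) \<Sigma>X}) \<le> K * q n) sequentially"
    using ev
  proof eventually_elim
    case (elim n)
    let ?Q = "realized_cov X (h n) n"
    have [measurable]: "?Q \<in> borel_measurable P" using elim by (intro realized_cov_measurable) simp
    let ?S = "\<lambda>\<omega>. \<Sum>a\<in>UNIV. \<Sum>b\<in>UNIV. \<bar>?Q \<omega> $ a $ b - \<Sigma>X $ a $ b\<bar>"
    have S: "mean_abs_le ?S (\<Sum>a\<in>(UNIV::'p set). \<Sum>b\<in>(UNIV::'p set). C * q n)"
      unfolding q_def by (intro mean_abs_le_sum mean_abs_le_abs C elim)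
    have [measurable]: "?S \<in> borel_measurable P" using mean_abs_le_integrable[OF S] by measurable
    have S0: "\<bar>?S \<omega>\<bar> = ?S \<omega>" for \<omega> by (simp add: sum_nonneg)
    have m: "{\<omega> \<in> space P. \<epsilon> < dist (?Q \<omega>) \<Sigma>X} \<in> sets P" by measurable
    have "measure P {\<omega> \<in> space P. \<epsilon> < dist (?Q \<omega>) \<Sigma>X} \<le> measure P {\<omega> \<in> space P. \<epsilon> \<le> ?S \<omega>}"
    proof (rule finite_measure_mono)
      show "{\<omega> \<in> space P. \<epsilon> \<le> ?S \<omega>} \<in> events" by measurable
      have le: "dist (?Q \<omega>) \<Sigma>X \<le> ?S \<omega>" for \<omega>
        using norm_matrix_le_sum_abs[of "?Q \<omega> - \<Sigma>X"] by (simp add: dist_norm)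
      show "{\<omega> \<in> space P. \<epsilon> < dist (?Q \<omega>) \<Sigma>X} \<subseteq> {\<omega> \<in> space P. \<epsilon> \<le> ?S \<omega>}"
      proof safe
        fix \<omega> assume "\<epsilon> < dist (?Q \<omega>) \<Sigma>X"
        with le[of \<omega>] show "\<epsilon> \<le> ?S \<omega>" by (rule order_trans[OF less_imp_le, rotated])
      qed
    qed
    also have "\<dots> \<le> expectation ?S / \<epsilon>"
      by (rule integral_Markov_inequality_measure[OF mean_abs_le_integrable[OF S], where A="{}"])
        (use \<epsilon> in \<open>auto simp: sum_nonneg\<close>)
    also have "\<dots> \<le> (\<Sum>a\<in>(UNIV::'p set). \<Sum>b\<in>(UNIV::'p set). C * q n) / \<epsilon>"
      using S \<epsilon> unfolding mean_abs_le_def S0 by (intro divide_right_mono) auto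
    also have "\<dots> = K * q n" by (simp add: K_def)
    finally show ?case using m by simp
  qed
  moreover have "(\<lambda>n. K * q n) \<longlonglongrightarrow> 0"
  proof -
    have "(\<lambda>n. 1 / sqrt (real n)) \<longlonglongrightarrow> 0"
      using tendsto_real_sqrt[OF lim_1_over_n] by (simp add: real_sqrt_divide)
    moreover have "(\<lambda>n. sqrt (h n * (1 / real n))) \<longlonglongrightarrow> sqrt (0 * 0)"
      by (intro tendsto_real_sqrt tendsto_mult h(2) lim_1_over_n)
    ultimately have "q \<longlonglongrightarrow> 0 + (0 + 0)"
      unfolding q_def[abs_def] by (intro tendsto_add h(2)) simp_all
    then show ?thesis using tendsto_mult_right_zero by simp
  qed
  ultimately show "(\<lambda>n. measure (completion P) {\<omega> \<in> space P. \<epsilon> < dist (realized_cov X (h n) n \<omega>) \<Sigma>X}) \<longlonglongrightarrow> 0"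
    by (rule Lim_null_comparison)
qed

end

text \<open>The characteristic function of the normalized error differs from that of the main term by at most the
mean of the remainder times \<open>\<surd>n\<close>, which tends to zero. The variance of a linear functional of the
main term is the quadratic form of \<open>asym_cov\<close>, as the entries show.\<close>

theorem realized_cov_clt:
  fixes A :: "real^'k^('p::{finite,linorder})"
  assumes obs: "linear_sde_observation P W Y B S y0 A X L K"
    and h: "\<And>n. 0 < n \<Longrightarrow> 0 < h n" "h \<longlonglongrightarrow> 0" and nh2: "(\<lambda>n. real n * (h n)\<^sup>2) \<longlonglongrightarrow> 0"
  defines "\<Sigma> \<equiv> (A ** S) ** transpose (A ** S)"
  shows "\<exists>N. is_normal_law 0 (asym_cov \<Sigma>) N \<and> converges_in_distribution P
     (\<lambda>n \<omega>. sqrt (real n) *\<^sub>R (vech (realized_cov X (h n) n \<omega>) - vech \<Sigma>)) N"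
proof -
  interpret linear_sde_observation P W Y B S y0 A X L K by (rule obs)
  have \<Sigma>: "\<Sigma> = \<Sigma>X" by (simp add: \<Sigma>_def \<Sigma>X_def G_def)
  obtain N where N: "is_normal_law 0 (asym_cov \<Sigma>) N"
    using asym_cov_normal_law[of "A ** S"] unfolding \<Sigma>_def by blast
  define i where "i v = snd (Rep_tri v)" for v :: "'p tri"
  define j where "j v = fst (Rep_tri v)" for v :: "'p tri"
  define T where "T n \<omega> = sqrt (real n) *\<^sub>R (vech (realized_cov X (h n) n \<omega>) - vech \<Sigma>)" for n \<omega>
  define f where "f n v \<omega> = fluct (h n) n \<omega> $ i v $ j v" for n v \<omega>
  define e where "e n v \<omega> = sqrt (real n) * remainder (h n) n \<omega> $ i v $ j v" for n v \<omega>
  obtain C1 where C1: "\<And>h n a b. 0 < h \<and> 0 < n \<Longrightarrow> mean_abs_le (\<lambda>\<omega>. fluct h n \<omega> $ a $ b) C1"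
    using fluct_bound by blast
  obtain C2 where C2: "\<And>h n a b. 0 < h \<and> h \<le> 1 \<and> 0 < n \<Longrightarrow>
     mean_abs_le (\<lambda>\<omega>. remainder h n \<omega> $ a $ b) (C2 * (h + sqrt (h / real n)))"
    using remainder_bound by blast
  define r where "r n = \<bar>sqrt (real n)\<bar> * (C2 * (h n + sqrt (h n / real n)))" for n
  have r: "r \<longlonglongrightarrow> 0"
  proof -
    have "eventually (\<lambda>n. C2 * (sqrt (real n * (h n)\<^sup>2) + sqrt (h n)) = r n) sequentially"
      using eventually_gt_at_top[of 0]
    proof eventually_elim
      case (elim n)
      have "sqrt (real n) * sqrt (h n / real n) = sqrt (h n)"
        using elim by (simp add: real_sqrt_mult[symmetric])
      moreover have "sqrt (real n) * h n = sqrt (real n * (h n)\<^sup>2)"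
        using h(1)[OF elim] by (simp add: real_sqrt_mult)
      ultimately show ?case by (simp add: r_def distrib_left mult.left_commute[of "sqrt (real n)"])
    qed
    moreover have "(\<lambda>n. C2 * (sqrt (real n * (h n)\<^sup>2) + sqrt (h n))) \<longlonglongrightarrow> C2 * (sqrt 0 + sqrt 0)"
      by (intro tendsto_mult_left tendsto_add tendsto_real_sqrt nh2 h(2))
    ultimately show ?thesis by (simp add: tendsto_cong)
  qed
  have "eventually (\<lambda>n. 0 < n \<and> h n \<le> 1 \<and> r n \<le> 1) sequentially"
    using order_tendstoD(2)[OF h(2) zero_less_one] order_tendstoD(2)[OF r zero_less_one] eventually_gt_at_top[of 0]
    by eventually_elim auto
  then obtain n0 where n0: "\<And>n. n0 \<le> n \<Longrightarrow> 0 < n \<and> h n \<le> 1 \<and> r n \<le> 1"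
    by (auto simp: eventually_sequentially)
  have T: "T n \<omega> $ v = f n v \<omega> + e n v \<omega>" if "n0 \<le> n" for n \<omega> v
  proof -
    have "T n \<omega> $ v = sqrt (real n) * (realized_cov X (h n) n \<omega> $ i v $ j v - \<Sigma>X $ i v $ j v)"
      by (simp add: T_def vech_def i_def j_def \<Sigma>)
    then show ?thesis unfolding realized_cov_entry f_def e_def using n0[OF that] by (simp add: distrib_left)
  qed
  have fb: "mean_abs_le (f n v) C1" and eb: "mean_abs_le (e n v) (r n)" if "n0 \<le> n" for n v
  proof -
    have hn: "0 < h n \<and> h n \<le> 1 \<and> 0 < n" using n0[OF that] h(1) by auto
    then show "mean_abs_le (f n v) C1" unfolding f_def by (intro C1) simp
    show "mean_abs_le (e n v) (r n)" unfolding e_def r_def by (intro mean_abs_le_cmult C2 hn)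
  qed
  have Tb: "mean_abs_le (\<lambda>\<omega>. T n \<omega> $ v) (C1 + r n)" if "n0 \<le> n" for n v
    unfolding T[OF that] by (intro mean_abs_le_add fb eb that)
  have Tm: "T n \<in> borel_measurable P" if "n0 \<le> n" for n
    using mean_abs_le_integrable[OF Tb[OF that]]
    by (subst borel_measurable_euclidean_space) (auto simp: Basis_vec_def inner_axis)
  \<comment> \<open>The moment bounds need \<open>h n \<le> 1\<close>; dropping finitely many terms does not affect the limit.\<close>
  define Z where "Z n = T (n + n0)" for n
  have Z: "Z n \<in> borel_measurable P" for n unfolding Z_def by (rule Tm) simp
  have "converges_in_distribution P Z N"
  proof (rule levy_continuity_euclidean[OF prob_space_axioms Z])
    show "prob_space N" "sets N = sets borel" using N by (auto simp: is_normal_law_def)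
    fix u :: "real^('p tri)"
    let ?f = "\<lambda>n \<omega>. \<Sum>v\<in>UNIV. u $ v * f n v \<omega>"
    have "(\<lambda>n. expectation (\<lambda>\<omega>. iexp (?f n \<omega>))) \<longlonglongrightarrow>
      exp (- complex_of_real (\<Sum>v\<in>UNIV. \<Sum>w\<in>UNIV. u $ v * u $ w *
        (\<Sigma>X $ i v $ i w * \<Sigma>X $ j v $ j w + \<Sigma>X $ i v $ j w * \<Sigma>X $ j v $ i w)) / 2)"
      unfolding f_def by (rule fluct_clt) (rule h(1))
    also have "(\<Sum>v\<in>UNIV. \<Sum>w\<in>UNIV. u $ v * u $ w *
        (\<Sigma>X $ i v $ i w * \<Sigma>X $ j v $ j w + \<Sigma>X $ i v $ j w * \<Sigma>X $ j v $ i w)) = u \<bullet> (asym_cov \<Sigma> *v u)"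
      by (simp add: inner_vec_def matrix_vector_mult_def asym_cov_entry \<Sigma> i_def j_def sum_distrib_left algebra_simps)
    also have "exp (- complex_of_real (u \<bullet> (asym_cov \<Sigma> *v u)) / 2) = (\<integral>x. iexp (u \<bullet> x) \<partial>N)"
      using N unfolding is_normal_law_def by simp
    finally have lim: "(\<lambda>n. expectation (\<lambda>\<omega>. iexp (?f n \<omega>))) \<longlonglongrightarrow> (\<integral>x. iexp (u \<bullet> x) \<partial>N)" .
    have "eventually (\<lambda>n. norm (expectation (\<lambda>\<omega>. iexp (u \<bullet> T n \<omega>)) - expectation (\<lambda>\<omega>. iexp (?f n \<omega>))) \<le>
        (\<Sum>v\<in>UNIV. \<bar>u $ v\<bar>) * r n) sequentially"
      using eventually_ge_at_top[of n0]
    proof eventually_elim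
      case (elim n)
      have d: "u \<bullet> T n \<omega> - ?f n \<omega> = (\<Sum>v\<in>UNIV. u $ v * e n v \<omega>)" for \<omega>
        by (simp add: inner_vec_def T[OF elim] distrib_left sum.distrib)
      note [measurable] = Tm[OF elim] borel_measurable_integrable[OF mean_abs_le_integrable[OF fb[OF elim]]]
      have "mean_abs_le (\<lambda>\<omega>. u \<bullet> T n \<omega> - ?f n \<omega>) (\<Sum>v\<in>UNIV. \<bar>u $ v\<bar> * r n)"
        unfolding d by (intro mean_abs_le_sum mean_abs_le_cmult eb elim)
      then have "cmod (expectation (\<lambda>\<omega>. iexp (u \<bullet> T n \<omega>)) - expectation (\<lambda>\<omega>. iexp (?f n \<omega>))) \<le> (\<Sum>v\<in>UNIV. \<bar>u $ v\<bar> * r n)"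
        by (intro char_diff_le) measurable
      then show ?case by (simp add: sum_distrib_right)
    qed
    moreover have "(\<lambda>n. (\<Sum>v\<in>UNIV. \<bar>u $ v\<bar>) * r n) \<longlonglongrightarrow> 0" by (rule tendsto_mult_right_zero[OF r])
    ultimately have "(\<lambda>n. expectation (\<lambda>\<omega>. iexp (u \<bullet> T n \<omega>)) - expectation (\<lambda>\<omega>. iexp (?f n \<omega>))) \<longlonglongrightarrow> 0"
      by (rule Lim_null_comparison)
    then have "(\<lambda>n. expectation (\<lambda>\<omega>. iexp (u \<bullet> T n \<omega>))) \<longlonglongrightarrow> (\<integral>x. iexp (u \<bullet> x) \<partial>N)"
      by (rule Lim_transform[OF lim])
    then show "(\<lambda>n. expectation (\<lambda>\<omega>. iexp (u \<bullet> Z n \<omega>))) \<longlonglongrightarrow> (\<integral>x. iexp (u \<bullet> x) \<partial>N)"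
      unfolding Z_def by (rule LIMSEQ_ignore_initial_segment)
  next
    fix n
    have m: "n0 \<le> n + n0" by simp
    let ?S = "\<lambda>\<omega>. \<Sum>v\<in>UNIV. \<bar>Z n \<omega> $ v\<bar>"
    have S: "mean_abs_le ?S (\<Sum>v\<in>(UNIV :: 'p tri set). C1 + 1)"
      unfolding Z_def
      by (intro mean_abs_le_sum mean_abs_le_abs mean_abs_le_mono[OF Tb[OF m]]) (use n0[OF m] in simp)
    have "expectation ?S = expectation (\<lambda>\<omega>. \<bar>?S \<omega>\<bar>)" by (simp add: sum_nonneg)
    then have "mean_abs_le (\<lambda>\<omega>. norm (Z n \<omega>)) (\<Sum>v\<in>(UNIV :: 'p tri set). C1 + 1)"
      using S Z norm_le_l1_cart[of "Z n _"] by (intro mean_abs_leI[where g="?S"]) (auto simp: mean_abs_le_def)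
    then show "integrable P (\<lambda>\<omega>. norm (Z n \<omega>))"
      "expectation (\<lambda>\<omega>. norm (Z n \<omega>)) \<le> (\<Sum>v\<in>(UNIV :: 'p tri set). C1 + 1)"
      by (simp_all add: mean_abs_le_def)
  qed
  then have shifted: "(\<lambda>n. expectation (\<lambda>\<omega>. F (T (n + n0) \<omega>))) \<longlonglongrightarrow> (\<integral>x. F x \<partial>N)"
    if "continuous_on UNIV F" "bounded (range F)" for F :: "real^('p tri) \<Rightarrow> real"
    using that unfolding converges_in_distribution_def Z_def by simp
  have "(\<lambda>n. expectation (\<lambda>\<omega>. F (T n \<omega>))) \<longlonglongrightarrow> (\<integral>x. F x \<partial>N)"
    if "continuous_on UNIV F" "bounded (range F)" for F :: "real^('p tri) \<Rightarrow> real"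
    using shifted[OF that] by (rule LIMSEQ_offset)
  then have "converges_in_distribution P T N" by (simp add: converges_in_distribution_def)
  then show ?thesis using N unfolding T_def by blast
qed

section \<open>Stacked vectors and block matrices\<close>

lemma sum_UNIV_sum:
  fixes f :: "'a::finite + 'b::finite \<Rightarrow> 'c::comm_monoid_add"
  shows "sum f UNIV = (\<Sum>a\<in>UNIV. f (Inl a)) + (\<Sum>b\<in>UNIV. f (Inr b))"
  using sum.Plus[of "UNIV :: 'a set" "UNIV :: 'b set" f] by (simp add: comp_def)

lemma stack_nth [simp]: "stack x y $ Inl a = x $ a" "stack x y $ Inr b = y $ b"
  by (simp_all add: stack_def)

lemma vec_eq_sum_iff: "z = z' \<longleftrightarrow> (\<forall>a. z $ Inl a = z' $ Inl a) \<and> (\<forall>b. z $ Inr b = z' $ Inr b)"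
  for z z' :: "'c^('a::finite + 'b::finite)"
  by (auto simp: vec_eq_iff split_sum_all)

lemma stack_add: "stack (x + x') (y + y') = stack x y + stack x' y'"
  by (simp add: vec_eq_sum_iff)

lemma stack_diff: "stack (x - x') (y - y') = stack x y - stack x' y'"
  by (simp add: vec_eq_sum_iff)

lemma inner_stack: "stack x y \<bullet> stack x' y' = x \<bullet> x' + y \<bullet> y'"
  by (simp add: inner_vec_def sum_UNIV_sum)

lemma norm_stack_sq: "(norm (stack x y))\<^sup>2 = (norm x)\<^sup>2 + (norm y)\<^sup>2"
  by (simp add: power2_norm_eq_inner inner_stack)

lemma norm_stack_le: "norm (stack x y) \<le> norm x + norm y"
proof (rule power2_le_imp_le)
  show "(norm (stack x y))\<^sup>2 \<le> (norm x + norm y)\<^sup>2" by (simp add: norm_stack_sq power2_sum)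
qed simp

definition upper :: "real^('a::finite + 'b::finite) \<Rightarrow> real^'a" where "upper z = (\<chi> a. z $ Inl a)"

definition lower :: "real^('a::finite + 'b::finite) \<Rightarrow> real^'b" where "lower z = (\<chi> b. z $ Inr b)"

lemma upper_stack [simp]: "upper (stack x y) = x" and lower_stack [simp]: "lower (stack x y) = y"
  by (simp_all add: upper_def lower_def vec_eq_iff)

lemma stack_upper_lower [simp]: "stack (upper z) (lower z) = z"
  by (simp add: vec_eq_sum_iff upper_def lower_def)

lemma upper_diff: "upper (z - z') = upper z - upper z'" and lower_diff: "lower (z - z') = lower z - lower z'"
  by (simp_all add: upper_def lower_def vec_eq_iff)

lemma norm_upper_le: "norm (upper z) \<le> norm z" and norm_lower_le: "norm (lower z) \<le> norm z"
  by (rule power2_le_imp_le; use norm_stack_sq[of "upper z" "lower z"] in simp)+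

lemma bounded_linear_stack_left: "bounded_linear (\<lambda>x :: real^'a. stack x (0 :: real^'b))"
proof (rule bounded_linear_intro[where K=1])
  fix x :: "real^'a"
  show "norm (stack x (0 :: real^'b)) \<le> norm x * 1" using norm_stack_le[of x "0 :: real^'b"] by simp
qed (simp_all add: vec_eq_sum_iff)

lemma bounded_linear_stack_right: "bounded_linear (\<lambda>y :: real^'b. stack (0 :: real^'a) y)"
proof (rule bounded_linear_intro[where K=1])
  fix y :: "real^'b"
  show "norm (stack (0 :: real^'a) y) \<le> norm y * 1" using norm_stack_le[of "0 :: real^'a" y] by simp
qed (simp_all add: vec_eq_sum_iff)

lemma stack_split: "stack x y = stack x 0 + stack 0 y"
  by (simp add: vec_eq_sum_iff)

lemma continuous_on_stack [continuous_intros]: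
  assumes "continuous_on T f" "continuous_on T g"
  shows "continuous_on T (\<lambda>t. stack (f t) (g t))"
  by (subst stack_split)
    (intro continuous_intros bounded_linear.continuous_on[OF bounded_linear_stack_left]
      bounded_linear.continuous_on[OF bounded_linear_stack_right] assms)

lemma measurable_stack [measurable (raw)]:
  assumes [measurable]: "f \<in> borel_measurable N" "g \<in> borel_measurable N"
  shows "(\<lambda>\<omega>. stack (f \<omega>) (g \<omega>)) \<in> borel_measurable N"
proof -
  have "(\<lambda>x. stack x 0) \<in> borel_measurable borel" "(\<lambda>y. stack 0 y) \<in> borel_measurable borel"
    by (intro borel_measurable_continuous_onI linear_continuous_on bounded_linear_stack_left bounded_linear_stack_right)+
  note [measurable] = this
  show ?thesis by (subst stack_split) measurable
qed

lemma has_integral_stack: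
  assumes "(f has_integral i) T" "(g has_integral j) T"
  shows "((\<lambda>t. stack (f t) (g t)) has_integral stack i j) T"
proof -
  have "((\<lambda>t. stack (f t) 0 + stack 0 (g t)) has_integral (stack i 0 + stack 0 j)) T"
    using has_integral_add[OF has_integral_linear[OF assms(1) bounded_linear_stack_left]
        has_integral_linear[OF assms(2) bounded_linear_stack_right]] by (simp add: comp_def)
  then show ?thesis by (simp flip: stack_split)
qed

text \<open>The loading matrix of the latent processes has two block rows and four block columns. Pairing the
columns makes it a two by two block matrix, whose entries are built in this way.\<close>

definition hstack :: "real^'c^'a \<Rightarrow> real^'d^'a \<Rightarrow> real^('c + 'd)^'a" where
  "hstack A B = (\<chi> i. stack (A $ i) (B $ i))"

lemma hstack_nth [simp]: "hstack A B $ i = stack (A $ i) (B $ i)"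
  by (simp add: hstack_def)

lemma block_matrix_nth [simp]:
  "block_matrix A B C D $ Inl a = stack (A $ a) (B $ a)" "block_matrix A B C D $ Inr b = stack (C $ b) (D $ b)"
  by (simp_all add: block_matrix_def)

lemma block_matrix_mult:
  "block_matrix A B C D ** block_matrix A' B' C' D' =
     block_matrix (A ** A' + B ** C') (A ** B' + B ** D') (C ** A' + D ** C') (C ** B' + D ** D')"
  by (simp add: vec_eq_sum_iff matrix_matrix_mult_def sum_UNIV_sum)

lemma transpose_block_matrix:
  "transpose (block_matrix A B C D) = block_matrix (transpose A) (transpose C) (transpose B) (transpose D)"
  by (simp add: vec_eq_sum_iff transpose_def)

lemma block_matrix_vec: "block_matrix A B C D *v stack x y = stack (A *v x + B *v y) (C *v x + D *v y)"
  by (simp add: vec_eq_sum_iff matrix_vector_mult_def sum_UNIV_sum)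

lemma hstack_vec: "hstack A B *v stack x y = A *v x + B *v y"
  by (simp add: vec_eq_iff matrix_vector_mult_def sum_UNIV_sum)

lemma hstack_mult_diag: "hstack A B ** block_matrix C 0 0 D = hstack (A ** C) (B ** D)"
  by (subst vec_eq_iff, intro allI) (simp add: vec_eq_sum_iff matrix_matrix_mult_def sum_UNIV_sum)

lemma hstack_mult_transpose: "hstack A B ** transpose (hstack C D) = A ** transpose C + B ** transpose D"
  by (simp add: vec_eq_iff matrix_matrix_mult_def transpose_def sum_UNIV_sum)

lemma matrix_mult_zero [simp]: "(0 :: real^'b^'a) ** (M :: real^'c^'b) = 0" "(N :: real^'b^'a) ** (0 :: real^'c^'b) = 0"
  by (simp_all add: vec_eq_iff matrix_matrix_mult_def)

lemma transpose_zero [simp]: "transpose (0 :: real^'b^'a) = 0"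
  by (simp add: vec_eq_iff transpose_def)

lemma matrix_mult_add_left: "(M + N) ** Q = M ** Q + N ** (Q :: real^'c^'b)"
  by (simp add: vec_eq_iff matrix_matrix_mult_def sum.distrib distrib_right)

lemma matrix_inv_mult_left:
  assumes "invertible (M :: real^'n^'n)"
  shows "matrix_inv M ** M = mat 1"
  unfolding matrix_inv_def by (rule someI2_ex) (use assms in \<open>auto simp: invertible_def\<close>)

section \<open>Joining independent diffusions\<close>

text \<open>Intersections of one event from each factor form an intersection-stable generator, on which independence can be
checked.\<close>

lemma (in prob_space) indep_set_joint:
  assumes ev: "E1 \<subseteq> events" "E2 \<subseteq> events" "D1 \<subseteq> events" "D2 \<subseteq> events"
    and Int: "Int_stable E1" "Int_stable E2" "Int_stable D1" "Int_stable D2"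
    and space: "space M \<in> E1" "space M \<in> E2" "space M \<in> D1" "space M \<in> D2"
    and indep: "\<And>a b c d. a \<in> E1 \<Longrightarrow> b \<in> E2 \<Longrightarrow> c \<in> D1 \<Longrightarrow> d \<in> D2 \<Longrightarrow>
      prob ((a \<inter> b) \<inter> (c \<inter> d)) = prob (a \<inter> b) * prob (c \<inter> d)"
  shows "indep_set (sigma_sets (space M) (E1 \<union> E2)) (sigma_sets (space M) (D1 \<union> D2))"
proof -
  define E where "E = {a \<inter> b | a b. a \<in> E1 \<and> b \<in> E2}"
  define D where "D = {c \<inter> d | c d. c \<in> D1 \<and> d \<in> D2}"
  have stable: "Int_stable {a \<inter> b | a b. a \<in> A \<and> b \<in> B}" if "Int_stable A" "Int_stable B" for A B :: "'a set set"
  proof (rule Int_stableI)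
    fix x y assume "x \<in> {a \<inter> b | a b. a \<in> A \<and> b \<in> B}" "y \<in> {a \<inter> b | a b. a \<in> A \<and> b \<in> B}"
    then obtain a b a' b' where "a \<in> A" "b \<in> B" "a' \<in> A" "b' \<in> B" and xy: "x = a \<inter> b" "y = a' \<inter> b'" by blast
    then have "a \<inter> a' \<in> A" "b \<inter> b' \<in> B" using that by (auto simp: Int_stable_def)
    moreover have "x \<inter> y = (a \<inter> a') \<inter> (b \<inter> b')" unfolding xy by blast
    ultimately show "x \<inter> y \<in> {a \<inter> b | a b. a \<in> A \<and> b \<in> B}" by blast
  qed
  have "indep_set E D"
    by (rule indep_setI) (use ev indep in \<open>auto simp: E_def D_def subset_iff\<close>)
  then have "indep_set (sigma_sets (space M) E) (sigma_sets (space M) D)"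
    by (rule indep_set_sigma_sets) (simp_all add: E_def D_def stable Int)
  moreover have "E1 \<union> E2 \<subseteq> E" "D1 \<union> D2 \<subseteq> D"
  proof -
    have cap: "a = a \<inter> space M" "a = space M \<inter> a" if "a \<in> events" for a
      using sets.sets_into_space[OF that] by auto
    have join: "A \<union> B \<subseteq> {a \<inter> b | a b. a \<in> A \<and> b \<in> B}"
      if "A \<subseteq> events" "B \<subseteq> events" "space M \<in> A" "space M \<in> B" for A B
    proof
      fix x assume "x \<in> A \<union> B"
      then show "x \<in> {a \<inter> b | a b. a \<in> A \<and> b \<in> B}"
      proof
        assume "x \<in> A"
        then show ?thesis using cap(1)[of x] that by blast
      next
        assume "x \<in> B"
        then show ?thesis using cap(2)[of x] that by blast
      qed
    qed
    show "E1 \<union> E2 \<subseteq> E" "D1 \<union> D2 \<subseteq> D" unfolding E_def D_def by (rule join; use ev space in simp)+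
  qed
  ultimately show ?thesis
    by (elim indep_set_mono) (intro sigma_sets_subseteq; assumption)+
qed

lemma Int_stable_process_events: "Int_stable (process_events P I W)"
  and space_process_events: "space P \<in> process_events P I W"
proof -
  have "sigma_algebra (space P) (process_events P I W)"
    unfolding process_events_def by (rule sigma_algebra_sigma_sets) auto
  then interpret sigma_algebra "space P" "process_events P I W" .
  show "Int_stable (process_events P I W)" by (auto simp: Int_stable_def)
  show "space P \<in> process_events P I W" by (rule top)
qed

lemma preimage_in_sigma_sets_stack:
  fixes f :: "'w \<Rightarrow> real^'a" and g :: "'w \<Rightarrow> real^'b"
  assumes E: "E \<subseteq> Pow (space P)"
    and f: "\<And>A. A \<in> sets borel \<Longrightarrow> f -` A \<inter> space P \<in> E" and g: "\<And>A. A \<in> sets borel \<Longrightarrow> g -` A \<inter> space P \<in> E"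
    and A: "A \<in> sets borel"
  shows "(\<lambda>\<omega>. stack (f \<omega>) (g \<omega>)) -` A \<inter> space P \<in> sigma_sets (space P) E"
proof -
  define N where "N = sigma (space P) E"
  have N: "space N = space P" "sets N = sigma_sets (space P) E"
    using E by (auto simp: N_def space_measure_of sets_measure_of)
  have [measurable]: "f \<in> borel_measurable N" "g \<in> borel_measurable N"
    by (auto intro!: measurableI simp: N f g)
  have "(\<lambda>\<omega>. stack (f \<omega>) (g \<omega>)) \<in> borel_measurable N" by measurable
  from measurable_sets[OF this A] show ?thesis by (simp add: N)
qed

lemma process_events_stack:
  fixes V :: "real \<Rightarrow> 'w \<Rightarrow> real^'a" and W :: "real \<Rightarrow> 'w \<Rightarrow> real^'b"
  shows "process_events P I (\<lambda>t \<omega>. stack (V t \<omega>) (W t \<omega>)) \<subseteq>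
    sigma_sets (space P) (process_events P I V \<union> process_events P I W)"
proof -
  let ?E = "process_events P I V \<union> process_events P I W"
  have "{(\<lambda>\<omega>. stack (V t \<omega>) (W t \<omega>)) -` A \<inter> space P | t A. t \<in> I \<and> A \<in> sets borel} \<subseteq> sigma_sets (space P) ?E"
  proof safe
    fix t and A :: "(real^('a + 'b)) set" assume t: "t \<in> I" and A: "A \<in> sets borel"
    show "(\<lambda>\<omega>. stack (V t \<omega>) (W t \<omega>)) -` A \<inter> space P \<in> sigma_sets (space P) ?E"
    proof (rule preimage_in_sigma_sets_stack[OF _ _ _ A])
      show "?E \<subseteq> Pow (space P)" by (simp add: process_events_subset_Pow)
    qed (use t in \<open>auto simp: process_events_def intro!: sigma_sets.Basic\<close>)
  qed
  then show ?thesis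
    using sigma_sets_mono unfolding process_events_def[of P I "\<lambda>t \<omega>. stack (V t \<omega>) (W t \<omega>)"] by blast
qed

lemma increment_events:
  fixes W :: "real \<Rightarrow> 'w \<Rightarrow> real^'r"
  assumes "0 \<le> s" "s < t"
  shows "{(\<lambda>\<omega>. W t \<omega> - W s \<omega>) -` A \<inter> space P | A. A \<in> sets borel} \<subseteq> process_events P {0..} W"
proof safe
  fix A :: "(real^'r) set" assume A: "A \<in> sets borel"
  have [measurable]: "W t \<in> borel_measurable (past P W t)" "W s \<in> borel_measurable (past P W t)"
    using assms by (auto intro: measurable_past)
  have "(\<lambda>\<omega>. W t \<omega> - W s \<omega>) -` A \<inter> space (past P W t) \<in> sets (past P W t)"
    by (rule measurable_sets[OF _ A]) measurable
  moreover have "process_events P {0..t} W \<subseteq> process_events P {0..} W" by (rule process_events_mono) auto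
  ultimately show "(\<lambda>\<omega>. W t \<omega> - W s \<omega>) -` A \<inter> space P \<in> process_events P {0..} W"
    by (auto simp: sets_past)
qed

lemma inner_mat_vec: "u \<bullet> ((mat h :: real^'i^'i) *v u) = h * (u \<bullet> u)"
  by (simp add: mat_vec)

text \<open>The hypothesis speaks of the generated events because \<open>f\<close> and \<open>g\<close> may have different dimensions.\<close>

lemma normal_law_stack:
  fixes f :: "'w \<Rightarrow> real^'a" and g :: "'w \<Rightarrow> real^'b"
  assumes P: "prob_space P" and [measurable]: "f \<in> borel_measurable P" "g \<in> borel_measurable P"
    and law: "is_normal_law 0 (mat h) (distr P borel f)" "is_normal_law 0 (mat h) (distr P borel g)"
    and ind: "prob_space.indep_set P (sigma_sets (space P) {f -` A \<inter> space P | A. A \<in> sets borel})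
        (sigma_sets (space P) {g -` A \<inter> space P | A. A \<in> sets borel})"
  shows "is_normal_law 0 (mat h) (distr P borel (\<lambda>\<omega>. stack (f \<omega>) (g \<omega>)))"
proof -
  interpret prob_space P by (rule P)
  show ?thesis unfolding is_normal_law_def
  proof (intro conjI allI)
    show "prob_space (distr P borel (\<lambda>\<omega>. stack (f \<omega>) (g \<omega>)))" by (rule prob_space_distr) measurable
    fix u :: "real^('a + 'b)"
    let ?x = "upper u" and ?y = "lower u"
    have "(\<integral>z. iexp (u \<bullet> z) \<partial>distr P borel (\<lambda>\<omega>. stack (f \<omega>) (g \<omega>))) =
        (\<integral>\<omega>. iexp (?x \<bullet> f \<omega>) * iexp (?y \<bullet> g \<omega>) \<partial>P)"
      using inner_stack[of ?x ?y] by (simp add: integral_distr exp_add distrib_left)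
    also have "\<dots> = (\<integral>\<omega>. iexp (?x \<bullet> f \<omega>) \<partial>P) * (\<integral>\<omega>. iexp (?y \<bullet> g \<omega>) \<partial>P)"
    proof (rule indep_var_lebesgue_integral)
      show "indep_var borel (\<lambda>\<omega>. iexp (?x \<bullet> f \<omega>)) borel (\<lambda>\<omega>. iexp (?y \<bullet> g \<omega>))"
        by (rule indep_var_compose_preimages[OF _ _ _ _ ind]) measurable
    qed (auto intro!: integrable_const_bound[where B=1])
    also have "(\<integral>\<omega>. iexp (?x \<bullet> f \<omega>) \<partial>P) = (\<integral>z. iexp (?x \<bullet> z) \<partial>distr P borel f)"
      by (simp add: integral_distr)
    also have "\<dots> = exp (- complex_of_real (h * (?x \<bullet> ?x)) / 2)"
      using law(1) unfolding is_normal_law_def by (simp add: inner_mat_vec)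
    also have "(\<integral>\<omega>. iexp (?y \<bullet> g \<omega>) \<partial>P) = (\<integral>z. iexp (?y \<bullet> z) \<partial>distr P borel g)"
      by (simp add: integral_distr)
    also have "\<dots> = exp (- complex_of_real (h * (?y \<bullet> ?y)) / 2)"
      using law(2) unfolding is_normal_law_def by (simp add: inner_mat_vec)
    also have "exp (- complex_of_real (h * (?x \<bullet> ?x)) / 2) * exp (- complex_of_real (h * (?y \<bullet> ?y)) / 2) =
        exp (\<i> * complex_of_real (u \<bullet> 0) - complex_of_real (u \<bullet> (mat h *v u)) / 2)"
      using inner_stack[of ?x ?y ?x ?y] by (simp add: inner_mat_vec exp_add[symmetric] distrib_left add_divide_distrib)
    finally show "(\<integral>z. iexp (u \<bullet> z) \<partial>distr P borel (\<lambda>\<omega>. stack (f \<omega>) (g \<omega>))) =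
        exp (\<i> * complex_of_real (u \<bullet> 0) - complex_of_real (u \<bullet> (mat h *v u)) / 2)" .
  qed simp
qed

text \<open>An increment of one component is independent of its own past by assumption and of the other component,
past and increment together, by the independence of the two processes. So the four events in play
have product probabilities, and the joint increment is independent of the joint past.\<close>

lemma wiener_process_stack:
  fixes V :: "real \<Rightarrow> 'w \<Rightarrow> real^'a" and W :: "real \<Rightarrow> 'w \<Rightarrow> real^'b"
  assumes P: "prob_space P" and V: "wiener_process P V" and W: "wiener_process P W"
    and ind: "prob_space.indep_set P (process_events P {0..} V) (process_events P {0..} W)"
  shows "wiener_process P (\<lambda>t \<omega>. stack (V t \<omega>) (W t \<omega>))"
  unfolding wiener_process_def
proof (intro conjI allI impI)
  interpret prob_space P by (rule P)
  have Vm: "0 \<le> t \<Longrightarrow> V t \<in> borel_measurable P" and Wm: "0 \<le> t \<Longrightarrow> W t \<in> borel_measurable P" for t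
    using V W by (auto simp: wiener_process_def)
  show "(\<lambda>\<omega>. stack (V t \<omega>) (W t \<omega>)) \<in> borel_measurable P" if "0 \<le> t" for t
    using Vm[OF that] Wm[OF that] by measurable
  have "AE \<omega> in P. V 0 \<omega> = 0 \<and> continuous_on {0..} (\<lambda>t. V t \<omega>)" "AE \<omega> in P. W 0 \<omega> = 0 \<and> continuous_on {0..} (\<lambda>t. W t \<omega>)"
    using V W by (auto simp: wiener_process_def)
  then show "AE \<omega> in P. stack (V 0 \<omega>) (W 0 \<omega>) = 0 \<and> continuous_on {0..} (\<lambda>t. stack (V t \<omega>) (W t \<omega>))"
    by eventually_elim (auto intro: continuous_on_stack simp: vec_eq_sum_iff)
  fix s t :: real assume st: "0 \<le> s \<and> s < t"
  let ?dV = "\<lambda>\<omega>. V t \<omega> - V s \<omega>" and ?dW = "\<lambda>\<omega>. W t \<omega> - W s \<omega>"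
  let ?E1 = "process_events P {0..s} V" and ?E2 = "process_events P {0..s} W"
  let ?D1 = "{?dV -` A \<inter> space P | A. A \<in> sets borel}" and ?D2 = "{?dW -` A \<inter> space P | A. A \<in> sets borel}"
  let ?F1 = "process_events P {0..} V" and ?F2 = "process_events P {0..} W"
  have st': "0 \<le> s" "s < t" "0 \<le> t" using st by auto
  note [measurable] = Vm[OF st'(1)] Vm[OF st'(3)] Wm[OF st'(1)] Wm[OF st'(3)]
  have lawV: "is_normal_law 0 (mat (t - s)) (distr P borel ?dV)" and indV: "indep_set ?E1 ?D1"
    using V st unfolding wiener_process_def by blast+
  have lawW: "is_normal_law 0 (mat (t - s)) (distr P borel ?dW)" and indW: "indep_set ?E2 ?D2"
    using W st unfolding wiener_process_def by blast+
  have EF: "?E1 \<subseteq> ?F1" "?E2 \<subseteq> ?F2" by (rule process_events_mono, simp)+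
  have DF: "?D1 \<subseteq> ?F1" "?D2 \<subseteq> ?F2" by (rule increment_events[OF st'(1,2)])+
  have Fev: "?F1 \<subseteq> events" "?F2 \<subseteq> events" by (rule process_events_subset_sets, simp add: Vm Wm)+
  have FInt: "Int_stable ?F1" "Int_stable ?F2" by (rule Int_stable_process_events)+
  have indD: "indep_set (sigma_sets (space P) ?D1) (sigma_sets (space P) ?D2)"
  proof (rule indep_set_mono[OF ind])
    show "sigma_sets (space P) ?D1 \<subseteq> ?F1" "sigma_sets (space P) ?D2 \<subseteq> ?F2"
      using sigma_sets_mono[OF DF(1)[unfolded process_events_def]] sigma_sets_mono[OF DF(2)[unfolded process_events_def]]
      unfolding process_events_def by auto
  qed
  have dstack: "(\<lambda>\<omega>. stack (V t \<omega>) (W t \<omega>) - stack (V s \<omega>) (W s \<omega>)) = (\<lambda>\<omega>. stack (?dV \<omega>) (?dW \<omega>))"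
    by (simp add: stack_diff)
  show "is_normal_law 0 (mat (t - s)) (distr P borel (\<lambda>\<omega>. stack (V t \<omega>) (W t \<omega>) - stack (V s \<omega>) (W s \<omega>)))"
    unfolding dstack by (rule normal_law_stack[OF P _ _ lawV lawW indD]) measurable
  have joint: "indep_set (sigma_sets (space P) (?E1 \<union> ?E2)) (sigma_sets (space P) (?D1 \<union> ?D2))"
  proof (rule indep_set_joint)
    show "space P \<in> ?D1" "space P \<in> ?D2" using sets.top[of borel] by (auto intro!: exI[of _ UNIV])
    fix a b c d assume abcd: "a \<in> ?E1" "b \<in> ?E2" "c \<in> ?D1" "d \<in> ?D2"
    have "a \<inter> c \<in> ?F1" "b \<inter> d \<in> ?F2"
      using abcd EF DF FInt by (auto simp only: Int_stable_def subset_iff)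
    then have "prob ((a \<inter> c) \<inter> (b \<inter> d)) = prob (a \<inter> c) * prob (b \<inter> d)" by (rule indep_setD[OF ind])
    also have "\<dots> = (prob a * prob c) * (prob b * prob d)"
      using indep_setD[OF indV abcd(1,3)] indep_setD[OF indW abcd(2,4)] by simp
    also have "prob a * prob c * (prob b * prob d) = (prob a * prob b) * (prob c * prob d)" by simp
    also have "prob a * prob b = prob (a \<inter> b)"
      using indep_setD[OF ind subsetD[OF EF(1) abcd(1)] subsetD[OF EF(2) abcd(2)]] by simp
    also have "prob c * prob d = prob (c \<inter> d)"
      using indep_setD[OF ind subsetD[OF DF(1) abcd(3)] subsetD[OF DF(2) abcd(4)]] by simp
    finally show "prob ((a \<inter> b) \<inter> (c \<inter> d)) = prob (a \<inter> b) * prob (c \<inter> d)"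
      by (simp add: Int_ac)
  qed (use EF DF Fev in \<open>auto intro: Int_stable_process_events space_process_events preimages_Int_stable\<close>)
  show "indep_set (process_events P {0..s} (\<lambda>t \<omega>. stack (V t \<omega>) (W t \<omega>)))
      {(\<lambda>\<omega>. stack (V t \<omega>) (W t \<omega>) - stack (V s \<omega>) (W s \<omega>)) -` A \<inter> space P |A. A \<in> sets borel}"
    unfolding dstack
  proof (rule indep_set_mono[OF joint process_events_stack], safe)
    fix A :: "(real^('a + 'b)) set" assume "A \<in> sets borel"
    then show "(\<lambda>\<omega>. stack (?dV \<omega>) (?dW \<omega>)) -` A \<inter> space P \<in> sigma_sets (space P) (?D1 \<union> ?D2)"
      by (rule preimage_in_sigma_sets_stack[rotated 3]) auto
  qed
qed

lemma solves_sde_stack: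
  assumes Y: "solves_sde P B S y V Y" and Z: "solves_sde P C T z W Z"
    and B: "continuous_on UNIV B" and C: "continuous_on UNIV C"
  shows "solves_sde P (\<lambda>x. stack (B (upper x)) (C (lower x))) (block_matrix S 0 0 T) (stack y z)
     (\<lambda>t \<omega>. stack (V t \<omega>) (W t \<omega>)) (\<lambda>t \<omega>. stack (Y t \<omega>) (Z t \<omega>))"
  unfolding solves_sde_def
proof (intro conjI allI impI)
  have m: "Y t \<in> borel_measurable P" "Z t \<in> borel_measurable P" if "0 \<le> t" for t
    using Y Z that by (auto simp: solves_sde_def)
  show "(\<lambda>\<omega>. stack (Y t \<omega>) (Z t \<omega>)) \<in> borel_measurable P" if "0 \<le> t" for t
    using m[OF that] by measurable
  have "AE \<omega> in P. continuous_on {0..} (\<lambda>t. Y t \<omega>) \<and> (\<forall>t\<ge>0. Y t \<omega> = y + integral {0..t} (\<lambda>s. B (Y s \<omega>)) + S *v V t \<omega>)"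
    "AE \<omega> in P. continuous_on {0..} (\<lambda>t. Z t \<omega>) \<and> (\<forall>t\<ge>0. Z t \<omega> = z + integral {0..t} (\<lambda>s. C (Z s \<omega>)) + T *v W t \<omega>)"
    using Y Z by (auto simp: solves_sde_def)
  then show "AE \<omega> in P. continuous_on {0..} (\<lambda>t. stack (Y t \<omega>) (Z t \<omega>)) \<and>
      (\<forall>t\<ge>0. stack (Y t \<omega>) (Z t \<omega>) = stack y z + integral {0..t} (\<lambda>s. stack (B (upper (stack (Y s \<omega>) (Z s \<omega>)))) (C (lower (stack (Y s \<omega>) (Z s \<omega>))))) +
         block_matrix S 0 0 T *v stack (V t \<omega>) (W t \<omega>))"
  proof eventually_elim
    case (elim \<omega>)
    have cB: "continuous_on {0..t} (\<lambda>s. B (Y s \<omega>))" and cC: "continuous_on {0..t} (\<lambda>s. C (Z s \<omega>))" for t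
    proof -
      have "continuous_on {0..t} (\<lambda>t. Y t \<omega>)" "continuous_on {0..t} (\<lambda>t. Z t \<omega>)"
        using elim by (auto elim: continuous_on_subset)
      then show "continuous_on {0..t} (\<lambda>s. B (Y s \<omega>))" "continuous_on {0..t} (\<lambda>s. C (Z s \<omega>))"
        by (auto intro: continuous_on_compose2[OF B] continuous_on_compose2[OF C])
    qed
    have "integral {0..t} (\<lambda>s. stack (B (Y s \<omega>)) (C (Z s \<omega>))) =
        stack (integral {0..t} (\<lambda>s. B (Y s \<omega>))) (integral {0..t} (\<lambda>s. C (Z s \<omega>)))" for t
      by (intro integral_unique has_integral_stack integrable_integral integrable_continuous_real cB cC)
    then show ?case using elim by (auto intro!: continuous_on_stack simp: block_matrix_vec stack_add)
  qed
qed

lemma lipschitz_stack: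
  fixes B :: "real^'a \<Rightarrow> real^'c" and C :: "real^'b \<Rightarrow> real^'d"
  assumes "L-lipschitz_on UNIV B" "M-lipschitz_on UNIV C"
  shows "(L + M)-lipschitz_on UNIV (\<lambda>x. stack (B (upper x)) (C (lower x)))"
proof (rule lipschitz_onI)
  have LM: "0 \<le> L" "0 \<le> M" using lipschitz_on_nonneg assms by auto
  then show "0 \<le> L + M" by simp
  fix x x' :: "real^('a + 'b)"
  have "norm (B (upper x) - B (upper x')) \<le> L * norm (x - x')"
    using lipschitz_onD[OF assms(1), of "upper x" "upper x'"] mult_left_mono[OF norm_upper_le[of "x - x'"] LM(1)]
    by (simp add: dist_norm upper_diff)
  moreover have "norm (C (lower x) - C (lower x')) \<le> M * norm (x - x')"
    using lipschitz_onD[OF assms(2), of "lower x" "lower x'"] mult_left_mono[OF norm_lower_le[of "x - x'"] LM(2)]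
    by (simp add: dist_norm lower_diff)
  ultimately show "dist (stack (B (upper x)) (C (lower x))) (stack (B (upper x')) (C (lower x'))) \<le> (L + M) * dist x x'"
    using norm_stack_le[of "B (upper x) - B (upper x')" "C (lower x) - C (lower x')"]
    by (simp add: dist_norm stack_diff distrib_right)
qed

definition second_moment_bounded :: "'w measure \<Rightarrow> (real \<Rightarrow> 'w \<Rightarrow> 'b::real_normed_vector) \<Rightarrow> bool" where
  "second_moment_bounded P Y \<longleftrightarrow> (\<exists>K\<ge>0. \<forall>t\<ge>0. mean_square P (Y t) \<le> ennreal K)"

lemma bounded_moments_second:
  assumes "bounded_moments P Y"
  shows "second_moment_bounded P Y"
proof -
  let ?S = "SUP t\<in>{0..}. \<integral>\<^sup>+\<omega>. ennreal (norm (Y t \<omega>) powr 2) \<partial>P"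
  have fin: "?S < \<infinity>" using assms unfolding bounded_moments_def by (metis zero_le_numeral)
  have p: "x powr 2 = x\<^sup>2" if "0 \<le> x" for x :: real using that by (cases "x = 0") auto
  show ?thesis unfolding second_moment_bounded_def
  proof (intro exI[of _ "enn2real ?S"] conjI allI impI)
    fix t :: real assume "0 \<le> t"
    then have "(\<integral>\<^sup>+\<omega>. ennreal (norm (Y t \<omega>) powr 2) \<partial>P) \<le> ?S" by (intro SUP_upper) auto
    also have "?S = ennreal (enn2real ?S)" using fin by simp
    finally show "mean_square P (Y t) \<le> ennreal (enn2real ?S)" by (simp add: p)
  qed simp
qed

lemma second_moment_bounded_stack:
  fixes Y :: "real \<Rightarrow> 'w \<Rightarrow> real^'a" and Z :: "real \<Rightarrow> 'w \<Rightarrow> real^'b"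
  assumes Y: "second_moment_bounded P Y" and Z: "second_moment_bounded P Z"
    and m: "\<And>t. 0 \<le> t \<Longrightarrow> Y t \<in> borel_measurable P" "\<And>t. 0 \<le> t \<Longrightarrow> Z t \<in> borel_measurable P"
  shows "second_moment_bounded P (\<lambda>t \<omega>. stack (Y t \<omega>) (Z t \<omega>))"
proof -
  obtain K where K: "0 \<le> K" "\<And>t. 0 \<le> t \<Longrightarrow> mean_square P (Y t) \<le> ennreal K"
    using Y unfolding second_moment_bounded_def by blast
  obtain K' where K': "0 \<le> K'" "\<And>t. 0 \<le> t \<Longrightarrow> mean_square P (Z t) \<le> ennreal K'"
    using Z unfolding second_moment_bounded_def by blast
  show ?thesis unfolding second_moment_bounded_def
  proof (intro exI[of _ "K + K'"] conjI allI impI)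
    fix t :: real assume t: "0 \<le> t"
    note [measurable] = m(1)[OF t] m(2)[OF t]
    have "mean_square P (\<lambda>\<omega>. stack (Y t \<omega>) (Z t \<omega>)) =
        mean_square P (Y t) + mean_square P (Z t)"
      by (simp add: norm_stack_sq nn_integral_add)
    also have "\<dots> \<le> ennreal K + ennreal K'" by (intro add_mono K K' t)
    finally show "mean_square P (\<lambda>\<omega>. stack (Y t \<omega>) (Z t \<omega>)) \<le> ennreal (K + K')"
      using K(1) K'(1) by simp
  qed (use K K' in simp)
qed

text \<open>Grouping four independent families two by two, which prepares two rounds of stacking.\<close>

lemma (in prob_space) indep_sets_pairs:
  assumes ind: "indep_sets (\<lambda>i. [E0, E1, E2, E3] ! i) {..<4::nat}"
    and Int: "Int_stable E0" "Int_stable E1" "Int_stable E2" "Int_stable E3"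
    and space: "space M \<in> E0" "space M \<in> E1" "space M \<in> E2" "space M \<in> E3"
  shows "indep_set E0 E1" "indep_set E2 E3"
    "indep_set (sigma_sets (space M) (E0 \<union> E1)) (sigma_sets (space M) (E2 \<union> E3))"
proof -
  let ?E = "\<lambda>i. [E0, E1, E2, E3] ! i"
  have all: "(\<forall>i\<in>{..<4::nat}. Q i) \<longleftrightarrow> Q 0 \<and> Q 1 \<and> Q 2 \<and> Q 3" for Q
    by (auto simp: numeral_eq_Suc lessThan_Suc)
  have "\<forall>i\<in>{..<4}. ?E i \<subseteq> events" using ind by (simp add: indep_sets_def)
  then have ev: "E0 \<subseteq> events" "E1 \<subseteq> events" "E2 \<subseteq> events" "E3 \<subseteq> events"
    unfolding all by (simp_all add: numeral_eq_Suc)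
  have prod4: "prob (a \<inter> b \<inter> (c \<inter> d)) = prob a * prob b * (prob c * prob d)"
    if "a \<in> E0" "b \<in> E1" "c \<in> E2" "d \<in> E3" for a b c d
  proof -
    have "\<forall>j\<in>{..<4::nat}. [a, b, c, d] ! j \<in> ?E j" unfolding all using that by (simp add: numeral_eq_Suc)
    then have "prob (\<Inter>j\<in>{..<4::nat}. [a, b, c, d] ! j) = (\<Prod>j\<in>{..<4::nat}. prob ([a, b, c, d] ! j))"
      by (intro indep_setsD[OF ind]) (auto simp: lessThan_empty_iff)
    moreover have "(\<Inter>j\<in>{..<4::nat}. [a, b, c, d] ! j) = a \<inter> b \<inter> (c \<inter> d)"
      by (auto simp: numeral_eq_Suc lessThan_Suc)
    moreover have "(\<Prod>j\<in>{..<4::nat}. prob ([a, b, c, d] ! j)) = prob a * prob b * (prob c * prob d)"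
      by (simp add: numeral_eq_Suc lessThan_Suc mult_ac)
    ultimately show ?thesis by simp
  qed
  have cap: "a \<inter> space M = a" "space M \<inter> a = a" if "a \<in> events" for a
    using sets.sets_into_space[OF that] by auto
  have p01: "prob (a \<inter> b) = prob a * prob b" if ab: "a \<in> E0" "b \<in> E1" for a b
  proof -
    have "a \<inter> b \<in> events" using ab ev by auto
    then show ?thesis using prod4[OF ab space(3,4)] by (simp add: prob_space cap)
  qed
  have p23: "prob (c \<inter> d) = prob c * prob d" if cd: "c \<in> E2" "d \<in> E3" for c d
  proof -
    have "c \<inter> d \<in> events" using cd ev by auto
    then show ?thesis using prod4[OF space(1,2) cd] by (simp add: prob_space cap)
  qed
  show "indep_set E0 E1" by (rule indep_setI[OF ev(1,2) p01])
  show "indep_set E2 E3" by (rule indep_setI[OF ev(3,4) p23])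
  show "indep_set (sigma_sets (space M) (E0 \<union> E1)) (sigma_sets (space M) (E2 \<union> E3))"
    by (rule indep_set_joint[OF ev Int space]) (simp add: prod4 p01 p23)
qed

section \<open>The factor model\<close>

text \<open>\<open>A\<close> is the loading matrix of the stacked latent processes \<open>\<xi>, \<delta>, \<epsilon>, \<zeta>\<close>, after the structural equation
has been solved for \<open>\<eta>\<close>, and \<open>S\<close> is their joint diffusion coefficient.\<close>

lemma cov_structure_factorization:
  fixes Lx1 :: "real^'k1^'p1" and Lx2 :: "real^'k2^'p2" and \<Gamma> :: "real^'k1^'k2" and \<Psi> :: "real^'k2^'k2"
    and S1 :: "real^'r1^'k1" and S2 :: "real^'r2^'p1" and S3 :: "real^'r3^'p2" and S4 :: "real^'r4^'k2"
  defines "M \<equiv> Lx2 ** matrix_inv \<Psi>"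
  defines "A \<equiv> block_matrix (hstack Lx1 (mat 1)) 0 (hstack (M ** \<Gamma>) 0) (hstack (mat 1) M)"
    and "S \<equiv> block_matrix (block_matrix S1 0 0 S2) 0 0 (block_matrix S3 0 0 S4)"
  shows "(A ** S) ** transpose (A ** S) = cov_structure Lx1 Lx2 \<Gamma> \<Psi> (S1 ** transpose S1) (S2 ** transpose S2)
     (S3 ** transpose S3) (S4 ** transpose S4)"
proof -
  have AS: "A ** S = block_matrix (hstack (Lx1 ** S1) S2) 0 (hstack (M ** \<Gamma> ** S1) 0) (hstack S3 (M ** S4))"
    by (simp add: A_def S_def block_matrix_mult hstack_mult_diag)
  show ?thesis
    unfolding AS transpose_block_matrix block_matrix_mult hstack_mult_transpose cov_structure_def Let_def
    by (simp add: M_def matrix_transpose_mul matrix_mul_assoc matrix_add_ldistrib matrix_mult_add_left ac_simps)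
qed

theorem theorem1:
  fixes P :: "'w measure"
    and \<Theta> :: "(real^'q) set" and \<theta> :: "real^'q"
    and Lx1 :: "real^'q \<Rightarrow> (real^'k1, 'p1 :: {finite, linorder}) vec"
    and Lx2 :: "real^'q \<Rightarrow> (real^'k2, 'p2 :: {finite, linorder}) vec"
    and \<Gamma> :: "real^'q \<Rightarrow> real^'k1^'k2"
    and B0 \<Psi> :: "real^'q \<Rightarrow> real^'k2^'k2"
    and S1 :: "real^'q \<Rightarrow> real^'r1^'k1" and S2 :: "real^'q \<Rightarrow> (real^'r2, 'p1) vec"
    and S3 :: "real^'q \<Rightarrow> (real^'r3, 'p2) vec" and S4 :: "real^'q \<Rightarrow> real^'r4^'k2"
    and \<Sigma>\<xi> :: "real^'q \<Rightarrow> real^'k1^'k1" and \<Sigma>\<delta> :: "real^'q \<Rightarrow> ((real, 'p1) vec, 'p1) vec"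
    and \<Sigma>\<epsilon> :: "real^'q \<Rightarrow> ((real, 'p2) vec, 'p2) vec" and \<Sigma>\<zeta> :: "real^'q \<Rightarrow> real^'k2^'k2"
    and \<Sigma> :: "real^'q \<Rightarrow> real^('p1 + 'p2)^('p1 + 'p2)"
    and B1 :: "real^'k1 \<Rightarrow> real^'k1" and B2 :: "(real, 'p1) vec \<Rightarrow> (real, 'p1) vec"
    and B3 :: "(real, 'p2) vec \<Rightarrow> (real, 'p2) vec" and B4 :: "real^'k2 \<Rightarrow> real^'k2"
    and W1 :: "real \<Rightarrow> 'w \<Rightarrow> real^'r1" and W2 :: "real \<Rightarrow> 'w \<Rightarrow> real^'r2"
    and W3 :: "real \<Rightarrow> 'w \<Rightarrow> real^'r3" and W4 :: "real \<Rightarrow> 'w \<Rightarrow> real^'r4"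
    and \<xi> :: "real \<Rightarrow> 'w \<Rightarrow> real^'k1" and \<delta> :: "real \<Rightarrow> 'w \<Rightarrow> (real, 'p1) vec"
    and \<epsilon> :: "real \<Rightarrow> 'w \<Rightarrow> (real, 'p2) vec" and \<zeta> \<eta> :: "real \<Rightarrow> 'w \<Rightarrow> real^'k2"
    and X1 :: "real \<Rightarrow> 'w \<Rightarrow> (real, 'p1) vec" and X2 :: "real \<Rightarrow> 'w \<Rightarrow> (real, 'p2) vec"
    and X :: "real \<Rightarrow> 'w \<Rightarrow> real^('p1 + 'p2)"
    and \<xi>0 :: "real^'k1" and \<delta>0 :: "(real, 'p1) vec" and \<epsilon>0 :: "(real, 'p2) vec" and \<zeta>0 :: "real^'k2"
    and h :: "nat \<Rightarrow> real"
  defines "\<Psi> \<equiv> \<lambda>\<theta>. mat 1 - B0 \<theta>"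
    and "\<Sigma>\<xi> \<equiv> \<lambda>\<theta>. S1 \<theta> ** transpose (S1 \<theta>)"
    and "\<Sigma>\<delta> \<equiv> \<lambda>\<theta>. S2 \<theta> ** transpose (S2 \<theta>)"
    and "\<Sigma>\<epsilon> \<equiv> \<lambda>\<theta>. S3 \<theta> ** transpose (S3 \<theta>)"
    and "\<Sigma>\<zeta> \<equiv> \<lambda>\<theta>. S4 \<theta> ** transpose (S4 \<theta>)"
    and "\<Sigma> \<equiv> \<lambda>\<theta>. cov_structure (Lx1 \<theta>) (Lx2 \<theta>) (\<Gamma> \<theta>) (\<Psi> \<theta>) (\<Sigma>\<xi> \<theta>) (\<Sigma>\<delta> \<theta>) (\<Sigma>\<epsilon> \<theta>) (\<Sigma>\<zeta> \<theta>)"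
  assumes dims: "CARD('k1) \<le> CARD('p1)" "CARD('k2) \<le> CARD('p2)"
    and param_space: "convex \<Theta>" "compact \<Theta>" "\<theta> \<in> \<Theta>"
    and B0_diag: "\<And>\<theta>' i. \<theta>' \<in> \<Theta> \<Longrightarrow> B0 \<theta>' $ i $ i = 0"
    and param: "collects_entries \<Theta> (entries Lx1 \<union> entries Lx2 \<union> entries \<Gamma> \<union> entries \<Psi> \<union>
          entries \<Sigma>\<xi> \<union> entries \<Sigma>\<delta> \<union> entries \<Sigma>\<epsilon> \<union> entries \<Sigma>\<zeta>)"
    and prob: "prob_space P"
    and wiener: "wiener_process P W1" "wiener_process P W2"
          "wiener_process P W3" "wiener_process P W4"
    and wiener_indep: "prob_space.indep_sets P
          (\<lambda>i. [process_events P {0..} W1, process_events P {0..} W2,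
                process_events P {0..} W3, process_events P {0..} W4] ! i) {..<4}"
    and latent: "solves_sde P B1 (S1 \<theta>) \<xi>0 W1 \<xi>" "solves_sde P B2 (S2 \<theta>) \<delta>0 W2 \<delta>"
          "solves_sde P B3 (S3 \<theta>) \<epsilon>0 W3 \<epsilon>" "solves_sde P B4 (S4 \<theta>) \<zeta>0 W4 \<zeta>"
    and X1_eq: "\<And>t \<omega>. 0 \<le> t \<Longrightarrow> \<omega> \<in> space P \<Longrightarrow> X1 t \<omega> = Lx1 \<theta> *v \<xi> t \<omega> + \<delta> t \<omega>"
    and X2_eq: "\<And>t \<omega>. 0 \<le> t \<Longrightarrow> \<omega> \<in> space P \<Longrightarrow> X2 t \<omega> = Lx2 \<theta> *v \<eta> t \<omega> + \<epsilon> t \<omega>"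
    and \<eta>_eq: "\<And>t \<omega>. 0 \<le> t \<Longrightarrow> \<omega> \<in> space P \<Longrightarrow>
          \<eta> t \<omega> = B0 \<theta> *v \<eta> t \<omega> + \<Gamma> \<theta> *v \<xi> t \<omega> + \<zeta> t \<omega>"
    and X_eq: "\<And>t \<omega>. 0 \<le> t \<Longrightarrow> \<omega> \<in> space P \<Longrightarrow> X t \<omega> = stack (X1 t \<omega>) (X2 t \<omega>)"
    and lipschitz: "\<exists>L. L-lipschitz_on UNIV B1" "\<exists>L. L-lipschitz_on UNIV B2"
          "\<exists>L. L-lipschitz_on UNIV B3" "\<exists>L. L-lipschitz_on UNIV B4"
    and smooth: "C_poly 4 B1" "C_poly 4 B2" "C_poly 4 B3" "C_poly 4 B4"
    and moments: "bounded_moments P \<xi>" "bounded_moments P \<delta>"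
          "bounded_moments P \<epsilon>" "bounded_moments P \<zeta>"
    and ergodic: "\<exists>\<pi>. ergodic_with P \<xi> \<pi>" "\<exists>\<pi>. ergodic_with P \<delta> \<pi>"
          "\<exists>\<pi>. ergodic_with P \<epsilon> \<pi>" "\<exists>\<pi>. ergodic_with P \<zeta> \<pi>"
    and cov_pos: "pos_def (\<Sigma>\<delta> \<theta>)" "pos_def (\<Sigma>\<epsilon> \<theta>)"
    and \<Psi>_inv: "invertible (\<Psi> \<theta>)"
    and Lx1_rank: "rank (Lx1 \<theta>) = CARD('k1)"
    and h_pos: "\<And>n. 1 \<le> n \<Longrightarrow> 0 < h n"
    and h_lim: "h \<longlonglongrightarrow> 0"
    and nh_lim: "filterlim (\<lambda>n. real n * h n) at_top sequentially"
  shows "converges_in_prob P sequentially (\<lambda>n. realized_cov X (h n) n) (\<Sigma> \<theta>) \<and>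
    ((\<lambda>n. real n * (h n)\<^sup>2) \<longlonglongrightarrow> 0 \<longrightarrow>
       (\<exists>N. is_normal_law 0 (asym_cov (\<Sigma> \<theta>)) N \<and>
          converges_in_distribution P
            (\<lambda>n \<omega>. sqrt (real n) *\<^sub>R (vech (realized_cov X (h n) n \<omega>) - vech (\<Sigma> \<theta>))) N))"
proof -
  interpret prob_space P by (rule prob)
  define Y where "Y t \<omega> = stack (stack (\<xi> t \<omega>) (\<delta> t \<omega>)) (stack (\<epsilon> t \<omega>) (\<zeta> t \<omega>))" for t \<omega>
  define W where "W t \<omega> = stack (stack (W1 t \<omega>) (W2 t \<omega>)) (stack (W3 t \<omega>) (W4 t \<omega>))" for t \<omega>
  define B12 where "B12 x = stack (B1 (upper x)) (B2 (lower x))" for x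
  define B34 where "B34 x = stack (B3 (upper x)) (B4 (lower x))" for x
  define B where "B x = stack (B12 (upper x)) (B34 (lower x))" for x
  define S where "S = block_matrix (block_matrix (S1 \<theta>) 0 0 (S2 \<theta>)) 0 0 (block_matrix (S3 \<theta>) 0 0 (S4 \<theta>))"
  define M where "M = Lx2 \<theta> ** matrix_inv (\<Psi> \<theta>)"
  define A where "A = block_matrix (hstack (Lx1 \<theta>) (mat 1)) 0 (hstack (M ** \<Gamma> \<theta>) 0) (hstack (mat 1) M)"
  define y where "y = stack (stack \<xi>0 \<delta>0) (stack \<epsilon>0 \<zeta>0)"
  have \<Sigma>: "(A ** S) ** transpose (A ** S) = \<Sigma> \<theta>"
    unfolding A_def S_def M_def cov_structure_factorization \<Sigma>_def \<Sigma>\<xi>_def \<Sigma>\<delta>_def \<Sigma>\<epsilon>_def \<Sigma>\<zeta>_def ..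
  \<comment> \<open>Two rounds of stacking: first \<open>W1\<close> with \<open>W2\<close> and \<open>W3\<close> with \<open>W4\<close>, then the two pairs.\<close>
  note pe = Int_stable_process_events Int_stable_process_events Int_stable_process_events Int_stable_process_events
    space_process_events space_process_events space_process_events space_process_events
  note pairs = indep_sets_pairs[OF wiener_indep pe]
  have W: "wiener_process P W"
    unfolding W_def
  proof (intro wiener_process_stack prob wiener pairs(1,2))
    show "indep_set (process_events P {0..} (\<lambda>t \<omega>. stack (W1 t \<omega>) (W2 t \<omega>)))
        (process_events P {0..} (\<lambda>t \<omega>. stack (W3 t \<omega>) (W4 t \<omega>)))"
      by (rule indep_set_mono[OF pairs(3) process_events_stack process_events_stack])
  qed
  obtain L1 L2 L3 L4 where L: "L1-lipschitz_on UNIV B1" "L2-lipschitz_on UNIV B2" "L3-lipschitz_on UNIV B3" "L4-lipschitz_on UNIV B4"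
    using lipschitz by blast
  have L12: "(L1 + L2)-lipschitz_on UNIV B12" and L34: "(L3 + L4)-lipschitz_on UNIV B34"
    unfolding B12_def B34_def by (intro lipschitz_stack L)+
  have LB: "(L1 + L2 + (L3 + L4))-lipschitz_on UNIV B"
    unfolding B_def by (rule lipschitz_stack[OF L12 L34])
  note cont = lipschitz_on_continuous_on[OF L(1)] lipschitz_on_continuous_on[OF L(2)]
    lipschitz_on_continuous_on[OF L(3)] lipschitz_on_continuous_on[OF L(4)]
  have s12: "solves_sde P B12 (block_matrix (S1 \<theta>) 0 0 (S2 \<theta>)) (stack \<xi>0 \<delta>0) (\<lambda>t \<omega>. stack (W1 t \<omega>) (W2 t \<omega>)) (\<lambda>t \<omega>. stack (\<xi> t \<omega>) (\<delta> t \<omega>))"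
    unfolding B12_def by (rule solves_sde_stack[OF latent(1,2) cont(1,2)])
  have s34: "solves_sde P B34 (block_matrix (S3 \<theta>) 0 0 (S4 \<theta>)) (stack \<epsilon>0 \<zeta>0) (\<lambda>t \<omega>. stack (W3 t \<omega>) (W4 t \<omega>)) (\<lambda>t \<omega>. stack (\<epsilon> t \<omega>) (\<zeta> t \<omega>))"
    unfolding B34_def by (rule solves_sde_stack[OF latent(3,4) cont(3,4)])
  have sde: "solves_sde P B S y W Y"
    unfolding B_def S_def y_def W_def Y_def
    by (rule solves_sde_stack[OF s12 s34 lipschitz_on_continuous_on[OF L12] lipschitz_on_continuous_on[OF L34]])
  have m: "\<xi> t \<in> borel_measurable P" "\<delta> t \<in> borel_measurable P" "\<epsilon> t \<in> borel_measurable P" "\<zeta> t \<in> borel_measurable P"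
    if "0 \<le> t" for t using latent that by (auto simp: solves_sde_def)
  have "second_moment_bounded P Y"
    unfolding Y_def
    by (intro second_moment_bounded_stack bounded_moments_second moments measurable_stack m)
  then obtain K where K: "0 \<le> K" "\<And>t. 0 \<le> t \<Longrightarrow> mean_square P (Y t) \<le> ennreal K"
    unfolding second_moment_bounded_def by blast
  have X: "X t \<omega> = A *v Y t \<omega>" if t: "0 \<le> t" and \<omega>: "\<omega> \<in> space P" for t \<omega>
  proof -
    \<comment> \<open>The structural equation reads \<open>\<Psi> \<eta> = \<Gamma> \<xi> + \<zeta>\<close>.\<close>
    have inv: "matrix_inv (\<Psi> \<theta>) ** \<Psi> \<theta> = mat 1" by (rule matrix_inv_mult_left[OF \<Psi>_inv])
    have "\<Psi> \<theta> *v \<eta> t \<omega> = \<eta> t \<omega> - B0 \<theta> *v \<eta> t \<omega>"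
      by (simp add: \<Psi>_def matrix_vector_mult_diff_rdistrib)
    also have "\<dots> = \<Gamma> \<theta> *v \<xi> t \<omega> + \<zeta> t \<omega>" using \<eta>_eq[OF t \<omega>] by (simp add: algebra_simps)
    finally have "matrix_inv (\<Psi> \<theta>) *v (\<Psi> \<theta> *v \<eta> t \<omega>) = matrix_inv (\<Psi> \<theta>) *v (\<Gamma> \<theta> *v \<xi> t \<omega> + \<zeta> t \<omega>)" by simp
    then have \<eta>: "\<eta> t \<omega> = matrix_inv (\<Psi> \<theta>) *v (\<Gamma> \<theta> *v \<xi> t \<omega> + \<zeta> t \<omega>)"
      by (simp add: matrix_vector_mul_assoc inv)
    show ?thesis
      unfolding X_eq[OF t \<omega>] X1_eq[OF t \<omega>] X2_eq[OF t \<omega>] \<eta>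
      by (simp add: A_def Y_def M_def block_matrix_vec hstack_vec matrix_vector_mul_assoc[symmetric]
          matrix_vector_right_distrib add_ac)
  qed
  have obs: "linear_sde_observation P W Y B S y A X (L1 + L2 + (L3 + L4)) K"
    by unfold_locales (use W sde LB K X in auto)
  have h0: "0 < n \<Longrightarrow> 0 < h n" for n using h_pos[of n] by simp
  interpret obs: linear_sde_observation P W Y B S y A X "L1 + L2 + (L3 + L4)" K by (rule obs)
  have "obs.\<Sigma>X = \<Sigma> \<theta>" unfolding obs.\<Sigma>X_def obs.G_def by (rule \<Sigma>)
  then have "converges_in_prob P sequentially (\<lambda>n. realized_cov X (h n) n) (\<Sigma> \<theta>)"
    using obs.realized_cov_consistent[of h, OF h0 h_lim] by simp
  moreover have "\<exists>N. is_normal_law 0 (asym_cov (\<Sigma> \<theta>)) N \<and> converges_in_distribution P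
     (\<lambda>n \<omega>. sqrt (real n) *\<^sub>R (vech (realized_cov X (h n) n \<omega>) - vech (\<Sigma> \<theta>))) N"
    if "(\<lambda>n. real n * (h n)\<^sup>2) \<longlonglongrightarrow> 0"
    using realized_cov_clt[OF obs h0 h_lim that] unfolding \<Sigma> .
  ultimately show ?thesis by blast
qed

end
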